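(* Let $V$ and $W$ be optimal computers, and let $f\colon \mathbb{N}^+\to\mathbb{N}$ be a total recursive function. Then the following two conditions are equivalent: (i) There exist an oracle deterministic Turing machine $M$ and $c\in\mathbb{N}$ such that, for all $n\in\mathbb{N}^+$, $M^{\mathrm{Dom}\,V\restriction n}(n)=\Omega_W\restriction(n-f(n)-c)$. (ii) $\sum_{n=1}^\infty 2^{-f(n)}<\infty$.
   Context: $\{0,1\}^*$ is the set of finite binary strings, ordered $\lambda,0,1,00,01,\dots$ ($\lambda$ the empty string); natural numbers are identified with strings via this order. A set of strings is prefix-free if no element is a proper prefix of another. A computer is a partial recursive function $C\colon\{0,1\}^*\to\{0,1\}^*$ whose domain $\mathrm{Dom}\,C$ is prefix-free. A computer $U$ is optimal if for every computer $C$ there is $d\in\mathbb{N}$ such that for every $p\in\mathrm{Dom}\,C$ there is $q$ with $U(q)=C(p)$ and $|q|\le|p|+d$. For an optimal computer $V$, $\Omega_V=\sum_{p\in\mathrm{Dom}\,V}2^{-|p|}$. For a set $S\subseteq\{0,1\}^*$ and $n\in\mathbb{Z}$, $S\restriction n=\{s\in S: |s|\le n\}$ (empty if $n<0$). For a real $\alpha$ and $n\in\mathbb{N}^+$, $\alpha\restriction n$ is the string of the first $n$ bits of the base-two expansion of $\alpha-\lfloor\alpha\rfloor$ (the expansion with infinitely many zeros, when there is a choice); for integers $n\le 0$, $\alpha\restriction n=\lambda$. $M^{A}(n)$ denotes the output of the oracle machine $M$ on input $n$ with oracle the set $A$. *)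

theory Defs
  imports "HOL-Analysis.Infinite_Sum" "HOL-Library.Sublist"
begin

section \<open>Strings and natural numbers\<close>

type_synonym str = "bool list"

text \<open>Position of a string in the length-lexicographic order \<open>\<lambda>, 0, 1, 00, 01, \<dots>\<close>;
  the leftmost character is the head of the list, and \<open>True\<close> is the digit 1.\<close>

definition str_num :: "str \<Rightarrow> nat" where
  "str_num s = foldl (\<lambda>n b. 2 * n + (if b then 2 else 1)) 0 s"

definition num_str :: "nat \<Rightarrow> str" where
  "num_str = inv str_num"

lemma str_num_Nil [simp]: "str_num [] = 0"
  by (simp add: str_num_def)

lemma str_num_snoc [simp]: "str_num (s @ [b]) = 2 * str_num s + (if b then 2 else 1)"
  by (simp add: str_num_def)

lemma bij_str_num: "bij str_num"
proof (rule bijI)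
  show "inj str_num"
  proof (rule injI)
    fix s t :: str
    assume "str_num s = str_num t"
    then show "s = t"
    proof (induction s arbitrary: t rule: rev_induct)
      case Nil
      then show ?case
        by (cases t rule: rev_cases) (auto split: if_splits)
    next
      case (snoc b s)
      then obtain t' b' where t: "t = t' @ [b']"
        by (cases t rule: rev_cases) (auto split: if_splits)
      have eq: "2 * str_num s + (if b then 2 else 1) = 2 * str_num t' + (if b' then 2 else 1)"
        using snoc.prems t by simp
      then have "b = b'"
        by (cases b; cases b') (simp_all, presburger+)
      with eq have "str_num s = str_num t'"
        by simp
      with snoc.IH \<open>b = b'\<close> t show ?case
        by simp
    qed
  qed
next
  have "\<exists>s. str_num s = n" for n
  proof (induction n rule: less_induct)
    case (less n)
    show ?case
    proof (cases "n = 0")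
      case True
      then show ?thesis
        using str_num_Nil by blast
    next
      case False
      then have "(n - 1) div 2 < n"
        by simp
      then obtain s where s: "str_num s = (n - 1) div 2"
        using less by blast
      have "str_num (s @ [even n]) = n"
        using False s by (auto elim!: evenE oddE)
      then show ?thesis
        by blast
    qed
  qed
  then show "surj str_num"
    by (metis surjI)
qed

lemma str_num_num_str [simp]: "str_num (num_str n) = n"
  using bij_str_num by (simp add: num_str_def bij_is_surj surj_f_inv_f)

lemma num_str_str_num [simp]: "num_str (str_num s) = s"
  using bij_str_num by (simp add: num_str_def bij_is_inj)


section \<open>Partial recursive functions\<close>

text \<open>Kleene's partial recursive functions. \<open>partrec n F\<close> is meaningful only for the values
  of \<open>F\<close> at argument lists of length \<open>n\<close>; \<open>None\<close> means undefined. Composition and primitive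
  recursion are strict, and minimisation requires all earlier values to be defined.\<close>

inductive partrec :: "nat \<Rightarrow> (nat list \<Rightarrow> nat option) \<Rightarrow> bool" where
  zero: "partrec n (\<lambda>xs. Some 0)"
| succ: "partrec 1 (\<lambda>xs. Some (Suc (hd xs)))"
| proj: "i < n \<Longrightarrow> partrec n (\<lambda>xs. Some (xs ! i))"
| comp: "partrec (length Gs) F \<Longrightarrow> (\<forall>G\<in>set Gs. partrec n G) \<Longrightarrow>
    partrec n (\<lambda>xs. Option.bind (those (map (\<lambda>G. G xs) Gs)) F)"
| prim: "partrec n F \<Longrightarrow> partrec (Suc (Suc n)) G \<Longrightarrow>
    partrec (Suc n) (\<lambda>xs. rec_nat (F (tl xs))
      (\<lambda>y r. Option.bind r (\<lambda>v. G (y # v # tl xs))) (hd xs))"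
| mu: "partrec (Suc n) F \<Longrightarrow>
    partrec n (\<lambda>xs. if \<exists>z. F (z # xs) = Some 0 \<and> (\<forall>y<z. F (y # xs) \<noteq> None)
      then Some (LEAST z. F (z # xs) = Some 0) else None)"

definition partial_recursive :: "(nat \<Rightarrow> nat option) \<Rightarrow> bool" where
  "partial_recursive g \<longleftrightarrow> (\<exists>F. partrec 1 F \<and> (\<forall>x. F [x] = g x))"

text \<open>A total recursive function on the positive integers; the value at 0 is irrelevant.\<close>

definition total_recursive_pos :: "(nat \<Rightarrow> nat) \<Rightarrow> bool" where
  "total_recursive_pos f \<longleftrightarrow> partial_recursive (\<lambda>n. if 1 \<le> n then Some (f n) else None)"

definition partial_recursive_str :: "(str \<Rightarrow> str option) \<Rightarrow> bool" where
  "partial_recursive_str C \<longleftrightarrow> partial_recursive (\<lambda>x. map_option str_num (C (num_str x)))"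


section \<open>Optimal computers and halting probabilities\<close>

definition prefix_free :: "str set \<Rightarrow> bool" where
  "prefix_free S \<longleftrightarrow> (\<forall>s\<in>S. \<forall>t\<in>S. \<not> strict_prefix s t)"

definition computer :: "(str \<Rightarrow> str option) \<Rightarrow> bool" where
  "computer C \<longleftrightarrow> partial_recursive_str C \<and> prefix_free (dom C)"

definition optimal_computer :: "(str \<Rightarrow> str option) \<Rightarrow> bool" where
  "optimal_computer U \<longleftrightarrow> computer U \<and>
    (\<forall>C. computer C \<longrightarrow>
      (\<exists>d::nat. \<forall>p\<in>dom C. \<exists>q. U q = C p \<and> length q \<le> length p + d))"

text \<open>For a computer the family is summable by Kraft's inequality, so \<open>infsum\<close> takes its
  genuine value.\<close>

definition Omega :: "(str \<Rightarrow> str option) \<Rightarrow> real" where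
  "Omega V = (\<Sum>\<^sub>\<infinity>p\<in>dom V. 1 / 2 ^ length p)"

definition set_upto :: "str set \<Rightarrow> int \<Rightarrow> str set" where
  "set_upto S n = {s \<in> S. int (length s) \<le> n}"


section \<open>Binary expansions\<close>

text \<open>\<open>bin_digit \<alpha> i\<close> is the digit of weight \<open>1 / 2 ^ Suc i\<close> of the fractional part of
  \<open>\<alpha>\<close>; \<open>bin_digit_expansion\<close> below shows that these are the digits of the unique base-two
  expansion with infinitely many zeros.\<close>

definition bin_digit :: "real \<Rightarrow> nat \<Rightarrow> bool" where
  "bin_digit \<alpha> i \<longleftrightarrow> odd \<lfloor>2 ^ Suc i * frac \<alpha>\<rfloor>"

definition real_prefix :: "real \<Rightarrow> int \<Rightarrow> str" where
  "real_prefix \<alpha> n = map (bin_digit \<alpha>) [0..<nat n]"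

lemma geometric_tail: "(\<lambda>i. 1 / 2 ^ Suc (i + N) :: real) sums (1 / 2 ^ N)"
proof -
  have "(\<lambda>i. (1 / 2 ^ N) * (1 / 2) ^ Suc i :: real) sums ((1 / 2 ^ N) * 1)"
    by (intro sums_mult power_half_series)
  then show ?thesis
    by (simp add: power_add power_divide field_simps)
qed

lemma bin_digit_partial_sum:
  "(\<Sum>i<n. of_bool (bin_digit \<alpha> i) / 2 ^ Suc i) = real_of_int \<lfloor>2 ^ n * frac \<alpha>\<rfloor> / 2 ^ n"
proof (induction n)
  case 0
  then show ?case by (simp add: floor_eq_iff frac_ge_0 frac_lt_1)
next
  case (Suc n)
  define x where "x = 2 ^ n * frac \<alpha>"
  have "\<lfloor>2 * x\<rfloor> = 2 * \<lfloor>x\<rfloor> \<or> \<lfloor>2 * x\<rfloor> = 2 * \<lfloor>x\<rfloor> + 1"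
    by linarith
  then have "real_of_int \<lfloor>2 * x\<rfloor> = 2 * real_of_int \<lfloor>x\<rfloor> + of_bool (odd \<lfloor>2 * x\<rfloor>)"
    by auto
  then show ?case
    using Suc by (simp add: bin_digit_def x_def mult.assoc field_simps)
qed

lemma binary_tail:
  fixes b :: "nat \<Rightarrow> bool"
  assumes "\<exists>\<^sub>\<infinity>i. \<not> b i"
  shows "summable (\<lambda>i. of_bool (b (i + N)) / 2 ^ Suc (i + N) :: real)"
    and "0 \<le> (\<Sum>i. of_bool (b (i + N)) / 2 ^ Suc (i + N) :: real)"
    and "(\<Sum>i. of_bool (b (i + N)) / 2 ^ Suc (i + N)) < (1 / 2 ^ N :: real)"
proof -
  let ?g = "\<lambda>i. 1 / 2 ^ Suc (i + N) :: real"
  let ?h = "\<lambda>i. of_bool (b (i + N)) / 2 ^ Suc (i + N) :: real"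
  have g: "summable ?g" "suminf ?g = 1 / 2 ^ N"
    using geometric_tail sums_iff by blast+
  show h: "summable ?h"
    by (rule summable_comparison_test'[OF g(1), of 0]) auto
  show "0 \<le> suminf ?h"
    by (intro suminf_nonneg h) auto
  obtain k where "k \<ge> N" "\<not> b k"
    using assms unfolding INFM_nat_le by blast
  then obtain j where j: "\<not> b (j + N)"
    by (metis add.commute le_Suc_ex)
  have "0 < (\<Sum>i. ?g i - ?h i)"
  proof (rule suminf_pos2[where i = j])
    show "summable (\<lambda>i. ?g i - ?h i)"
      by (intro summable_diff g(1) h)
  qed (use j in \<open>auto simp: divide_right_mono\<close>)
  also have "\<dots> = 1 / 2 ^ N - suminf ?h"
    using suminf_diff[OF g(1) h] g(2) by simp
  finally show "suminf ?h < 1 / 2 ^ N"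
    by simp
qed

lemma bin_digit_sums: "(\<lambda>i. of_bool (bin_digit \<alpha> i) / 2 ^ Suc i) sums frac \<alpha>"
proof -
  have "(\<lambda>n. real_of_int \<lfloor>2 ^ n * frac \<alpha>\<rfloor> / 2 ^ n) \<longlonglongrightarrow> frac \<alpha>"
  proof (rule tendsto_sandwich[where f = "\<lambda>n. frac \<alpha> - (1 / 2) ^ n" and h = "\<lambda>n. frac \<alpha>"])
    have "frac \<alpha> - (1 / 2) ^ n \<le> real_of_int \<lfloor>2 ^ n * frac \<alpha>\<rfloor> / 2 ^ n" for n
    proof -
      have "2 ^ n * frac \<alpha> - 1 \<le> real_of_int \<lfloor>2 ^ n * frac \<alpha>\<rfloor>"
        by linarith
      then have "(2 ^ n * frac \<alpha> - 1) / 2 ^ n \<le> real_of_int \<lfloor>2 ^ n * frac \<alpha>\<rfloor> / 2 ^ n"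
        by (intro divide_right_mono) auto
      then show ?thesis
        by (simp add: diff_divide_distrib power_divide)
    qed
    then show "\<forall>\<^sub>F n in sequentially. frac \<alpha> - (1 / 2) ^ n \<le> real_of_int \<lfloor>2 ^ n * frac \<alpha>\<rfloor> / 2 ^ n"
      by simp
    have "real_of_int \<lfloor>2 ^ n * frac \<alpha>\<rfloor> / 2 ^ n \<le> frac \<alpha>" for n
      by (simp add: field_simps)
    then show "\<forall>\<^sub>F n in sequentially. real_of_int \<lfloor>2 ^ n * frac \<alpha>\<rfloor> / 2 ^ n \<le> frac \<alpha>"
      by simp
    have "(\<lambda>n. frac \<alpha> - (1 / 2) ^ n) \<longlonglongrightarrow> frac \<alpha> - 0"
      by (intro tendsto_diff tendsto_const LIMSEQ_power_zero) simp
    then show "(\<lambda>n. frac \<alpha> - (1 / 2) ^ n) \<longlonglongrightarrow> frac \<alpha>"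
      by simp
  qed simp
  then show ?thesis
    by (simp only: sums_def bin_digit_partial_sum)
qed

lemma bin_digit_INFM: "\<exists>\<^sub>\<infinity>i. \<not> bin_digit \<alpha> i"
proof (rule ccontr)
  assume "\<not> (\<exists>\<^sub>\<infinity>i. \<not> bin_digit \<alpha> i)"
  then obtain N where N: "\<And>i. i \<ge> N \<Longrightarrow> bin_digit \<alpha> i"
    unfolding INFM_nat_le by auto
  let ?h = "\<lambda>i. of_bool (bin_digit \<alpha> i) / 2 ^ Suc i :: real"
  have "(\<lambda>i. ?h (i + N)) sums (frac \<alpha> - sum ?h {..<N})"
    using bin_digit_sums[of \<alpha>] sums_iff_shift'[of ?h N "frac \<alpha>"] by blast
  moreover have "(\<lambda>i. ?h (i + N)) sums (1 / 2 ^ N)"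
    using geometric_tail[of N] N by simp
  ultimately have "frac \<alpha> - sum ?h {..<N} = 1 / 2 ^ N"
    by (rule sums_unique2)
  then have "2 ^ N * frac \<alpha> = real_of_int \<lfloor>2 ^ N * frac \<alpha>\<rfloor> + 1"
    unfolding bin_digit_partial_sum by (simp add: field_simps)
  then show False
    by linarith
qed

theorem bin_digit_expansion:
  fixes b :: "nat \<Rightarrow> bool"
  shows "(\<lambda>i. of_bool (b i) / 2 ^ Suc i) sums frac \<alpha> \<and> (\<exists>\<^sub>\<infinity>i. \<not> b i) \<longleftrightarrow> b = bin_digit \<alpha>"
proof
  assume asm: "(\<lambda>i. of_bool (b i) / 2 ^ Suc i) sums frac \<alpha> \<and> (\<exists>\<^sub>\<infinity>i. \<not> b i)"
  let ?h = "\<lambda>i. of_bool (b i) / 2 ^ Suc i :: real"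
  have ints: "\<exists>k::int. 2 ^ n * sum ?h {..<n} = real_of_int k \<and>
      2 ^ Suc n * sum ?h {..<Suc n} = real_of_int (2 * k + of_bool (b n))" for n
  proof (induction n)
    case 0
    then show ?case by (intro exI[of _ 0]) auto
  next
    case (Suc n)
    then obtain k :: int where "2 ^ Suc n * sum ?h {..<Suc n} = real_of_int (2 * k + of_bool (b n))"
      by blast
    then show ?case
      by (intro exI[of _ "2 * k + of_bool (b n)"]) (simp add: field_simps)
  qed
  have fl: "real_of_int \<lfloor>2 ^ n * frac \<alpha>\<rfloor> = 2 ^ n * sum ?h {..<n}" for n
  proof -
    obtain k :: int where k: "2 ^ n * sum ?h {..<n} = real_of_int k"
      using ints by blast
    have "frac \<alpha> = (\<Sum>i. ?h (i + n)) + sum ?h {..<n}"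
      using asm suminf_split_initial_segment[of ?h n] by (simp add: sums_iff)
    then have "2 ^ n * frac \<alpha> = 2 ^ n * (\<Sum>i. ?h (i + n)) + real_of_int k"
      using k by (simp add: distrib_left)
    moreover have "0 \<le> 2 ^ n * (\<Sum>i. ?h (i + n))" "2 ^ n * (\<Sum>i. ?h (i + n)) < 1"
      using binary_tail(2,3)[of b n] asm by (simp_all add: field_simps)
    ultimately have "\<lfloor>2 ^ n * frac \<alpha>\<rfloor> = k"
      by linarith
    then show ?thesis
      using k by simp
  qed
  show "b = bin_digit \<alpha>"
  proof
    fix n
    obtain k :: int where "2 ^ Suc n * sum ?h {..<Suc n} = real_of_int (2 * k + of_bool (b n))"
      using ints by blast
    then have "\<lfloor>2 ^ Suc n * frac \<alpha>\<rfloor> = 2 * k + of_bool (b n)"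
      using fl[of "Suc n"] by linarith
    then show "b n = bin_digit \<alpha> n"
      by (simp add: bin_digit_def)
  qed
next
  assume "b = bin_digit \<alpha>"
  then show "(\<lambda>i. of_bool (b i) / 2 ^ Suc i) sums frac \<alpha> \<and> (\<exists>\<^sub>\<infinity>i. \<not> b i)"
    using bin_digit_sums bin_digit_INFM by simp
qed


section \<open>Oracle deterministic Turing machines\<close>

text \<open>Multitape machines with two-way infinite tapes. Tape 0 initially holds the input, tape 1
  is the oracle tape, tape 2 is the output tape, and all further tapes are work tapes. In the
  query state the machine enters the yes or the no state in one step, according to whether the
  string on the oracle tape belongs to the oracle; tapes and heads are left unchanged.\<close>

datatype symbol = Blank | Bit bool | Mark nat

datatype move = Go_Left | Stay | Go_Right

type_synonym tape = "(int \<Rightarrow> symbol) \<times> int"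
type_synonym config = "nat \<times> tape list"

record otm =
  states :: "nat set"
  alphabet :: "symbol set"
  tapes :: nat
  start_state :: nat
  halt_state :: nat
  query_state :: nat
  yes_state :: nat
  no_state :: nat
  trans :: "nat \<Rightarrow> symbol list \<Rightarrow> nat \<times> (symbol \<times> move) list"

definition oracle_machine :: "otm \<Rightarrow> bool" where
  "oracle_machine M \<longleftrightarrow>
    finite (states M) \<and> finite (alphabet M) \<and>
    {Blank, Bit False, Bit True} \<subseteq> alphabet M \<and> 3 \<le> tapes M \<and>
    {start_state M, halt_state M, query_state M, yes_state M, no_state M} \<subseteq> states M \<and>
    halt_state M \<noteq> query_state M \<and> yes_state M \<noteq> no_state M \<and>
    (\<forall>q \<in> states M - {halt_state M, query_state M}. \<forall>as.
      set as \<subseteq> alphabet M \<and> length as = tapes M \<longrightarrow>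
      (case trans M q as of (q', acts) \<Rightarrow>
        q' \<in> states M \<and> length acts = tapes M \<and> fst ` set acts \<subseteq> alphabet M))"

fun shift :: "move \<Rightarrow> int \<Rightarrow> int" where
  "shift Go_Left h = h - 1"
| "shift Stay h = h"
| "shift Go_Right h = h + 1"

fun tape_act :: "symbol \<times> move \<Rightarrow> tape \<Rightarrow> tape" where
  "tape_act (a, d) (T, h) = (T(h := a), shift d h)"

fun tape_read :: "tape \<Rightarrow> symbol" where
  "tape_read (T, h) = T h"

definition blank_tape :: tape where
  "blank_tape = (\<lambda>_. Blank, 0)"

definition string_tape :: "str \<Rightarrow> tape" where
  "string_tape s =
    (\<lambda>i. if 0 \<le> i \<and> i < int (length s) then Bit (s ! nat i) else Blank, 0)"

text \<open>The string on a tape is the block of bits that starts at cell 0 and ends before the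
  first cell not containing a bit; it does not depend on the head position.\<close>

fun tape_string :: "tape \<Rightarrow> str" where
  "tape_string (T, h) =
    map (\<lambda>i. T (int i) = Bit True) [0..<(LEAST i::nat. T (int i) \<notin> range Bit)]"

lemma tape_string_string_tape [simp]: "tape_string (string_tape s) = s"
proof -
  have len: "(LEAST i::nat. fst (string_tape s) (int i) \<notin> range Bit) = length s"
    by (rule Least_equality) (auto simp: string_tape_def split: if_splits intro: ccontr)
  have "tape_string (string_tape s) = map (\<lambda>i. fst (string_tape s) (int i) = Bit True)
      [0..<(LEAST i::nat. fst (string_tape s) (int i) \<notin> range Bit)]"
    by (cases "string_tape s") simp
  also have "\<dots> = s"
    unfolding len by (rule nth_equalityI) (auto simp: string_tape_def)
  finally show ?thesis .
qed

definition otm_init :: "otm \<Rightarrow> str \<Rightarrow> config" where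
  "otm_init M x = (start_state M, string_tape x # replicate (tapes M - 1) blank_tape)"

fun otm_step :: "otm \<Rightarrow> str set \<Rightarrow> config \<Rightarrow> config" where
  "otm_step M A (q, ts) =
    (if q = halt_state M then (q, ts)
     else if q = query_state M then
       (if tape_string (ts ! 1) \<in> A then yes_state M else no_state M, ts)
     else case trans M q (map tape_read ts) of (q', acts) \<Rightarrow> (q', map2 tape_act acts ts))"

definition otm_run :: "otm \<Rightarrow> str set \<Rightarrow> str \<Rightarrow> nat \<Rightarrow> config" where
  "otm_run M A x t = (otm_step M A ^^ t) (otm_init M x)"

text \<open>The output on input \<open>x\<close>, \<open>None\<close> if the machine does not halt. A natural number \<open>n\<close> is
  given to the machine as the string \<open>num_str n\<close>.\<close>

definition otm_output :: "otm \<Rightarrow> str set \<Rightarrow> str \<Rightarrow> str option" where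
  "otm_output M A x =
    (if \<exists>t. fst (otm_run M A x t) = halt_state M
     then Some (tape_string
       (snd (otm_run M A x (LEAST t. fst (otm_run M A x t) = halt_state M)) ! 2))
     else None)"

end

theory Submission
  imports Defs "HOL-Library.Nat_Bijection"
begin

text \<open>
  (i) implies (ii). Enumerate the domains of \<open>V\<close> and \<open>W\<close> in stages, with approximations
  \<open>D k\<close> of \<open>dom V\<close> and \<open>om k\<close> of \<open>Omega W\<close>. Let \<open>F k\<close> be the sum
  of \<open>1 / 2 ^ f n\<close> over those \<open>n\<close> for which \<open>M\<close>, with oracle \<open>D k\<close> cut at
  length \<open>n\<close>, outputs the initial \<open>n - f n - c\<close> digits of \<open>om k\<close>. For fixed \<open>n\<close>
  the cut oracle takes at most \<open>1 + card (set_upto (dom V) n)\<close> values, and while it is constant the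
  agreement confines \<open>om\<close> to one dyadic interval; by Kraft's inequality the integral of \<open>F\<close> along
  \<open>om\<close> is therefore finite. If an optimal computer is asked, at every stage, to describe a new string
  with a program whose measure is the current increment of that integral, then
  \<open>Omega W - om k\<close> must dominate the rest of the integral up to a constant factor, so \<open>F\<close>
  is bounded near \<open>Omega W\<close>, where it tends to the sum over all \<open>n\<close>.

  (ii) implies (i). A prefix code with code words of length about \<open>f n\<close>, followed by a candidate for
  the first \<open>n - f n - O(1)\<close> digits of \<open>Omega W\<close>, describes within \<open>n - O(1)\<close> bits a
  stage at which \<open>om\<close> has reached the candidate. By optimality \<open>V\<close> outputs such a stage on a
  program of length at most \<open>n\<close>, and a machine that knows which of these programs are in the domain
  can evaluate all of them and take a stage beyond all outputs.
\<close>

section \<open>Recursive functions\<close>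

text \<open>Two models of computation have to be translated into each other: the first implication
  needs the run of a machine with a finite oracle as a recursive function of the stage, the second
  needs a machine for a given recursive function. Comparisons of reals stay decidable because every
  approximation carries an explicit power of two as denominator. The stage digits of
  \<open>om k\<close> settle on those of \<open>Omega W\<close> only if \<open>Omega W\<close> is
  not dyadic, since \<open>om\<close> stays strictly below its limit. This fact is itself obtained
  from the integral argument, with an integrand that has a logarithmic pole at
  \<open>Omega W\<close>. The integral argument ends by comparing two tails: if the integrand is at
  least \<open>F\<close> from stage \<open>K\<close> on, the rest of the integral is at least
  \<open>F * (Omega W - om K)\<close>, while the measure that is still to be spent bounds it by a
  constant times \<open>Omega W - om K\<close>. The common factor is positive and cancels, so the
  bound on \<open>F\<close> is the same for all finite portions of the series.\<close>

definition recursive_list :: "nat \<Rightarrow> (nat list \<Rightarrow> nat) \<Rightarrow> bool" where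
  "recursive_list n f \<longleftrightarrow> (\<exists>F. partrec n F \<and> (\<forall>xs. length xs = n \<longrightarrow> F xs = Some (f xs)))"

lemma recursive_list_cong:
  assumes "recursive_list n f" "\<And>xs. length xs = n \<Longrightarrow> f xs = g xs"
  shows "recursive_list n g"
  using assms unfolding recursive_list_def by metis

lemma recursive_list_zero: "recursive_list n (\<lambda>xs. 0)"
  unfolding recursive_list_def using partrec.zero by blast

lemma recursive_list_nth: "i < n \<Longrightarrow> recursive_list n (\<lambda>xs. xs ! i)"
  unfolding recursive_list_def using partrec.proj by blast

lemma recursive_list_hd: "recursive_list (Suc n) (\<lambda>xs. hd xs)"
  by (rule recursive_list_cong[OF recursive_list_nth[of 0]]) (auto simp: hd_conv_nth length_Suc_conv)

lemma those_map_Some: "those (map (\<lambda>x. Some (f x)) xs) = Some (map f xs)"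
  by (induction xs) auto

lemma recursive_list_comp:
  assumes "recursive_list (length gs) f" "\<And>g. g \<in> set gs \<Longrightarrow> recursive_list n g"
  shows "recursive_list n (\<lambda>xs. f (map (\<lambda>g. g xs) gs))"
proof -
  obtain F where F: "partrec (length gs) F" "\<And>xs. length xs = length gs \<Longrightarrow> F xs = Some (f xs)"
    using assms(1) unfolding recursive_list_def by blast
  have "\<forall>g\<in>set gs. \<exists>G. partrec n G \<and> (\<forall>xs. length xs = n \<longrightarrow> G xs = Some (g xs))"
    using assms(2) unfolding recursive_list_def by blast
  then obtain \<Phi> where \<Phi>: "\<forall>g\<in>set gs. partrec n (\<Phi> g) \<and> (\<forall>xs. length xs = n \<longrightarrow> \<Phi> g xs = Some (g xs))"
    by metis
  have "partrec n (\<lambda>xs. Option.bind (those (map (\<lambda>G. G xs) (map \<Phi> gs))) F)"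
    by (rule partrec.comp) (use F \<Phi> in auto)
  moreover have "Option.bind (those (map (\<lambda>G. G xs) (map \<Phi> gs))) F = Some (f (map (\<lambda>g. g xs) gs))"
    if "length xs = n" for xs
  proof -
    have "map (\<lambda>G. G xs) (map \<Phi> gs) = map (\<lambda>g. Some (g xs)) gs"
      using \<Phi> that by simp
    then show ?thesis
      using F(2) by (simp only: those_map_Some) simp
  qed
  ultimately show ?thesis
    unfolding recursive_list_def by blast
qed

lemma recursive_list_Suc:
  assumes "recursive_list n f"
  shows "recursive_list n (\<lambda>xs. Suc (f xs))"
proof -
  have "recursive_list (length [f]) (\<lambda>xs. Suc (hd xs))"
    unfolding recursive_list_def using partrec.succ by auto
  from recursive_list_comp[OF this] show ?thesis
    using assms by simp
qed

lemma recursive_list_prim: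
  assumes "recursive_list n f" "recursive_list (Suc (Suc n)) g"
  shows "recursive_list (Suc n) (\<lambda>xs. rec_nat (f (tl xs)) (\<lambda>y r. g (y # r # tl xs)) (hd xs))"
proof -
  obtain F G where F: "partrec n F" "\<And>xs. length xs = n \<Longrightarrow> F xs = Some (f xs)"
    and G: "partrec (Suc (Suc n)) G" "\<And>xs. length xs = Suc (Suc n) \<Longrightarrow> G xs = Some (g xs)"
    using assms unfolding recursive_list_def by blast
  have "rec_nat (F (tl xs)) (\<lambda>y r. Option.bind r (\<lambda>v. G (y # v # tl xs))) k
      = Some (rec_nat (f (tl xs)) (\<lambda>y r. g (y # r # tl xs)) k)" if "length xs = Suc n" for xs k
    using that by (induction k) (auto simp: F(2) G(2))
  then show ?thesis
    unfolding recursive_list_def using partrec.prim[OF F(1) G(1)] by blast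
qed

lemma recursive_list_Least:
  assumes "recursive_list (Suc n) f" "\<And>xs. length xs = n \<Longrightarrow> \<exists>z. f (z # xs) = 0"
  shows "recursive_list n (\<lambda>xs. LEAST z. f (z # xs) = 0)"
proof -
  obtain F where F: "partrec (Suc n) F" "\<And>xs. length xs = Suc n \<Longrightarrow> F xs = Some (f xs)"
    using assms unfolding recursive_list_def by blast
  show ?thesis
    unfolding recursive_list_def using partrec.mu[OF F(1)] F(2) assms(2) by force
qed

lemma recursive_list_app1:
  assumes "recursive_list 1 (\<lambda>xs. h (hd xs))" "recursive_list n f"
  shows "recursive_list n (\<lambda>xs. h (f xs))"
  using recursive_list_comp[of "[f]" "\<lambda>xs. h (hd xs)" n] assms by simp

lemma recursive_list_app2:
  assumes "recursive_list 2 (\<lambda>xs. h (xs ! 0) (xs ! 1))" "recursive_list n f" "recursive_list n g"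
  shows "recursive_list n (\<lambda>xs. h (f xs) (g xs))"
  using recursive_list_comp[of "[f, g]" "\<lambda>xs. h (xs ! 0) (xs ! 1)" n] assms
  by (auto simp: numeral_2_eq_2)

lemma recursive_list_add:
  assumes "recursive_list n f" "recursive_list n g"
  shows "recursive_list n (\<lambda>xs. f xs + g xs)"
proof -
  have "recursive_list (Suc 1) (\<lambda>xs. rec_nat (hd (tl xs)) (\<lambda>y r. Suc ((y # r # tl xs) ! 1)) (hd xs))"
    by (rule recursive_list_prim[where g = "\<lambda>xs. Suc (xs ! 1)" and f = "\<lambda>xs. hd xs"])
      (auto intro: recursive_list_hd[of 0, simplified] recursive_list_Suc recursive_list_nth)
  moreover have "rec_nat a (\<lambda>y r. Suc r) b = a + b" for a b :: nat
    by (induction b) auto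
  ultimately have "recursive_list 2 (\<lambda>xs. xs ! 0 + xs ! 1)"
    unfolding numeral_2_eq_2 One_nat_def
    by - (rule recursive_list_cong, assumption, auto simp: length_Suc_conv)
  then show ?thesis
    by (rule recursive_list_app2) (fact assms)+
qed

lemma recursive_list_pred:
  assumes "recursive_list n f"
  shows "recursive_list n (\<lambda>xs. f xs - 1)"
proof -
  have "recursive_list (Suc 0) (\<lambda>xs. rec_nat 0 (\<lambda>y r. (y # r # tl xs) ! 0) (hd xs))"
    by (rule recursive_list_prim[where g = "\<lambda>xs. xs ! 0" and f = "\<lambda>xs. 0"])
      (auto intro: recursive_list_zero recursive_list_nth)
  moreover have "rec_nat 0 (\<lambda>y r. y) b = b - 1" for b :: nat
    by (induction b) auto
  ultimately have "recursive_list 1 (\<lambda>xs. hd xs - 1)"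
    by simp
  then show ?thesis
    by (rule recursive_list_app1) (fact assms)+
qed

lemma recursive_list_diff:
  assumes "recursive_list n f" "recursive_list n g"
  shows "recursive_list n (\<lambda>xs. f xs - g xs)"
proof -
  have "recursive_list (Suc 1) (\<lambda>xs. rec_nat (hd (tl xs)) (\<lambda>y r. (y # r # tl xs) ! 1 - 1) (hd xs))"
    by (rule recursive_list_prim[where g = "\<lambda>xs. xs ! 1 - 1" and f = "\<lambda>xs. hd xs"])
      (auto intro!: recursive_list_hd[of 0, simplified] recursive_list_pred[unfolded One_nat_def] recursive_list_nth)
  moreover have "rec_nat a (\<lambda>y r. r - Suc 0) b = a - b" for a b :: nat
    by (induction b) auto
  ultimately have "recursive_list 2 (\<lambda>xs. xs ! 1 - xs ! 0)"
    unfolding numeral_2_eq_2 One_nat_def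
    by - (rule recursive_list_cong, assumption, auto simp: length_Suc_conv)
  from recursive_list_app2[of "\<lambda>a b. b - a", OF this assms(2,1)] show ?thesis .
qed

lemma recursive_list_triangle:
  assumes "recursive_list n f"
  shows "recursive_list n (\<lambda>xs. triangle (f xs))"
proof -
  have "recursive_list (Suc 0) (\<lambda>xs. rec_nat 0 (\<lambda>y r. (y # r # tl xs) ! 1 + Suc ((y # r # tl xs) ! 0)) (hd xs))"
    by (rule recursive_list_prim[where g = "\<lambda>xs. xs ! 1 + Suc (xs ! 0)" and f = "\<lambda>xs. 0"])
      (auto intro!: recursive_list_zero recursive_list_add recursive_list_Suc recursive_list_nth)
  moreover have "rec_nat 0 (\<lambda>y r. Suc (r + y)) b = triangle b" for b :: nat
    by (induction b) auto
  ultimately have "recursive_list 1 (\<lambda>xs. triangle (hd xs))"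
    by simp
  then show ?thesis
    by (rule recursive_list_app1) (fact assms)+
qed

section \<open>Cantor pairing and its projections\<close>

definition nfst :: "nat \<Rightarrow> nat" where "nfst z = fst (prod_decode z)"
definition nsnd :: "nat \<Rightarrow> nat" where "nsnd z = snd (prod_decode z)"
definition npair :: "nat \<Rightarrow> nat \<Rightarrow> nat" where "npair x y = prod_encode (x, y)"

lemma nfst_npair [simp]: "nfst (npair x y) = x"
  and nsnd_npair [simp]: "nsnd (npair x y) = y"
  and npair_nfst_nsnd [simp]: "npair (nfst z) (nsnd z) = z"
  by (simp_all add: nfst_def nsnd_def npair_def)

lemma npair_eq [simp]: "npair a b = npair c d \<longleftrightarrow> a = c \<and> b = d"
  by (simp add: npair_def)

lemma le_npair1: "a \<le> npair a b" and le_npair2: "b \<le> npair a b"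
  by (simp_all add: npair_def le_prod_encode_1 le_prod_encode_2)

lemma nfst_le: "nfst z \<le> z" and nsnd_le: "nsnd z \<le> z"
  by (metis le_npair1 le_npair2 npair_nfst_nsnd)+

lemma triangle_mono: "x \<le> y \<Longrightarrow> triangle x \<le> triangle y"
  by (induction y) (auto simp: le_Suc_eq)

lemma triangle_nfst_nsnd: "triangle (nfst z + nsnd z) + nfst z = z"
  using npair_nfst_nsnd[of z] unfolding npair_def prod_encode_def by simp

text \<open>\<open>prod_encode (a, b)\<close> is \<open>triangle (a + b) + a\<close>, so
  \<open>z\<close> lies in the block between two consecutive triangular numbers whose index is the
  sum of its components. Truncated subtraction writes \<open>z < triangle (Suc w)\<close> as an
  equation with 0, the form in which minimisation searches.\<close>

lemma Least_triangle: "(LEAST w. Suc z - triangle (Suc w) = 0) = nfst z + nsnd z"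
proof -
  let ?a = "nfst z" and ?b = "nsnd z"
  have z: "z = triangle (?a + ?b) + ?a"
    by (simp add: triangle_nfst_nsnd)
  have "w < ?a + ?b \<Longrightarrow> triangle (Suc w) \<le> triangle (?a + ?b)" for w
    by (rule triangle_mono) simp
  then have "\<And>w. triangle (Suc w) \<ge> Suc z \<Longrightarrow> ?a + ?b \<le> w"
    using z by (metis Suc_n_not_le_n le_add1 le_trans linorder_not_less)
  then show ?thesis
    by (intro Least_equality) (use z in auto)
qed

lemma recursive_list_npair:
  assumes "recursive_list n f" "recursive_list n g"
  shows "recursive_list n (\<lambda>xs. npair (f xs) (g xs))"
  unfolding npair_def prod_encode_def
  by (simp, intro recursive_list_add recursive_list_triangle assms)

lemma recursive_list_nfst_nsnd:
  shows recursive_list_nfst: "recursive_list n f \<Longrightarrow> recursive_list n (\<lambda>xs. nfst (f xs))"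
    and recursive_list_nsnd: "recursive_list n f \<Longrightarrow> recursive_list n (\<lambda>xs. nsnd (f xs))"
proof -
  let ?f = "\<lambda>xs. Suc (xs ! 1) - triangle (Suc (xs ! 0))"
  have "recursive_list 1 (\<lambda>xs. LEAST z. ?f (z # xs) = 0)"
  proof (rule recursive_list_Least)
    show "recursive_list (Suc 1) ?f"
      by (intro recursive_list_diff recursive_list_triangle recursive_list_Suc recursive_list_nth) auto
    show "\<exists>z. ?f (z # xs) = 0" for xs
      by (rule exI[of _ "xs ! 0"]) simp
  qed
  then have s: "recursive_list 1 (\<lambda>xs. nfst (hd xs) + nsnd (hd xs))"
    by (rule recursive_list_cong) (auto simp: Least_triangle[simplified] length_Suc_conv)
  have "z - triangle (nfst z + nsnd z) = nfst z" for z
    by (metis triangle_nfst_nsnd diff_add_inverse)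
  moreover have "recursive_list 1 (\<lambda>xs. hd xs - triangle (nfst (hd xs) + nsnd (hd xs)))"
    by (rule recursive_list_diff[OF recursive_list_hd[of 0, folded One_nat_def] recursive_list_triangle[OF s]])
  ultimately have 1: "recursive_list 1 (\<lambda>xs. nfst (hd xs))"
    by (simp only:)
  have 2: "recursive_list 1 (\<lambda>xs. nsnd (hd xs))"
    using recursive_list_diff[OF s 1] by simp
  show "recursive_list n f \<Longrightarrow> recursive_list n (\<lambda>xs. nfst (f xs))"
    by (rule recursive_list_app1[OF 1])
  show "recursive_list n f \<Longrightarrow> recursive_list n (\<lambda>xs. nsnd (f xs))"
    by (rule recursive_list_app1[OF 2])
qed

subsection \<open>Unary recursive functions with paired arguments\<close>

definition recursive :: "(nat \<Rightarrow> nat) \<Rightarrow> bool" where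
  "recursive f \<longleftrightarrow> recursive_list 1 (\<lambda>xs. f (hd xs))"

text \<open>Several variables are packed into one number. Every closure rule, also for a construct
  that binds a variable, then has premises of the single form
  \<open>recursive (\<lambda>p. ...)\<close>, and recursiveness follows from the shape of the
  term.\<close>

abbreviation recursive2 :: "(nat \<Rightarrow> nat \<Rightarrow> nat) \<Rightarrow> bool" where
  "recursive2 f \<equiv> recursive (\<lambda>p. f (nfst p) (nsnd p))"

abbreviation recursive3 :: "(nat \<Rightarrow> nat \<Rightarrow> nat \<Rightarrow> nat) \<Rightarrow> bool" where
  "recursive3 f \<equiv> recursive (\<lambda>p. f (nfst p) (nfst (nsnd p)) (nsnd (nsnd p)))"

abbreviation decidable :: "(nat \<Rightarrow> bool) \<Rightarrow> bool" where
  "decidable P \<equiv> recursive (\<lambda>x. of_bool (P x))"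

abbreviation decidable2 :: "(nat \<Rightarrow> nat \<Rightarrow> bool) \<Rightarrow> bool" where
  "decidable2 P \<equiv> recursive (\<lambda>p. of_bool (P (nfst p) (nsnd p)))"

abbreviation decidable3 :: "(nat \<Rightarrow> nat \<Rightarrow> nat \<Rightarrow> bool) \<Rightarrow> bool" where
  "decidable3 P \<equiv> recursive (\<lambda>p. of_bool (P (nfst p) (nfst (nsnd p)) (nsnd (nsnd p))))"

named_theorems rec_intros

lemma recursive_list_recursive:
  "recursive h \<Longrightarrow> recursive_list n f \<Longrightarrow> recursive_list n (\<lambda>xs. h (f xs))"
  unfolding recursive_def by (rule recursive_list_app1)

lemma recursive_comp: "recursive f \<Longrightarrow> recursive g \<Longrightarrow> recursive (\<lambda>x. f (g x))"
  unfolding recursive_def by (rule recursive_list_app1)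

lemma recursive_id [rec_intros]: "recursive (\<lambda>x. x)"
  by (simp add: recursive_def recursive_list_hd[of 0, simplified])

lemma recursive_const [rec_intros]: "recursive (\<lambda>x. c)"
  unfolding recursive_def by (induction c) (auto intro: recursive_list_zero recursive_list_Suc)

lemma recursive_Suc [rec_intros]: "recursive f \<Longrightarrow> recursive (\<lambda>x. Suc (f x))"
  unfolding recursive_def by (rule recursive_list_Suc)

lemma recursive_add [rec_intros]: "recursive f \<Longrightarrow> recursive g \<Longrightarrow> recursive (\<lambda>x. f x + g x)"
  unfolding recursive_def by (rule recursive_list_add)

lemma recursive_diff [rec_intros]: "recursive f \<Longrightarrow> recursive g \<Longrightarrow> recursive (\<lambda>x. f x - g x)"
  unfolding recursive_def by (rule recursive_list_diff)

lemma recursive_npair [rec_intros]: "recursive f \<Longrightarrow> recursive g \<Longrightarrow> recursive (\<lambda>x. npair (f x) (g x))"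
  unfolding recursive_def by (rule recursive_list_npair)

lemma recursive_nfst [rec_intros]: "recursive f \<Longrightarrow> recursive (\<lambda>x. nfst (f x))"
  unfolding recursive_def by (rule recursive_list_nfst)

lemma recursive_nsnd [rec_intros]: "recursive f \<Longrightarrow> recursive (\<lambda>x. nsnd (f x))"
  unfolding recursive_def by (rule recursive_list_nsnd)

lemma recursive_app2:
  assumes "recursive2 h" "recursive f" "recursive g"
  shows "recursive (\<lambda>x. h (f x) (g x))"
  using recursive_comp[OF assms(1) recursive_npair[OF assms(2,3)]] by simp

lemma recursive_app3:
  assumes "recursive3 h" "recursive f" "recursive g" "recursive k"
  shows "recursive (\<lambda>x. h (f x) (g x) (k x))"
  using recursive_comp[OF assms(1) recursive_npair[OF assms(2) recursive_npair[OF assms(3,4)]]] by simp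

lemma recursive_rec_nat [rec_intros]:
  assumes "recursive a" "recursive3 g" "recursive b"
  shows "recursive (\<lambda>x. rec_nat (a x) (\<lambda>y r. g x y r) (b x))"
proof -
  have "recursive_list (Suc 1) (\<lambda>xs. rec_nat (a (hd (tl xs)))
      (\<lambda>y r. (\<lambda>xs. g (xs ! 2) (xs ! 0) (xs ! 1)) (y # r # tl xs)) (hd xs))"
  proof (rule recursive_list_prim[where f = "\<lambda>xs. a (hd xs)"])
    show "recursive_list 1 (\<lambda>xs. a (hd xs))"
      using assms(1) by (simp add: recursive_def)
    have "recursive_list (Suc (Suc 1)) (\<lambda>xs. npair (xs ! 2) (npair (xs ! 0) (xs ! 1)))"
      by (intro recursive_list_npair recursive_list_nth) auto
    from recursive_list_recursive[OF assms(2) this]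
    show "recursive_list (Suc (Suc 1)) (\<lambda>xs. g (xs ! 2) (xs ! 0) (xs ! 1))"
      by simp
  qed
  then have "recursive_list 2 (\<lambda>xs. rec_nat (a (xs ! 1)) (\<lambda>y r. g (xs ! 1) y r) (xs ! 0))"
    unfolding numeral_2_eq_2 One_nat_def
    by - (rule recursive_list_cong, assumption, auto simp: length_Suc_conv)
  from recursive_list_app2[of "\<lambda>y x. rec_nat (a x) (\<lambda>y r. g x y r) y", OF this, of 1 "\<lambda>xs. b (hd xs)" "\<lambda>xs. hd xs"]
  show ?thesis
    using assms(3) by (simp add: recursive_def recursive_list_hd[of 0, simplified])
qed

section \<open>Bounded sums, decidable predicates and division\<close>

lemma recursive_sum [rec_intros]:
  assumes "recursive b" "recursive2 g"
  shows "recursive (\<lambda>x. \<Sum>y<b x. g x y)"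
proof -
  have "recursive (\<lambda>x. rec_nat 0 (\<lambda>y r. r + g x y) (b x))"
    by (intro rec_intros assms(1) recursive_app2[OF assms(2)])
  moreover have "rec_nat 0 (\<lambda>y r. r + g x y) n = (\<Sum>y<n. g x y)" for x n
    by (induction n) auto
  ultimately show ?thesis by (simp only:)
qed

lemma recursive_mult [rec_intros]:
  assumes "recursive f" "recursive g"
  shows "recursive (\<lambda>x. f x * g x)"
proof -
  have "recursive (\<lambda>x. \<Sum>y<g x. f x)"
    by (intro rec_intros assms recursive_comp[OF assms(1)])
  then show ?thesis by (simp add: mult.commute)
qed

lemma recursive_power [rec_intros]:
  assumes "recursive f" "recursive g"
  shows "recursive (\<lambda>x. f x ^ g x)"
proof -
  have "recursive (\<lambda>x. rec_nat 1 (\<lambda>y r. f x * r) (g x))"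
    by (intro rec_intros assms recursive_comp[OF assms(1)])
  moreover have "rec_nat 1 (\<lambda>y r. a * r) n = a ^ n" for a n :: nat
    by (induction n) auto
  ultimately show ?thesis by (simp only:)
qed

lemma decidable_less [rec_intros]:
  assumes "recursive f" "recursive g"
  shows "decidable (\<lambda>x. f x < g x)"
proof -
  have "recursive (\<lambda>x. 1 - (1 - (g x - f x)))"
    by (intro rec_intros assms)
  moreover have "1 - (1 - (g x - f x)) = of_bool (f x < g x)" for x
    by auto
  ultimately show ?thesis by (simp only:)
qed

lemma decidable_not [rec_intros]:
  assumes "decidable P"
  shows "decidable (\<lambda>x. \<not> P x)"
proof -
  have "recursive (\<lambda>x. 1 - of_bool (P x))"
    by (intro recursive_diff recursive_const assms)
  moreover have "1 - of_bool (P x) = (of_bool (\<not> P x) :: nat)" for x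
    by (cases "P x") auto
  ultimately show ?thesis by (simp only:)
qed

lemma decidable_conj [rec_intros]:
  assumes "decidable P" "decidable Q"
  shows "decidable (\<lambda>x. P x \<and> Q x)"
  unfolding of_bool_conj by (intro rec_intros assms)

lemma decidable_disj [rec_intros]:
  assumes "decidable P" "decidable Q"
  shows "decidable (\<lambda>x. P x \<or> Q x)"
proof -
  have "decidable (\<lambda>x. \<not> (\<not> P x \<and> \<not> Q x))"
    by (intro rec_intros assms)
  then show ?thesis by simp
qed

lemma decidable_imp [rec_intros]:
  assumes "decidable P" "decidable Q"
  shows "decidable (\<lambda>x. P x \<longrightarrow> Q x)"
  unfolding imp_conv_disj by (intro rec_intros assms)

lemma decidable_le [rec_intros]:
  assumes "recursive f" "recursive g"
  shows "decidable (\<lambda>x. f x \<le> g x)"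
  unfolding not_less[symmetric] by (intro rec_intros assms)

lemma decidable_eq [rec_intros]:
  assumes "recursive f" "recursive g"
  shows "decidable (\<lambda>x. f x = g x)"
  unfolding order_eq_iff by (intro rec_intros assms)

lemma recursive_if [rec_intros]:
  assumes "decidable P" "recursive f" "recursive g"
  shows "recursive (\<lambda>x. if P x then f x else g x)"
proof -
  have "recursive (\<lambda>x. of_bool (P x) * f x + (1 - of_bool (P x)) * g x)"
    by (intro rec_intros assms)
  moreover have "of_bool (P x) * f x + (1 - of_bool (P x)) * g x = (if P x then f x else g x)" for x
    by auto
  ultimately show ?thesis by (simp only:)
qed

lemma decidable_ex_less [rec_intros]:
  assumes "recursive b" "decidable2 P"
  shows "decidable (\<lambda>x. \<exists>y<b x. P x y)"
proof -
  have "decidable (\<lambda>x. 0 < (\<Sum>y<b x. of_bool (P x y) :: nat))"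
    by (intro rec_intros assms)
  moreover have "(0 < (\<Sum>y<b x. of_bool (P x y) :: nat)) = (\<exists>y<b x. P x y)" for x
    by (auto simp: zero_less_iff_neq_zero)
  ultimately show ?thesis by (simp only:)
qed

lemma decidable_all_less [rec_intros]:
  assumes "recursive b" "decidable2 P"
  shows "decidable (\<lambda>x. \<forall>y<b x. P x y)"
proof -
  have "decidable (\<lambda>x. \<not> (\<exists>y<b x. \<not> P x y))"
    by (intro rec_intros assms)
  then show ?thesis by simp
qed

lemma recursive_Least:
  assumes "decidable2 P" "\<And>x. \<exists>y. P x y"
  shows "recursive (\<lambda>x. LEAST y. P x y)"
proof -
  let ?f = "\<lambda>xs. of_bool (\<not> P (xs ! 1) (xs ! 0)) :: nat"
  have "recursive_list 1 (\<lambda>xs. LEAST z. ?f (z # xs) = 0)"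
  proof (rule recursive_list_Least)
    have "recursive_list (Suc 1) (\<lambda>xs. npair (xs ! 1) (xs ! 0))"
      by (intro recursive_list_npair recursive_list_nth) auto
    from recursive_list_recursive[OF decidable_not[OF assms(1)] this]
    show "recursive_list (Suc 1) ?f"
      by simp
  next
    fix xs :: "nat list"
    obtain z where "P (xs ! 0) z" using assms(2) by blast
    then show "\<exists>z. ?f (z # xs) = 0"
      by (intro exI[of _ z]) simp
  qed
  then show ?thesis
    unfolding recursive_def
    by (rule recursive_list_cong) (auto simp: length_Suc_conv)
qed

lemma recursive_div [rec_intros]:
  assumes "recursive f" "recursive g"
  shows "recursive (\<lambda>x. f x div g x)"
proof -
  \<comment> \<open>The disjunct \<open>g x = 0\<close> provides a witness when the divisor
    vanishes; \<open>recursive_Least\<close> demands one for every argument.\<close>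
  have "recursive (\<lambda>x. if g x = 0 then 0 else LEAST q. g x = 0 \<or> f x < Suc q * g x)"
  proof (intro rec_intros recursive_Least assms recursive_comp[OF assms(1)] recursive_comp[OF assms(2)])
    show "\<exists>q. g x = 0 \<or> f x < Suc q * g x" for x
      by (rule exI[of _ "f x"]) (cases "g x", auto)
  qed
  moreover have "(if b = 0 then 0 else LEAST q. b = 0 \<or> a < Suc q * b) = a div b" for a b :: nat
  proof (cases "b = 0")
    case False
    then have "(LEAST q. b = 0 \<or> a < Suc q * b) = a div b"
    proof (intro Least_equality)
      fix q assume "b = 0 \<or> a < Suc q * b"
      with False show "a div b \<le> q"
        using less_mult_imp_div_less[of a "Suc q" b] by simp
    qed (use False dividend_less_times_div[of b a] in \<open>auto simp: mult.commute\<close>)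
    with False show ?thesis by simp
  qed simp
  ultimately show ?thesis by (simp only:)
qed

lemma recursive_mod [rec_intros]:
  assumes "recursive f" "recursive g"
  shows "recursive (\<lambda>x. f x mod g x)"
  unfolding minus_mult_div_eq_mod[symmetric] by (intro rec_intros assms)

lemma decidable_odd [rec_intros]:
  assumes "recursive f"
  shows "decidable (\<lambda>x. odd (f x))"
  unfolding odd_iff_mod_2_eq_one by (intro rec_intros assms)

lemma decidable_even [rec_intros]:
  assumes "recursive f"
  shows "decidable (\<lambda>x. even (f x))"
  unfolding even_iff_mod_2_eq_zero by (intro rec_intros assms)

text \<open>Kleene's normal form: every use of partiality below is one unbounded search.\<close>

lemma partial_recursive_search:
  assumes "decidable2 P" "recursive2 h"
  shows "partial_recursive (\<lambda>x. if \<exists>y. P x y then Some (h x (LEAST y. P x y)) else None)"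
proof -
  let ?f = "\<lambda>xs. of_bool (\<not> P (xs ! 1) (xs ! 0)) :: nat"
  have "recursive_list (Suc 1) (\<lambda>xs. npair (xs ! 1) (xs ! 0))"
    by (intro recursive_list_npair recursive_list_nth) auto
  from recursive_list_recursive[OF decidable_not[OF assms(1)] this]
  have "recursive_list (Suc 1) ?f"
    by simp
  then obtain F where F: "partrec (Suc 1) F" "\<And>xs. length xs = Suc 1 \<Longrightarrow> F xs = Some (?f xs)"
    unfolding recursive_list_def by blast
  define M where "M xs = (if \<exists>z. F (z # xs) = Some 0 \<and> (\<forall>y<z. F (y # xs) \<noteq> None)
      then Some (LEAST z. F (z # xs) = Some 0) else None)" for xs
  have "partrec 1 M"
    unfolding M_def by (rule partrec.mu[OF F(1)])
  have M: "M [x] = (if \<exists>y. P x y then Some (LEAST y. P x y) else None)" for x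
    unfolding M_def by (simp add: F(2))
  have "recursive_list 2 (\<lambda>xs. npair (xs ! 0) (xs ! 1))"
    by (intro recursive_list_npair recursive_list_nth) auto
  from recursive_list_recursive[OF assms(2) this] obtain H where
    H: "partrec 2 H" "\<And>xs. length xs = 2 \<Longrightarrow> H xs = Some (h (xs ! 0) (xs ! 1))"
    unfolding recursive_list_def by auto
  let ?K = "\<lambda>xs. Option.bind (those (map (\<lambda>G. G xs) [\<lambda>xs. Some (xs ! 0), M])) H"
  have "partrec 1 ?K"
    by (rule partrec.comp) (use H(1) \<open>partrec 1 M\<close> partrec.proj[of 0 1] in \<open>auto simp: numeral_2_eq_2\<close>)
  moreover have "?K [x] = (if \<exists>y. P x y then Some (h x (LEAST y. P x y)) else None)" for x
    by (simp add: M H(2))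
  ultimately show ?thesis
    unfolding partial_recursive_def by blast
qed

lemma recursive_partial_recursive: "recursive f \<longleftrightarrow> partial_recursive (\<lambda>x. Some (f x))"
proof
  assume "recursive f"
  then obtain F where "partrec 1 F" "\<And>xs. length xs = 1 \<Longrightarrow> F xs = Some (f (hd xs))"
    unfolding recursive_def recursive_list_def by blast
  then show "partial_recursive (\<lambda>x. Some (f x))"
    unfolding partial_recursive_def by (intro exI[of _ F]) auto
next
  assume "partial_recursive (\<lambda>x. Some (f x))"
  then obtain F where "partrec 1 F" "\<And>x. F [x] = Some (f x)"
    unfolding partial_recursive_def by blast
  then show "recursive f"
    unfolding recursive_def recursive_list_def by (intro exI[of _ F]) (auto simp: length_Suc_conv)
qed

subsection \<open>Lists of arguments\<close>

definition ncons :: "nat \<Rightarrow> nat \<Rightarrow> nat" where "ncons a l = Suc (npair a l)"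
definition nhd :: "nat \<Rightarrow> nat" where "nhd x = nfst (x - 1)"
definition ntl :: "nat \<Rightarrow> nat" where "ntl x = nsnd (x - 1)"

lemma list_encode_Cons [simp]: "list_encode (x # xs) = ncons x (list_encode xs)"
  by (simp add: ncons_def npair_def)

declare list_encode.simps(2) [simp del]

lemma nhd_ncons [simp]: "nhd (ncons a l) = a" and ntl_ncons [simp]: "ntl (ncons a l) = l"
  by (simp_all add: nhd_def ntl_def ncons_def)

lemma recursive_ncons [rec_intros]: "recursive f \<Longrightarrow> recursive g \<Longrightarrow> recursive (\<lambda>x. ncons (f x) (g x))"
  unfolding ncons_def by (intro rec_intros)

lemma recursive_nhd [rec_intros]: "recursive f \<Longrightarrow> recursive (\<lambda>x. nhd (f x))"
  unfolding nhd_def by (intro rec_intros)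

lemma recursive_ntl [rec_intros]: "recursive f \<Longrightarrow> recursive (\<lambda>x. ntl (f x))"
  unfolding ntl_def by (intro rec_intros)

lemma recursive_nth_list_decode [rec_intros]:
  "recursive f \<Longrightarrow> recursive (\<lambda>x. nhd ((ntl ^^ i) (f x)))"
proof (induction i arbitrary: f)
  case (Suc i)
  show ?case
    unfolding funpow_Suc_right o_def by (intro Suc.IH recursive_ntl Suc.prems)
qed (auto intro: recursive_nhd)

lemma nhd_funpow_ntl: "i < length xs \<Longrightarrow> nhd ((ntl ^^ i) (list_encode xs)) = xs ! i"
proof (induction xs arbitrary: i)
  case (Cons x xs)
  then show ?case by (cases i) (simp_all add: funpow_Suc_right del: funpow.simps)
qed simp

lemma recursive_list_encode:
  "(\<And>g. g \<in> set gs \<Longrightarrow> recursive (h g)) \<Longrightarrow> recursive (\<lambda>x. list_encode (map (\<lambda>g. h g x) gs))"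
  by (induction gs) (auto intro: rec_intros)

lemma decidable_ball_list:
  "(\<And>g. g \<in> set gs \<Longrightarrow> decidable (h g)) \<Longrightarrow> decidable (\<lambda>x. \<forall>g\<in>set gs. h g x)"
proof (induction gs)
  case (Cons g gs)
  then show ?case
    unfolding list.set ball_simps by (intro rec_intros) auto
qed (simp add: recursive_const)

lemma recursive_Let [rec_intros]:
  assumes "recursive f" "recursive2 g"
  shows "recursive (\<lambda>x. let y = f x in g x y)"
  unfolding Let_def by (rule recursive_app2[OF assms(2) recursive_id assms(1)])

subsection \<open>Approximation of partial recursive functions in stages\<close>

text \<open>At stage \<open>k\<close> the value \<open>0\<close> means that no result is known yet, and \<open>Suc v\<close> that the
  result is \<open>v\<close>.\<close>

definition stages :: "nat \<Rightarrow> (nat list \<Rightarrow> nat option) \<Rightarrow> (nat \<Rightarrow> nat \<Rightarrow> nat) \<Rightarrow> bool" where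
  "stages n F S \<longleftrightarrow> recursive2 S \<and> (\<forall>xs v. length xs = n \<longrightarrow>
     (\<forall>k. S k (list_encode xs) = Suc v \<longrightarrow> F xs = Some v) \<and>
     (F xs = Some v \<longrightarrow> (\<forall>\<^sub>F k in sequentially. S k (list_encode xs) = Suc v)))"

lemma those_eq_Some: "those ys = Some zs \<longleftrightarrow> ys = map Some zs"
proof
  show "those ys = Some zs \<Longrightarrow> ys = map Some zs"
    by (induction ys arbitrary: zs) (auto split: option.splits)
  show "ys = map Some zs \<Longrightarrow> those ys = Some zs"
    using those_map_Some[of id zs] by simp
qed

text \<open>All functions are evaluated at one common stage. Soundness survives because a nonzero
  value is always correct, completeness because finitely many eventual events eventually occur
  together.\<close>

lemma stages_comp:
  assumes F: "stages (length Gs) F SF" and G: "\<And>G. G \<in> set Gs \<Longrightarrow> stages n G (SG G)"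
  shows "stages n (\<lambda>xs. Option.bind (those (map (\<lambda>G. G xs) Gs)) F)
    (\<lambda>k x. if \<forall>G\<in>set Gs. SG G k x \<noteq> 0 then SF k (list_encode (map (\<lambda>G. SG G k x - 1) Gs)) else 0)"
    (is "stages n ?F ?S")
  unfolding stages_def
proof (intro conjI allI impI)
  have F': "recursive2 SF"
    and F1: "\<And>k xs v. length xs = length Gs \<Longrightarrow> SF k (list_encode xs) = Suc v \<Longrightarrow> F xs = Some v"
    and F2: "\<And>xs v. length xs = length Gs \<Longrightarrow> F xs = Some v \<Longrightarrow> \<forall>\<^sub>F k in sequentially. SF k (list_encode xs) = Suc v"
    using F unfolding stages_def by blast+
  have G': "\<And>G. G \<in> set Gs \<Longrightarrow> recursive2 (SG G)"
    and G1: "\<And>G k xs v. G \<in> set Gs \<Longrightarrow> length xs = n \<Longrightarrow> SG G k (list_encode xs) = Suc v \<Longrightarrow> G xs = Some v"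
    and G2: "\<And>G xs v. G \<in> set Gs \<Longrightarrow> length xs = n \<Longrightarrow> G xs = Some v \<Longrightarrow> \<forall>\<^sub>F k in sequentially. SG G k (list_encode xs) = Suc v"
    using G unfolding stages_def by blast+
  show "recursive2 ?S"
    by (intro rec_intros decidable_ball_list recursive_app2[OF F'] recursive_list_encode G')
  fix xs :: "nat list" and v
  assume n: "length xs = n"
  show "?F xs = Some v" if S: "?S k (list_encode xs) = Suc v" for k
  proof -
    have nz: "\<forall>G\<in>set Gs. SG G k (list_encode xs) \<noteq> 0"
      using S by (auto split: if_splits)
    have "map (\<lambda>G. G xs) Gs = map Some (map (\<lambda>G. SG G k (list_encode xs) - 1) Gs)"
      using nz by (auto intro!: G1 n)
    moreover have "F (map (\<lambda>G. SG G k (list_encode xs) - 1) Gs) = Some v"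
      by (rule F1[of _ k]) (use S nz in auto)
    ultimately show ?thesis
      by (simp only: those_eq_Some[THEN iffD2] bind.bind_lunit)
  qed
  show "\<forall>\<^sub>F k in sequentially. ?S k (list_encode xs) = Suc v" if "?F xs = Some v"
  proof -
    obtain zs where zs: "those (map (\<lambda>G. G xs) Gs) = Some zs" "F zs = Some v"
      using \<open>?F xs = Some v\<close> by (auto simp: bind_eq_Some_conv)
    then have zs': "map (\<lambda>G. G xs) Gs = map Some zs"
      by (simp add: those_eq_Some)
    then have len: "length zs = length Gs"
      by (metis length_map)
    have "zs = map (\<lambda>G. the (G xs)) Gs"
    proof -
      have "map the (map (\<lambda>G. G xs) Gs) = map the (map Some zs)"
        using zs' by simp
      then show ?thesis by (simp add: comp_def)
    qed
    have "\<forall>G\<in>set Gs. \<forall>\<^sub>F k in sequentially. SG G k (list_encode xs) = Suc (the (G xs))"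
    proof
      fix G assume "G \<in> set Gs"
      then have "G xs \<in> set (map Some zs)"
        unfolding zs'[symmetric] by simp
      then show "\<forall>\<^sub>F k in sequentially. SG G k (list_encode xs) = Suc (the (G xs))"
        using G2[OF \<open>G \<in> set Gs\<close> n] by auto
    qed
    then have "\<forall>\<^sub>F k in sequentially. \<forall>G\<in>set Gs. SG G k (list_encode xs) = Suc (the (G xs))"
      by (intro eventually_ball_finite) auto
    with F2[OF len zs(2)] show ?thesis
    proof eventually_elim
      case (elim k)
      then have "map (\<lambda>G. SG G k (list_encode xs) - 1) Gs = zs"
        by (simp add: \<open>zs = map (\<lambda>G. the (G xs)) Gs\<close>)
      with elim show ?case by simp
    qed
  qed
qed

text \<open>The value 0 propagates: one unknown intermediate result makes all later ones unknown, so
  soundness and completeness go through by induction on the recursion argument.\<close>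

lemma stages_prim:
  assumes F: "stages n F SF" and G: "stages (Suc (Suc n)) G SG"
  shows "stages (Suc n) (\<lambda>xs. rec_nat (F (tl xs)) (\<lambda>y r. Option.bind r (\<lambda>v. G (y # v # tl xs))) (hd xs))
    (\<lambda>k x. rec_nat (SF k (ntl x)) (\<lambda>y r. if r = 0 then 0 else SG k (ncons y (ncons (r - 1) (ntl x)))) (nhd x))"
    (is "stages _ ?F ?S")
  unfolding stages_def
proof (intro conjI allI impI)
  have F': "recursive2 SF"
    and F1: "\<And>k xs v. length xs = n \<Longrightarrow> SF k (list_encode xs) = Suc v \<Longrightarrow> F xs = Some v"
    and F2: "\<And>xs v. length xs = n \<Longrightarrow> F xs = Some v \<Longrightarrow> \<forall>\<^sub>F k in sequentially. SF k (list_encode xs) = Suc v"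
    using F unfolding stages_def by blast+
  have G': "recursive2 SG"
    and G1: "\<And>k xs v. length xs = Suc (Suc n) \<Longrightarrow> SG k (list_encode xs) = Suc v \<Longrightarrow> G xs = Some v"
    and G2: "\<And>xs v. length xs = Suc (Suc n) \<Longrightarrow> G xs = Some v \<Longrightarrow> \<forall>\<^sub>F k in sequentially. SG k (list_encode xs) = Suc v"
    using G unfolding stages_def by blast+
  show "recursive2 ?S"
    by (intro rec_intros recursive_app2[OF F'] recursive_app2[OF G'])
  fix xs :: "nat list" and v
  assume "length xs = Suc n"
  then obtain h t where xs: "xs = h # t" and t: "length t = n"
    by (auto simp: length_Suc_conv)
  show "?F xs = Some v" if "?S k (list_encode xs) = Suc v" for k
    using that unfolding xs list_encode_Cons nhd_ncons ntl_ncons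
  proof (induction h arbitrary: v)
    case 0
    then show ?case using F1[OF t] by simp
  next
    case (Suc h)
    let ?r = "rec_nat (SF k (list_encode t))
      (\<lambda>y r. if r = 0 then 0 else SG k (ncons y (ncons (r - 1) (list_encode t)))) h"
    have "?r \<noteq> 0" and SG: "SG k (list_encode (h # (?r - 1) # t)) = Suc v"
      using Suc.prems by (auto split: if_splits)
    then have "?F (h # t) = Some (?r - 1)"
      by (intro Suc.IH) simp
    moreover have "G (h # (?r - 1) # t) = Some v"
      by (rule G1[OF _ SG]) (simp add: t)
    ultimately show ?case by simp
  qed
  show "\<forall>\<^sub>F k in sequentially. ?S k (list_encode xs) = Suc v" if "?F xs = Some v"
    using that unfolding xs list_encode_Cons nhd_ncons ntl_ncons
  proof (induction h arbitrary: v)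
    case 0
    then show ?case using F2[OF t] by simp
  next
    case (Suc h)
    then obtain w where w: "?F (h # t) = Some w" "G (h # w # t) = Some v"
      by (auto simp: bind_eq_Some_conv)
    from w(2) have "\<forall>\<^sub>F k in sequentially. SG k (list_encode (h # w # t)) = Suc v"
      by (intro G2) (simp add: t)
    with Suc.IH[OF w(1)] show ?case
      by eventually_elim simp
  qed
qed

text \<open>Cutting the search off at \<open>k\<close> makes it total. The value 1 stands for the
  known result 0, so the search stops at the first argument known to be a zero; the test that all
  earlier results are known excludes a smaller zero that only a later stage would reveal.\<close>

lemma stages_mu:
  assumes F: "stages (Suc n) F SF"
  shows "stages n (\<lambda>xs. if \<exists>z. F (z # xs) = Some 0 \<and> (\<forall>y<z. F (y # xs) \<noteq> None)
      then Some (LEAST z. F (z # xs) = Some 0) else None)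
    (\<lambda>k x. let z = LEAST z. k \<le> z \<or> SF k (ncons z x) = 1 in
      if z < k \<and> (\<forall>y<z. SF k (ncons y x) \<noteq> 0) then Suc z else 0)"
    (is "stages _ ?F ?S")
  unfolding stages_def
proof (intro conjI allI impI)
  have F': "recursive2 SF"
    and F1: "\<And>k xs v. length xs = Suc n \<Longrightarrow> SF k (list_encode xs) = Suc v \<Longrightarrow> F xs = Some v"
    and F2: "\<And>xs v. length xs = Suc n \<Longrightarrow> F xs = Some v \<Longrightarrow> \<forall>\<^sub>F k in sequentially. SF k (list_encode xs) = Suc v"
    using F unfolding stages_def by blast+
  show "recursive2 ?S"
    by (intro rec_intros recursive_app2[OF F'] recursive_Least) auto
  fix xs :: "nat list" and v
  assume n: "length xs = n"
  show "?F xs = Some v" if "?S k (list_encode xs) = Suc v" for k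
  proof -
    define Q where "Q z \<longleftrightarrow> k \<le> z \<or> SF k (ncons z (list_encode xs)) = 1" for z
    have v: "v = (LEAST z. Q z)" and "v < k" and nz: "\<forall>y<v. SF k (ncons y (list_encode xs)) \<noteq> 0"
      using that unfolding Q_def[symmetric] by (auto simp: Let_def split: if_splits)
    have "Q v" unfolding v by (rule LeastI[of _ k]) (simp add: Q_def)
    then have 0: "F (v # xs) = Some 0"
      using F1[of "v # xs" k 0] n \<open>v < k\<close> by (simp add: Q_def)
    have y: "\<exists>w. F (y # xs) = Some (Suc w)" if "y < v" for y
    proof -
      have "\<not> Q y" using that not_less_Least unfolding v by blast
      then have "SF k (list_encode (y # xs)) \<noteq> 1" "SF k (list_encode (y # xs)) \<noteq> 0"
        using nz that by (auto simp: Q_def)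
      then obtain w where "SF k (list_encode (y # xs)) = Suc (Suc w)"
        by (cases "SF k (list_encode (y # xs))" rule: nat.exhaust) (auto simp: neq0_conv gr0_conv_Suc)
      then show ?thesis using F1[of "y # xs" k] n by auto
    qed
    have "(LEAST z. F (z # xs) = Some 0) = v"
    proof (rule Least_equality)
      show "v \<le> z" if "F (z # xs) = Some 0" for z
      proof (rule ccontr)
        assume "\<not> v \<le> z"
        with y[of z] that show False by auto
      qed
    qed (rule 0)
    moreover have "\<exists>z. F (z # xs) = Some 0 \<and> (\<forall>y<z. F (y # xs) \<noteq> None)"
      using 0 y by (metis option.distinct(1))
    ultimately show ?thesis by simp
  qed
  show "\<forall>\<^sub>F k in sequentially. ?S k (list_encode xs) = Suc v" if "?F xs = Some v"
  proof -
    have ex: "\<exists>z. F (z # xs) = Some 0 \<and> (\<forall>y<z. F (y # xs) \<noteq> None)"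
    proof (rule ccontr)
      assume n: "\<not> ?thesis"
      from that show False
        unfolding if_not_P[OF n] by simp
    qed
    then obtain z where z: "F (z # xs) = Some 0" "\<forall>y<z. F (y # xs) \<noteq> None"
      by blast
    have v: "v = (LEAST z. F (z # xs) = Some 0)"
      using that ex by simp
    have 0: "F (v # xs) = Some 0"
      unfolding v by (rule LeastI, rule z)
    have "v \<le> z"
      unfolding v by (rule Least_le, rule z)
    have nz: "F (y # xs) \<noteq> Some 0" if "y < v" for y
      using that not_less_Least unfolding v by blast
    have "\<forall>y\<in>{..v}. \<forall>\<^sub>F k in sequentially. SF k (list_encode (y # xs)) = Suc (the (F (y # xs)))"
    proof
      fix y assume "y \<in> {..v}"
      then have "F (y # xs) \<noteq> None"
        using 0 z(2) \<open>v \<le> z\<close> by (cases "y = v") auto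
      then show "\<forall>\<^sub>F k in sequentially. SF k (list_encode (y # xs)) = Suc (the (F (y # xs)))"
        using F2[of "y # xs"] n by auto
    qed
    then have "\<forall>\<^sub>F k in sequentially. \<forall>y\<in>{..v}. SF k (list_encode (y # xs)) = Suc (the (F (y # xs)))"
      by (intro eventually_ball_finite) auto
    with eventually_gt_at_top[of v] show ?thesis
    proof eventually_elim
      case (elim k)
      have "(LEAST z. k \<le> z \<or> SF k (ncons z (list_encode xs)) = 1) = v"
      proof (rule Least_equality)
        show "k \<le> v \<or> SF k (ncons v (list_encode xs)) = 1"
          using elim(2) 0 by simp
        show "v \<le> u" if "k \<le> u \<or> SF k (ncons u (list_encode xs)) = 1" for u
        proof (rule ccontr)
          assume "\<not> v \<le> u"
          then have "u < v" by simp
          then have "u < z"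
            using \<open>v \<le> z\<close> by simp
          then obtain w where "F (u # xs) = Some w"
            using z(2) by blast
          then show False
            using that elim nz[OF \<open>u < v\<close>] \<open>u < v\<close> by auto
        qed
      qed
      then show ?case
        using elim by auto
    qed
  qed
qed

lemma partrec_stages: "partrec n F \<Longrightarrow> \<exists>S. stages n F S"
proof (induction rule: partrec.induct)
  case (zero n)
  have "stages n (\<lambda>xs. Some 0) (\<lambda>k x. 1)"
    unfolding stages_def by (auto intro: rec_intros)
  then show ?case by blast
next
  case succ
  have "recursive (\<lambda>p. Suc (Suc (nhd (nsnd p))))"
    by (intro rec_intros)
  then have "stages 1 (\<lambda>xs. Some (Suc (hd xs))) (\<lambda>k x. Suc (Suc (nhd x)))"
    unfolding stages_def by (auto simp: length_Suc_conv)
  then show ?case by blast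
next
  case (proj i n)
  have "recursive (\<lambda>p. Suc (nhd ((ntl ^^ i) (nsnd p))))"
    by (intro rec_intros)
  then have "stages n (\<lambda>xs. Some (xs ! i)) (\<lambda>k x. Suc (nhd ((ntl ^^ i) x)))"
    unfolding stages_def by (auto simp: nhd_funpow_ntl proj)
  then show ?case by blast
next
  case (comp Gs F n)
  then obtain SF SG where "stages (length Gs) F SF" "\<forall>G\<in>set Gs. stages n G (SG G)"
    by metis
  then show ?case
    using stages_comp[of Gs F SF n SG] by blast
next
  case (prim n F G)
  then show ?case
    using stages_prim by blast
next
  case (mu n F)
  then show ?case
    using stages_mu by blast
qed

text \<open>\<open>stages\<close> permits a known result to disappear again. Monotonicity is gained
  by reading the old function at its first success up to stage \<open>k\<close>, or at
  \<open>k\<close> itself if there is none; soundness is inherited because only old values are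
  read.\<close>

lemma partial_recursive_stages:
  assumes "partial_recursive g"
  obtains S where "recursive2 S" "\<And>k x v. S k x = Suc v \<Longrightarrow> g x = Some v"
    "\<And>k k' x. S k x \<noteq> 0 \<Longrightarrow> k \<le> k' \<Longrightarrow> S k' x = S k x"
    "\<And>x v. g x = Some v \<Longrightarrow> \<exists>k. S k x = Suc v"
proof -
  obtain F where F: "partrec 1 F" "\<And>x. F [x] = g x"
    using assms unfolding partial_recursive_def by blast
  obtain S where S: "stages 1 F S"
    using partrec_stages[OF F(1)] by blast
  define R where "R k x = S (LEAST j. k \<le> j \<or> S j (list_encode [x]) \<noteq> 0) (list_encode [x])" for k x
  have S1: "S k (list_encode [x]) = Suc v \<Longrightarrow> g x = Some v" for k x v
    using S F(2) unfolding stages_def by (metis One_nat_def length_Cons list.size(3))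
  have rec: "recursive2 S"
    using S unfolding stages_def by blast
  have R1: "R k x = Suc v \<Longrightarrow> g x = Some v" for k x v
    unfolding R_def by (rule S1)
  have R2: "R k' x \<noteq> 0" if "R k x \<noteq> 0" "k \<le> k'" for k k' x
  proof -
    define Q where "Q k j \<longleftrightarrow> k \<le> j \<or> S j (list_encode [x]) \<noteq> 0" for k j
    have R: "R k x = S (LEAST j. Q k j) (list_encode [x])" for k
      unfolding R_def Q_def ..
    have "Q k' (LEAST j. Q k' j)" by (rule LeastI[of _ k']) (simp add: Q_def)
    show ?thesis
    proof (cases "k' \<le> (LEAST j. Q k' j)")
      case True
      have "Q k' (LEAST j. Q k j)" using that(1) unfolding R by (simp add: Q_def[of k'])
      moreover have "(LEAST j. Q k j) \<le> k'"
        by (rule Least_le) (use that(2) in \<open>simp add: Q_def\<close>)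
      ultimately have "(LEAST j. Q k' j) = (LEAST j. Q k j)"
        using True by (meson Least_le le_antisym le_trans)
      then show ?thesis using that(1) unfolding R by simp
    next
      case False
      with \<open>Q k' (LEAST j. Q k' j)\<close> show ?thesis
        unfolding R by (metis Q_def)
    qed
  qed
  show ?thesis
  proof
    show "recursive2 R"
      unfolding R_def list_encode_Cons list_encode.simps(1)
      by (intro rec_intros recursive_app2[OF rec] recursive_Least) auto
    show "\<And>k x v. R k x = Suc v \<Longrightarrow> g x = Some v" by (rule R1)
    show "R k' x = R k x" if "R k x \<noteq> 0" "k \<le> k'" for k k' x
      using R2[OF that] that(1) R1[of k x] R1[of k' x] by (metis option.inject not0_implies_Suc)
    show "\<exists>k. R k x = Suc v" if "g x = Some v" for x v
    proof -
      have "\<forall>\<^sub>F k in sequentially. S k (list_encode [x]) = Suc v"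
        using S F(2)[of x] that unfolding stages_def by (metis One_nat_def length_Cons list.size(3))
      then obtain k where k: "S k (list_encode [x]) = Suc v"
        by (auto simp: eventually_sequentially)
      define j where "j = (LEAST j. k \<le> j \<or> S j (list_encode [x]) \<noteq> 0)"
      have "j \<le> k" unfolding j_def by (rule Least_le) simp
      moreover have "k \<le> j \<or> S j (list_encode [x]) \<noteq> 0"
        unfolding j_def by (rule LeastI[of _ k]) simp
      ultimately have "S j (list_encode [x]) \<noteq> 0"
        using k by auto
      then have "R k x \<noteq> 0" unfolding R_def j_def .
      then show ?thesis
        using R1[of k x] that by (metis option.inject not0_implies_Suc)
    qed
  qed
qed

section \<open>Binary strings\<close>

definition bval :: "str \<Rightarrow> nat" where
  "bval s = foldl (\<lambda>n b. 2 * n + of_bool b) 0 s"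

lemma bval_Nil [simp]: "bval [] = 0"
  and bval_snoc [simp]: "bval (s @ [b]) = 2 * bval s + of_bool b"
  by (simp_all add: bval_def)

lemma bval_append: "bval (s @ t) = bval s * 2 ^ length t + bval t"
  by (induction t rule: rev_induct) (simp_all flip: append_assoc)

lemma bval_less: "bval s < 2 ^ length s"
  by (induction s rule: rev_induct) auto

text \<open>In binary, the successor of a position is the string itself behind a leading 1. This
  identity links positions, lengths and binary values.\<close>

lemma Suc_str_num: "Suc (str_num s) = 2 ^ length s + bval s"
  by (induction s rule: rev_induct) auto

lemma length_num_str_eq: "length (num_str q) = l \<longleftrightarrow> 2 ^ l \<le> Suc q \<and> Suc q < 2 ^ Suc l"
proof -
  have *: "2 ^ length (num_str q) \<le> Suc q" "Suc q < 2 ^ Suc (length (num_str q))"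
    using Suc_str_num[of "num_str q"] bval_less[of "num_str q"] by simp_all
  show ?thesis
  proof
    assume a: "2 ^ l \<le> Suc q \<and> Suc q < 2 ^ Suc l"
    have 1: "(2::nat) ^ l < 2 ^ Suc (length (num_str q))" and 2: "(2::nat) ^ length (num_str q) < 2 ^ Suc l"
      using * a by linarith+
    from 1 have "l < Suc (length (num_str q))"
      by (rule power_less_imp_less_exp[rotated]) simp
    moreover from 2 have "length (num_str q) < Suc l"
      by (rule power_less_imp_less_exp[rotated]) simp
    ultimately show "length (num_str q) = l"
      by simp
  qed (use * in auto)
qed

lemma length_num_str_Least: "length (num_str q) = (LEAST l. Suc q < 2 ^ Suc l)"
proof (rule Least_equality[symmetric])
  show "Suc q < 2 ^ Suc (length (num_str q))"
    using length_num_str_eq by blast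
  show "length (num_str q) \<le> l" if "Suc q < 2 ^ Suc l" for l
  proof -
    have "(2::nat) ^ length (num_str q) < 2 ^ Suc l"
      using that length_num_str_eq[of q "length (num_str q)"] by linarith
    then have "length (num_str q) < Suc l"
      by (rule power_less_imp_less_exp[rotated]) simp
    then show ?thesis by simp
  qed
qed

lemma recursive_length_num_str [rec_intros]:
  assumes "recursive f"
  shows "recursive (\<lambda>x. length (num_str (f x)))"
proof -
  have "recursive (\<lambda>x. length (num_str x))"
    unfolding length_num_str_Least
    by (intro recursive_Least rec_intros) (metis length_num_str_eq)
  from recursive_comp[OF this assms] show ?thesis .
qed

lemma length_num_str_le: "length (num_str q) \<le> q"
proof -
  have "Suc (length (num_str q)) \<le> 2 ^ length (num_str q)"
    by (rule Suc_leI, rule less_exp)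
  also have "\<dots> \<le> Suc q"
    using length_num_str_eq by blast
  finally show ?thesis by simp
qed

text \<open>Shorter strings come first in the order, so a cut at length \<open>n\<close> is an
  initial segment of the enumeration and the cut oracle becomes a finite bit vector.\<close>

lemma length_le_iff_str_num: "length s \<le> n \<longleftrightarrow> str_num s < 2 ^ Suc n - 1"
proof
  assume "length s \<le> n"
  then have "(2::nat) ^ Suc (length s) \<le> 2 ^ Suc n"
    by (intro power_increasing) auto
  with Suc_str_num[of s] bval_less[of s] have "Suc (str_num s) < 2 ^ Suc n"
    unfolding power_Suc by linarith
  then show "str_num s < 2 ^ Suc n - 1" by linarith
next
  assume "str_num s < 2 ^ Suc n - 1"
  then have "(2::nat) ^ length s < 2 ^ Suc n"
    using Suc_str_num[of s] by linarith
  then have "length s < Suc n"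
    by (rule power_less_imp_less_exp[rotated]) simp
  then show "length s \<le> n" by simp
qed

lemma bval_num_str: "v < 2 ^ l \<Longrightarrow> bval (num_str (2 ^ l - 1 + v)) = v \<and> length (num_str (2 ^ l - 1 + v)) = l"
proof -
  assume "v < 2 ^ l"
  then have "length (num_str (2 ^ l - 1 + v)) = l"
    unfolding length_num_str_eq by auto
  moreover have "Suc (2 ^ l - 1 + v) = 2 ^ l + v"
    by simp
  ultimately show ?thesis
    using Suc_str_num[of "num_str (2 ^ l - 1 + v)"] by simp
qed

lemma real_prefix_nat: "real_prefix \<alpha> n = real_prefix \<alpha> (int (nat n))"
  by (simp add: real_prefix_def)

lemma length_real_prefix [simp]: "length (real_prefix \<alpha> n) = nat n"
  by (simp add: real_prefix_def)

lemma bval_real_prefix: "int (bval (real_prefix \<alpha> (int n))) = \<lfloor>2 ^ n * frac \<alpha>\<rfloor>"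
proof (induction n)
  case 0
  then show ?case by (simp add: real_prefix_def floor_eq_iff frac_lt_1)
next
  case (Suc n)
  define x where "x = 2 ^ n * frac \<alpha>"
  have "\<lfloor>2 * x\<rfloor> = 2 * \<lfloor>x\<rfloor> \<or> \<lfloor>2 * x\<rfloor> = 2 * \<lfloor>x\<rfloor> + 1"
    by linarith
  then have "\<lfloor>2 * x\<rfloor> = 2 * \<lfloor>x\<rfloor> + of_bool (odd \<lfloor>2 * x\<rfloor>)"
    by auto
  moreover have "real_prefix \<alpha> (int (Suc n)) = real_prefix \<alpha> (int n) @ [bin_digit \<alpha> n]"
    by (simp add: real_prefix_def nat_add_distrib)
  ultimately show ?case
    using Suc by (simp add: bin_digit_def x_def mult.assoc)
qed

section \<open>Kraft's inequality and stages of a computer\<close>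

text \<open>Padding every word of \<open>A\<close> in all ways to the maximal length
  \<open>L\<close> gives disjoint subsets of the \<open>2 ^ L\<close> words of that length.\<close>

lemma kraft:
  assumes "prefix_free S" "finite A" "A \<subseteq> S"
  shows "(\<Sum>s\<in>A. 1 / 2 ^ length s :: real) \<le> 1"
proof -
  define L where "L = Max (insert 0 (length ` A))"
  have L: "length s \<le> L" if "s \<in> A" for s
    unfolding L_def by (rule Max_ge) (use that assms in auto)
  define E where "E s = (\<lambda>u. s @ u) ` {u :: str. length u = L - length s}" for s
  have fin: "finite {u :: str. length u = n}" "card {u :: str. length u = n} = 2 ^ n" for n
    using card_lists_length_eq[of "UNIV :: bool set" n] finite_lists_length_eq[of "UNIV :: bool set" n] by auto
  have card: "card (E s) = 2 ^ (L - length s)" for s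
    unfolding E_def by (subst card_image) (auto simp: fin inj_on_def)
  have disj: "E s \<inter> E t = {}" if "s \<in> A" "t \<in> A" "s \<noteq> t" for s t
  proof (rule ccontr)
    assume "E s \<inter> E t \<noteq> {}"
    then obtain u v where "s @ u = t @ v" unfolding E_def by auto
    then have "prefix s t \<or> prefix t s"
      by (metis prefixI prefix_same_cases)
    then have "strict_prefix s t \<or> strict_prefix t s"
      using that(3) by (auto simp: strict_prefix_def)
    then show False
      using assms that unfolding prefix_free_def by blast
  qed
  have "(\<Sum>s\<in>A. card (E s)) = card (\<Union>s\<in>A. E s)"
    by (subst card_UN_disjoint) (use assms disj in \<open>auto simp: E_def fin\<close>)
  also have "\<dots> \<le> card {u :: str. length u = L}"
    by (rule card_mono) (use L in \<open>auto simp: E_def fin\<close>)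
  finally have "(\<Sum>s\<in>A. 2 ^ (L - length s) :: nat) \<le> 2 ^ L"
    by (simp add: card fin)
  then have "real (\<Sum>s\<in>A. 2 ^ (L - length s) :: nat) \<le> 2 ^ L"
    by (metis of_nat_le_iff of_nat_numeral of_nat_power)
  then have "(\<Sum>s\<in>A. 2 ^ (L - length s)) / 2 ^ L \<le> (1 :: real)"
    by simp
  also have "(\<Sum>s\<in>A. 2 ^ (L - length s)) / 2 ^ L = (\<Sum>s\<in>A. 1 / 2 ^ length s :: real)"
    unfolding sum_divide_distrib by (intro sum.cong refl) (use L in \<open>simp add: power_diff[of "2::real"]\<close>)
  finally show ?thesis .
qed

lemma kraft_computer:
  assumes "computer V" "finite A" "A \<subseteq> dom V"
  shows "(\<Sum>s\<in>A. 1 / 2 ^ length s :: real) \<le> 1"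
  using assms(1) unfolding computer_def by (intro kraft[OF _ assms(2,3)]) blast

lemma computer_summable:
  assumes "computer V"
  shows "(\<lambda>p. 1 / 2 ^ length p :: real) summable_on dom V"
proof (rule nonneg_bdd_above_summable_on)
  show "bdd_above (sum (\<lambda>p. 1 / 2 ^ length p :: real) ` {F. F \<subseteq> dom V \<and> finite F})"
    by (rule bdd_aboveI[of _ 1]) (use kraft_computer[OF assms] in blast)
qed auto

lemma sum_le_Omega:
  assumes "computer V" "finite A" "A \<subseteq> dom V"
  shows "(\<Sum>p\<in>A. 1 / 2 ^ length p) \<le> Omega V"
  unfolding Omega_def
  by (rule finite_sum_le_infsum[OF computer_summable[OF assms(1)] assms(2,3)]) auto

lemma Omega_le:
  assumes "computer V" "\<And>A. finite A \<Longrightarrow> A \<subseteq> dom V \<Longrightarrow> (\<Sum>p\<in>A. 1 / 2 ^ length p) \<le> b"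
  shows "Omega V \<le> b"
  unfolding Omega_def
  by (rule infsum_le_finite_sums[OF computer_summable[OF assms(1)] assms(2)])

lemma Omega_le_1: "computer V \<Longrightarrow> Omega V \<le> 1"
  by (rule Omega_le[OF _ kraft_computer])

section \<open>Approximations of a halting probability from below\<close>

locale staged_computer =
  fixes V :: "str \<Rightarrow> str option" and S :: "nat \<Rightarrow> nat \<Rightarrow> nat"
  assumes computer: "computer V"
    and recursive_S: "recursive2 S"
    and S_sound: "S k q = Suc v \<Longrightarrow> V (num_str q) = Some (num_str v)"
    and S_mono: "S k q \<noteq> 0 \<Longrightarrow> k \<le> k' \<Longrightarrow> S k' q = S k q"
    and S_complete: "V (num_str q) = Some x \<Longrightarrow> \<exists>k. S k q = Suc (str_num x)"
begin

definition D :: "nat \<Rightarrow> nat set" where "D k = {q. q < k \<and> S k q \<noteq> 0}"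

definition om :: "nat \<Rightarrow> real" where "om k = (\<Sum>q\<in>D k. 1 / 2 ^ length (num_str q))"

text \<open>The condition \<open>q < k\<close> forces lengths at most \<open>k\<close>, so
  \<open>2 ^ k\<close> is a common denominator for \<open>om k\<close> and the difference in the
  exponent is never truncated.\<close>

definition numer :: "nat \<Rightarrow> nat" where
  "numer k = (\<Sum>q<k. of_bool (S k q \<noteq> 0) * 2 ^ (k - length (num_str q)))"

lemma recursive_S_app [rec_intros]: "recursive f \<Longrightarrow> recursive g \<Longrightarrow> recursive (\<lambda>x. S (f x) (g x))"
  by (rule recursive_app2[OF recursive_S])

lemma recursive_numer [rec_intros]:
  assumes "recursive f"
  shows "recursive (\<lambda>x. numer (f x))"
proof -
  have "recursive numer"
    unfolding numer_def by (intro rec_intros)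
  from recursive_comp[OF this assms] show ?thesis .
qed

lemma finite_D [simp]: "finite (D k)"
  by (rule finite_subset[of _ "{..<k}"]) (auto simp: D_def)

lemma D_mono:
  assumes "k \<le> k'"
  shows "D k \<subseteq> D k'"
proof
  fix q assume q: "q \<in> D k"
  then have "S k' q = S k q"
    unfolding D_def by (intro S_mono[OF _ assms]) simp
  with q assms show "q \<in> D k'"
    by (simp add: D_def)
qed

lemma D_dom: "num_str ` D k \<subseteq> dom V"
proof
  fix p assume "p \<in> num_str ` D k"
  then obtain q where q: "p = num_str q" "S k q \<noteq> 0"
    unfolding D_def by auto
  then obtain v where "S k q = Suc v"
    by (metis not0_implies_Suc)
  from S_sound[OF this] show "p \<in> dom V"
    unfolding q(1) by (rule domI)
qed

lemma eventually_D: "num_str q \<in> dom V \<Longrightarrow> \<forall>\<^sub>F k in sequentially. q \<in> D k"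
proof -
  assume "num_str q \<in> dom V"
  then obtain k where "S k q \<noteq> 0"
    using S_complete by fastforce
  then have "q \<in> D n" if "max (Suc q) k \<le> n" for n
    using S_mono[of k q n] that by (simp add: D_def)
  then show ?thesis
    unfolding eventually_sequentially by blast
qed

lemma om_numer: "om k = numer k / 2 ^ k"
proof -
  have "om k = (\<Sum>q<k. of_bool (S k q \<noteq> 0) / 2 ^ length (num_str q))"
    unfolding om_def D_def by (intro sum.mono_neutral_cong_left) auto
  also have "\<dots> = (\<Sum>q<k. real (of_bool (S k q \<noteq> 0) * 2 ^ (k - length (num_str q))) / 2 ^ k)"
  proof (intro sum.cong refl)
    fix q assume "q \<in> {..<k}"
    then have "length (num_str q) \<le> k"
      using length_num_str_le[of q] by simp
    then show "of_bool (S k q \<noteq> 0) / 2 ^ length (num_str q)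
        = real (of_bool (S k q \<noteq> 0) * 2 ^ (k - length (num_str q))) / 2 ^ k"
      by (simp add: power_diff[of "2::real"])
  qed
  also have "\<dots> = numer k / 2 ^ k"
    unfolding numer_def by (simp only: sum_divide_distrib of_nat_sum)
  finally show ?thesis .
qed

text \<open>Sums over disjoint sets of programs add up, so programs outside \<open>D k\<close> are
  paid out of what is missing from \<open>om k\<close>. This is the source of all lower bounds for
  \<open>Omega V - om k\<close>.\<close>

lemma om_add_le:
  assumes "finite B" "num_str ` B \<subseteq> dom V" "B \<inter> D k = {}"
  shows "om k + (\<Sum>q\<in>B. 1 / 2 ^ length (num_str q)) \<le> Omega V"
proof -
  have inj: "inj_on num_str X" for X
    by (metis inj_onI str_num_num_str)
  have "om k + (\<Sum>q\<in>B. 1 / 2 ^ length (num_str q)) = (\<Sum>q\<in>D k \<union> B. 1 / 2 ^ length (num_str q))"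
    unfolding om_def using assms by (subst sum.union_disjoint) auto
  also have "\<dots> = (\<Sum>p\<in>num_str ` (D k \<union> B). 1 / 2 ^ length p)"
    by (subst sum.reindex[OF inj]) simp
  also have "\<dots> \<le> Omega V"
    by (rule sum_le_Omega[OF computer]) (use assms D_dom[of k] in \<open>auto simp del: domIff\<close>)
  finally show ?thesis .
qed

lemma om_le: "om k \<le> Omega V"
  using om_add_le[of "{}" k] by simp

lemma om_nonneg: "0 \<le> om k"
  unfolding om_def by (intro sum_nonneg) auto

lemma incseq_om: "incseq om"
  unfolding incseq_def om_def by (auto intro!: sum_mono2 D_mono)

lemma om_tendsto: "om \<longlonglongrightarrow> Omega V"
proof (rule tendstoI)
  fix e :: real assume "e > 0"
  then have "\<not> Omega V \<le> Omega V - e" by simp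
  then obtain A where A: "finite A" "A \<subseteq> dom V" "(\<Sum>p\<in>A. 1 / 2 ^ length p) > Omega V - e"
    using Omega_le[OF computer, of "Omega V - e"] by force
  have "\<forall>\<^sub>F k in sequentially. \<forall>p\<in>A. str_num p \<in> D k"
    using A(1,2) by (intro eventually_ball_finite) (auto intro!: eventually_D)
  then show "\<forall>\<^sub>F k in sequentially. dist (om k) (Omega V) < e"
  proof eventually_elim
    case (elim k)
    have "(\<Sum>p\<in>A. 1 / 2 ^ length p :: real) = (\<Sum>q\<in>str_num ` A. 1 / 2 ^ length (num_str q))"
      by (subst sum.reindex) (auto intro: inj_on_inverseI[of _ num_str])
    also have "\<dots> \<le> om k"
      unfolding om_def using elim by (intro sum_mono2) auto
    finally show ?case
      using A(3) om_le[of k] by (auto simp: dist_real_def)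
  qed
qed

end

lemma staged_computer_exists:
  assumes "computer V"
  obtains S where "staged_computer V S"
proof -
  have "partial_recursive (\<lambda>x. map_option str_num (V (num_str x)))"
    using assms unfolding computer_def partial_recursive_str_def by blast
  then show ?thesis
  proof (rule partial_recursive_stages)
    fix S
    assume S: "recursive2 S"
      "\<And>k x v. S k x = Suc v \<Longrightarrow> map_option str_num (V (num_str x)) = Some v"
      "\<And>k k' x. S k x \<noteq> 0 \<Longrightarrow> k \<le> k' \<Longrightarrow> S k' x = S k x"
      "\<And>x v. map_option str_num (V (num_str x)) = Some v \<Longrightarrow> \<exists>k. S k x = Suc v"
    have "staged_computer V S"
    proof
      show "V (num_str q) = Some (num_str v)" if "S k q = Suc v" for k q v
        using S(2)[OF that] by auto
      show "\<exists>k. S k q = Suc (str_num x)" if "V (num_str q) = Some x" for q x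
        using S(4)[of q "str_num x"] that by simp
      show "S k' q = S k q" if "S k q \<noteq> 0" "k \<le> k'" for k k' q
        using that by (rule S(3))
    qed (fact assms S(1))+
    then show ?thesis by (rule that)
  qed
qed

section \<open>Prefix codes with prescribed lengths\<close>

lemma ceiling_div_bounds:
  assumes "0 < (b::nat)"
  shows "(a + (b - 1)) div b * b < a + b" "a \<le> (a + (b - 1)) div b * b"
  using div_mult_mod_eq[of "a + (b - 1)" b] mod_less_divisor[OF assms, of "a + (b - 1)"] assms
  by linarith+

text \<open>Shannon--Fano--Elias coding: item \<open>i\<close> owns the interval of length \<open>1 / 2 ^ L i\<close>
  that starts at the sum of the earlier lengths. The interval contains a dyadic interval of half
  the length, whose index is the code word, so no lengths have to be sorted.\<close>

lemma prefix_code_exists: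
  fixes I :: "nat \<Rightarrow> bool" and L :: "nat \<Rightarrow> nat"
  assumes I: "decidable I" and L: "recursive L"
    and sum: "\<And>N. (\<Sum>i<N. of_bool (I i) / 2 ^ L i :: real) \<le> 1"
  obtains c where "recursive c" "\<And>i. I i \<Longrightarrow> length (num_str (c i)) = Suc (L i)"
    "\<And>i j. I i \<Longrightarrow> I j \<Longrightarrow> prefix (num_str (c i)) (num_str (c j)) \<Longrightarrow> i = j"
proof -
  \<comment> \<open>Every exponent \<open>L j\<close> with \<open>j < i\<close> is at most
    \<open>B i\<close>, so \<open>2 ^ B i\<close> is a computable common denominator of the partial
    sum \<open>x i\<close>, and \<open>X i\<close> is the numerator.\<close>
  define B where "B i = (\<Sum>j<i. L j)" for i
  define X where "X i = (\<Sum>j<i. of_bool (I j) * 2 ^ (B i - L j) :: nat)" for i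
  \<comment> \<open>The ceiling of \<open>x i * 2 ^ Suc (L i)\<close>. The dyadic interval of half
    length with this index starts less than a half length after \<open>x i\<close>, hence ends
    inside the interval of item \<open>i\<close>.\<close>
  define v where "v i = (X i * 2 ^ Suc (L i) + (2 ^ B i - 1)) div 2 ^ B i" for i
  define x where "x i = (\<Sum>j<i. of_bool (I j) / 2 ^ L j :: real)" for i
  have X: "real (X i) / 2 ^ B i = x i" for i
  proof -
    have "real (X i) / 2 ^ B i = (\<Sum>j<i. real (of_bool (I j) * 2 ^ (B i - L j)) / 2 ^ B i)"
      unfolding X_def by (simp only: sum_divide_distrib of_nat_sum)
    also have "\<dots> = x i"
      unfolding x_def
    proof (intro sum.cong refl)
      fix j assume "j \<in> {..<i}"
      then have "L j \<le> B i"
        unfolding B_def by (intro member_le_sum) auto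
      then show "real (of_bool (I j) * 2 ^ (B i - L j)) / 2 ^ B i = of_bool (I j) / 2 ^ L j"
        by (simp add: power_diff[of "2::real"])
    qed
    finally show ?thesis .
  qed
  have v: "x i \<le> v i / 2 ^ Suc (L i)" "v i / 2 ^ Suc (L i) < x i + 1 / 2 ^ Suc (L i)" for i
  proof -
    let ?b = "(2::nat) ^ B i" and ?a = "X i * 2 ^ Suc (L i)"
    have n: "v i * ?b < ?a + ?b" "?a \<le> v i * ?b"
      unfolding v_def by (rule ceiling_div_bounds; simp)+
    have "real (v i) * 2 ^ B i < real (X i) * 2 ^ Suc (L i) + 2 ^ B i"
      using n(1)[THEN of_nat_less_iff[where 'a = real, THEN iffD2]] by simp
    then show "v i / 2 ^ Suc (L i) < x i + 1 / 2 ^ Suc (L i)"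
      unfolding X[symmetric] by (simp add: field_simps)
    have "real (X i) * 2 ^ Suc (L i) \<le> real (v i) * 2 ^ B i"
      using n(2)[THEN of_nat_le_iff[where 'a = real, THEN iffD2]] by simp
    then show "x i \<le> v i / 2 ^ Suc (L i)"
      unfolding X[symmetric] by (simp add: field_simps)
  qed
  define c where "c i = 2 ^ Suc (L i) - 1 + v i" for i
  have step: "x i + 2 / 2 ^ Suc (L i) \<le> x j" if "I i" "i < j" for i j
  proof -
    have "x (Suc i) \<le> x j"
      unfolding x_def using that by (intro sum_mono2) auto
    then show ?thesis
      using that by (simp add: x_def)
  qed
  have "v i < 2 ^ Suc (L i)" if "I i" for i
  proof -
    have "real (v i) / 2 ^ Suc (L i) < 1"
    proof -
      have "x (Suc i) \<le> 1"
        unfolding x_def by (rule sum)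
      moreover have "1 / 2 ^ Suc (L i) \<le> (2 / 2 ^ Suc (L i) :: real)"
        by (rule divide_right_mono) auto
      ultimately show ?thesis
        using v(2)[of i] step[OF that lessI] by linarith
    qed
    then have "real (v i) < 2 ^ Suc (L i)"
      by (simp add: field_simps)
    then have "real (v i) < real (2 ^ Suc (L i))"
      by simp
    then show ?thesis
      by (simp only: of_nat_less_iff)
  qed
  from bval_num_str[OF this] have c: "bval (num_str (c i)) = v i" "length (num_str (c i)) = Suc (L i)"
    if "I i" for i
    using that unfolding c_def by blast+
  show ?thesis
  proof
    have "recursive B"
      unfolding B_def by (intro rec_intros recursive_comp[OF L])
    then show "recursive c"
      unfolding c_def v_def X_def
      by (intro rec_intros recursive_comp[OF I] recursive_comp[OF L] recursive_comp[OF \<open>recursive B\<close>])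
    show "length (num_str (c i)) = Suc (L i)" if "I i" for i
      using c that by blast
    show "i = j" if ij: "I i" "I j" and pre: "prefix (num_str (c i)) (num_str (c j))" for i j
    proof -
      obtain t where t: "num_str (c j) = num_str (c i) @ t"
        using pre by (auto elim: prefixE)
      have len: "Suc (L j) = Suc (L i) + length t"
        using c(2)[OF ij(1)] c(2)[OF ij(2)] t by simp
      have "v j = v i * 2 ^ length t + bval t"
        using c(1)[OF ij(1)] c(1)[OF ij(2)] bval_append[of "num_str (c i)" t] t by simp
      then have "real (v j) / 2 ^ Suc (L j) = v i / 2 ^ Suc (L i) + bval t / 2 ^ length t / 2 ^ Suc (L i)"
        unfolding len power_add by (simp add: add_divide_distrib)
      moreover have "bval t / 2 ^ length t / 2 ^ Suc (L i) < (1 / 2 ^ Suc (L i) :: real)"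
      proof (rule divide_strict_right_mono)
        have "real (bval t) < real (2 ^ length t)"
          using bval_less[of t] by (simp only: of_nat_less_iff)
        then show "real (bval t) / 2 ^ length t < 1"
          by simp
      qed simp
      moreover have "(0::real) \<le> bval t / 2 ^ length t / 2 ^ Suc (L i)"
        by simp
      ultimately have le: "v i / 2 ^ Suc (L i) \<le> v j / 2 ^ Suc (L j)"
        and lt: "v j / 2 ^ Suc (L j) < v i / 2 ^ Suc (L i) + 1 / 2 ^ Suc (L i)"
        by linarith+
      have d: "(2::real) / 2 ^ Suc k = 1 / 2 ^ Suc k + 1 / 2 ^ Suc k" "(0::real) < 1 / 2 ^ Suc k" for k
        by auto
      \<comment> \<open>The prefix relation puts the dyadic interval of \<open>j\<close> inside that
        of \<open>i\<close>, while \<open>step\<close> separates the intervals of distinct items,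
        whichever of the two comes first.\<close>
      show "i = j"
      proof (cases i j rule: linorder_cases)
        case less
        then show ?thesis
          using step[of i j] ij v[of i] v[of j] lt d(1)[of "L i"] by linarith
      next
        case greater
        then show ?thesis
          using step[of j i] ij v[of i] v[of j] le d[of "L j"] by linarith
      qed
    qed
  qed
qed

text \<open>A form of the Kraft-Chaitin theorem in which the output of a request is searched for
  among the \<open>k\<close> with \<open>R i k\<close>. A request that no \<open>k\<close> meets
  leaves its code word undefined, which harms neither the weight bound nor prefix-freeness. The
  search may find a witness other than the given \<open>k\<close>, hence \<open>k'\<close>.\<close>

lemma computer_with_lengths:
  assumes I: "decidable I" and L: "recursive L"
    and sum: "\<And>N. (\<Sum>i<N. of_bool (I i) / 2 ^ L i :: real) \<le> 1"
    and R: "decidable2 R"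
  obtains C where "computer C"
    "\<And>i k. I i \<Longrightarrow> R i k \<Longrightarrow> \<exists>p k'. length p = Suc (L i) \<and> C p = Some (num_str k') \<and> R i k'"
proof (rule prefix_code_exists[OF I L sum])
  fix c
  assume c: "recursive c" "\<And>i. I i \<Longrightarrow> length (num_str (c i)) = Suc (L i)"
    "\<And>i j. I i \<Longrightarrow> I j \<Longrightarrow> prefix (num_str (c i)) (num_str (c j)) \<Longrightarrow> i = j"
  define P where "P x y \<longleftrightarrow> I (nfst y) \<and> R (nfst y) (nsnd y) \<and> x = c (nfst y)" for x y
  define g where "g x = (if \<exists>y. P x y then Some (nsnd (LEAST y. P x y)) else None)" for x
  have "partial_recursive g"
    unfolding g_def
  proof (rule partial_recursive_search)
    show "decidable2 P"
      unfolding P_def by (intro rec_intros recursive_comp[OF I] recursive_app2[OF R] recursive_comp[OF c(1)])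
  qed (intro rec_intros)
  define C where "C p = map_option num_str (g (str_num p))" for p
  have "g = (\<lambda>x. map_option str_num (C (num_str x)))"
    by (auto simp: C_def option.map_comp comp_def option.map_id0[unfolded id_def])
  then have "partial_recursive_str C"
    using \<open>partial_recursive g\<close> unfolding partial_recursive_str_def by simp
  moreover have "prefix_free (dom C)"
  proof -
    have dom: "\<exists>i. I i \<and> p = num_str (c i)" if "p \<in> dom C" for p
    proof -
      have "\<exists>y. P (str_num p) y"
        by (rule ccontr) (use that in \<open>simp add: domIff C_def g_def\<close>)
      then show ?thesis
        unfolding P_def by (metis num_str_str_num)
    qed
    show ?thesis
      unfolding prefix_free_def
    proof (intro ballI notI)
      fix s t assume st: "s \<in> dom C" "t \<in> dom C" "strict_prefix s t"
      then obtain i j where ij: "I i" "s = num_str (c i)" "I j" "t = num_str (c j)"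
        using dom by blast
      then have "i = j"
        using c(3)[OF ij(1,3)] st(3) by (simp add: strict_prefix_def)
      with ij st(3) show False by simp
    qed
  qed
  ultimately have "computer C"
    unfolding computer_def by blast
  moreover have "\<exists>p k'. length p = Suc (L i) \<and> C p = Some (num_str k') \<and> R i k'" if "I i" "R i k" for i k
  proof -
    have "P (c i) (npair i k)"
      using that by (simp add: P_def)
    then have ex: "\<exists>y. P (c i) y" by blast
    define l where "l = (LEAST y. P (c i) y)"
    have "P (c i) l"
      unfolding l_def using ex by (rule LeastI_ex)
    then have l: "I (nfst l)" "R (nfst l) (nsnd l)" "c i = c (nfst l)"
      unfolding P_def by blast+
    \<comment> \<open>A string is a prefix of itself, so equal code words belong to the same
      request.\<close>
    have "i = nfst l"
      using c(3)[OF that(1) l(1)] l(3) by simp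
    moreover have "C (num_str (c i)) = Some (num_str (nsnd l))"
      using ex by (simp add: C_def g_def l_def)
    ultimately show ?thesis
      using l(2) c(2)[OF that(1)] by blast
  qed
  ultimately show ?thesis by (rule that)
qed

section \<open>Optimal computers are slow\<close>

context staged_computer
begin

text \<open>Request at stage \<open>k\<close> a string of length \<open>L k\<close> for an output that \<open>V\<close> has not
  produced yet: an optimal \<open>V\<close> has to spend a comparable measure after stage \<open>k\<close>.\<close>

lemma remaining_measure:
  assumes opt: "optimal_computer V" and I: "decidable I" and L: "recursive L"
    and sum: "\<And>N. (\<Sum>i<N. of_bool (I i) / 2 ^ L i :: real) \<le> 1"
  obtains d :: nat where "\<And>K N. (\<Sum>k=K..<N. of_bool (I k) / 2 ^ L k) \<le> 2 ^ d * (Omega V - om K)"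
proof -
  \<comment> \<open>\<open>S k q = Suc v\<close> puts every output \<open>v\<close> known at stage
    \<open>k\<close> below the sum, so \<open>x k\<close> is new at that stage. The summand
    \<open>k\<close> makes \<open>x\<close> strictly increasing, so different requests ask for
    different outputs.\<close>
  define x where "x k = k + (\<Sum>q<k. S k q)" for k
  have x_less: "x i < x j" if "i < j" for i j
  proof -
    have "(\<Sum>q<i. S i q) \<le> (\<Sum>q<i. S j q)"
    proof (rule sum_mono)
      fix q
      show "S i q \<le> S j q"
        using S_mono[of i q j] that by (cases "S i q = 0") auto
    qed
    also have "\<dots> \<le> (\<Sum>q<j. S j q)"
      using that by (intro sum_mono2) auto
    finally show ?thesis
      using that by (simp add: x_def)
  qed
  have fresh: "v < x k" if "q \<in> D k" "S k q = Suc v" for k q v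
  proof -
    have "S k q \<le> (\<Sum>q<k. S k q)"
      using that(1) by (intro member_le_sum) (auto simp: D_def)
    then show ?thesis
      using that(2) by (simp add: x_def)
  qed
  \<comment> \<open>The relation has a single solution, so the search can only return
    \<open>x i\<close>.\<close>
  have R: "decidable2 (\<lambda>i k. k = x i)"
    unfolding x_def by (intro rec_intros)
  show ?thesis
  proof (rule computer_with_lengths[OF I L sum R])
    fix C
    assume C: "computer C" "\<And>i k. I i \<Longrightarrow> k = x i \<Longrightarrow>
      \<exists>p k'. length p = Suc (L i) \<and> C p = Some (num_str k') \<and> k' = x i"
    obtain d where d: "\<forall>p\<in>dom C. \<exists>q. V q = C p \<and> length q \<le> length p + d"
      using opt C(1) unfolding optimal_computer_def by blast
    have "\<exists>q. V q = Some (num_str (x i)) \<and> length q \<le> Suc (L i) + d" if "I i" for i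
    proof -
      obtain p where p: "length p = Suc (L i)" "C p = Some (num_str (x i))"
        using C(2)[of i "x i"] \<open>I i\<close> by auto
      then have "p \<in> dom C" by (simp add: domIff)
      with d obtain q where "V q = C p" "length q \<le> length p + d" by blast
      with p show ?thesis by auto
    qed
    then obtain q where q: "\<And>i. I i \<Longrightarrow> V (q i) = Some (num_str (x i))"
      "\<And>i. I i \<Longrightarrow> length (q i) \<le> Suc (L i) + d"
      by metis
    show ?thesis
    \<comment> \<open>The extra 1 is the additional bit in the length of the code words.\<close>
    proof (rule that[of "Suc d"])
      fix K N
      let ?A = "{i\<in>{K..<N}. I i}"
      have inj: "inj_on (\<lambda>i. str_num (q i)) ?A"
      proof (rule inj_onI)
        fix i j assume ij: "i \<in> ?A" "j \<in> ?A" "str_num (q i) = str_num (q j)"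
        then have "q i = q j"
          by (metis num_str_str_num)
        then have "num_str (x i) = num_str (x j)"
          using q(1)[of i] q(1)[of j] ij by simp
        then have "x i = x j"
          by (metis str_num_num_str)
        then show "i = j"
          using x_less[of i j] x_less[of j i] by (cases i j rule: linorder_cases) auto
      qed
      have "om K + (\<Sum>q\<in>(\<lambda>i. str_num (q i)) ` ?A. 1 / 2 ^ length (num_str q)) \<le> Omega V"
      proof (rule om_add_le)
        show "num_str ` (\<lambda>i. str_num (q i)) ` ?A \<subseteq> dom V"
          using q(1) by (auto simp: domIff)
        \<comment> \<open>A program known at stage \<open>K\<close> is known at every stage
          \<open>i \<ge> K\<close>, and its output would then lie below \<open>x i\<close>.\<close>
        show "(\<lambda>i. str_num (q i)) ` ?A \<inter> D K = {}"
        proof (rule ccontr)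
          assume "(\<lambda>i. str_num (q i)) ` ?A \<inter> D K \<noteq> {}"
          then obtain i where i: "K \<le> i" "I i" "str_num (q i) \<in> D K"
            by auto
          then have D: "str_num (q i) \<in> D i"
            using D_mono by blast
          then have "S i (str_num (q i)) \<noteq> 0"
            by (simp add: D_def)
          then obtain v where v: "S i (str_num (q i)) = Suc v"
            by (metis not0_implies_Suc)
          from S_sound[OF v] have "v = x i"
            using q(1)[OF i(2)] by (metis num_str_str_num option.inject str_num_num_str)
          with fresh[OF D v] show False by simp
        qed
      qed simp
      also have "(\<Sum>q\<in>(\<lambda>i. str_num (q i)) ` ?A. 1 / 2 ^ length (num_str q) :: real)
          = (\<Sum>i\<in>?A. 1 / 2 ^ length (q i))"
        by (subst sum.reindex[OF inj]) simp
      finally have 1: "(\<Sum>i\<in>?A. 1 / 2 ^ length (q i)) \<le> Omega V - om K"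
        by simp
      have "(\<Sum>k=K..<N. of_bool (I k) / 2 ^ L k) = (\<Sum>k\<in>?A. 1 / 2 ^ L k :: real)"
        by (intro sum.mono_neutral_cong_right) auto
      also have "\<dots> \<le> (\<Sum>k\<in>?A. 2 ^ Suc d * (1 / 2 ^ length (q k)))"
      proof (rule sum_mono)
        fix k assume "k \<in> ?A"
        then have "(2::real) ^ length (q k) \<le> 2 ^ (Suc (L k) + d)"
          by (intro power_increasing q(2)) auto
        then show "1 / 2 ^ L k \<le> 2 ^ Suc d * (1 / 2 ^ length (q k) :: real)"
          by (simp add: power_add field_simps)
      qed
      also have "\<dots> \<le> 2 ^ Suc d * (Omega V - om K)"
        unfolding sum_distrib_left[symmetric] using 1 by (intro mult_left_mono) auto
      finally show "(\<Sum>k=K..<N. of_bool (I k) / 2 ^ L k) \<le> 2 ^ Suc d * (Omega V - om K)" .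
    qed
  qed
qed

text \<open>Requests of length \<open>k + 1\<close> at every stage \<open>k\<close> leave some
  measure to be spent after any given stage. Strictness allows \<open>Omega V - om K\<close> to be
  cancelled in \<open>integral_test\<close>.\<close>

lemma om_less:
  assumes "optimal_computer V"
  shows "om K < Omega V"
proof -
  have L: "recursive (\<lambda>k. Suc k)" and I: "decidable (\<lambda>k. True)"
    by (intro rec_intros)+
  have "(\<Sum>i<N. of_bool True / 2 ^ Suc i :: real) \<le> 1" for N
  proof -
    have "(\<Sum>i<N. of_bool True / 2 ^ Suc i :: real) = 1 - 1 / 2 ^ N"
      by (induction N) (auto simp: field_simps)
    then show ?thesis by simp
  qed
  then obtain d :: nat where
    "\<And>K N. (\<Sum>k=K..<N. of_bool True / 2 ^ Suc k) \<le> 2 ^ d * (Omega V - om K)"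
    by (rule remaining_measure[OF assms I L]) (rule that)
  from this[of K "Suc K"] have "1 / 2 ^ Suc K \<le> 2 ^ d * (Omega V - om K)"
    by simp
  moreover have "(0::real) < 1 / 2 ^ Suc K" by simp
  ultimately have "0 < 2 ^ d * (Omega V - om K)"
    by linarith
  then show ?thesis
    by (simp add: zero_less_mult_iff)
qed

lemma numer_mono: "2 * numer k \<le> numer (Suc k)"
proof -
  have "numer k / 2 ^ k \<le> numer (Suc k) / 2 ^ Suc k"
    using incseq_om unfolding incseq_def om_numer[symmetric] by (meson lessI less_imp_le)
  then have "real (2 * numer k) \<le> real (numer (Suc k))"
    by (simp add: field_simps)
  then show ?thesis
    by (simp only: of_nat_le_iff)
qed

lemma om_diff: "om (Suc k) - om k = real (numer (Suc k) - 2 * numer k) / 2 ^ Suc k"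
  unfolding om_numer using numer_mono[of k] by (simp add: of_nat_diff field_simps)

text \<open>The integral of \<open>\<Sum>n. 2 ^ m n / 2 ^ n * of_bool (P k n)\<close> along the
  increasing sequence \<open>om\<close> is bounded, so the integrand is bounded near \<open>Omega V\<close>.\<close>

lemma integral_test:
  fixes c :: "nat \<Rightarrow> real"
  assumes opt: "optimal_computer V" and m: "recursive m" and P: "decidable2 P"
    and c: "\<And>n N. (\<Sum>k<N. (om (Suc k) - om k) * of_bool (P k n)) * 2 ^ m n \<le> c n"
    and C: "\<And>N. (\<Sum>n<N. c n / 2 ^ n) \<le> 2 ^ C"
  obtains B :: nat where "\<forall>N. (\<forall>n<N. \<forall>\<^sub>F k in sequentially. P k n) \<longrightarrow>
    (\<Sum>n<N. 2 ^ m n / 2 ^ n) \<le> (2 ^ B :: real)"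
proof -
  \<comment> \<open>Stage \<open>k\<close> only sums over \<open>n < k\<close>, a finite and
    computable portion of the integrand; each \<open>n\<close> is left out at finitely many
    stages.\<close>
  define \<delta> where "\<delta> k = (om (Suc k) - om k) * (\<Sum>n<k. of_bool (P k n) * 2 ^ m n / 2 ^ n)" for k
  \<comment> \<open>The numerator of \<open>\<delta> k\<close>: the increment of \<open>om\<close>
    has denominator \<open>2 ^ Suc k\<close> and the inner sum has denominator
    \<open>2 ^ k\<close>.\<close>
  define E where "E k = (numer (Suc k) - 2 * numer k) * (\<Sum>n<k. of_bool (P k n) * 2 ^ (m n + (k - n)))" for k
  have om_diff_nonneg: "0 \<le> om (Suc k) - om k" for k
    using incseq_om by (simp add: incseq_Suc_iff)
  have \<delta>_nonneg: "0 \<le> \<delta> k" for k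
    unfolding \<delta>_def by (intro mult_nonneg_nonneg om_diff_nonneg sum_nonneg) auto
  have \<delta>_E: "\<delta> k = E k / 2 ^ (2 * k + 1)" for k
  proof -
    have "(\<Sum>n<k. of_bool (P k n) * 2 ^ m n / 2 ^ n :: real)
        = (\<Sum>n<k. of_bool (P k n) * 2 ^ (m n + (k - n)) / 2 ^ k)"
    proof (intro sum.cong refl)
      fix n assume "n \<in> {..<k}"
      then have "(2::real) ^ k = 2 ^ n * 2 ^ (k - n)"
        by (simp flip: power_add)
      then show "of_bool (P k n) * 2 ^ m n / 2 ^ n = (of_bool (P k n) * 2 ^ (m n + (k - n)) / 2 ^ k :: real)"
        by (simp add: power_add)
    qed
    also have "\<dots> = real (\<Sum>n<k. of_bool (P k n) * 2 ^ (m n + (k - n)) :: nat) / 2 ^ k"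
      by (simp only: sum_divide_distrib of_nat_sum of_nat_mult of_nat_of_bool of_nat_power of_nat_numeral)
    finally have s: "(\<Sum>n<k. of_bool (P k n) * 2 ^ m n / 2 ^ n :: real)
        = real (\<Sum>n<k. of_bool (P k n) * 2 ^ (m n + (k - n)) :: nat) / 2 ^ k" .
    have "2 * k + 1 = Suc k + k"
      by simp
    then have "(2::real) ^ (2 * k + 1) = 2 ^ Suc k * 2 ^ k"
      by (simp only: power_add)
    then show ?thesis
      unfolding \<delta>_def E_def s om_diff by (simp only: of_nat_mult times_divide_times_eq)
  qed
  have \<delta>_sum: "(\<Sum>k<N. \<delta> k) \<le> 2 ^ C" for N
  proof -
    have "(\<Sum>k<N. \<delta> k) \<le> (\<Sum>k<N. \<Sum>n<N. (om (Suc k) - om k) * of_bool (P k n) * 2 ^ m n / 2 ^ n)"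
    proof (rule sum_mono)
      fix k assume "k \<in> {..<N}"
      have "\<delta> k = (\<Sum>n<k. (om (Suc k) - om k) * of_bool (P k n) * 2 ^ m n / 2 ^ n)"
        unfolding \<delta>_def sum_distrib_left by (simp only: mult.assoc times_divide_eq_right)
      also have "\<dots> \<le> (\<Sum>n<N. (om (Suc k) - om k) * of_bool (P k n) * 2 ^ m n / 2 ^ n)"
        using \<open>k \<in> {..<N}\<close> om_diff_nonneg[of k] by (intro sum_mono2) auto
      finally show "\<delta> k \<le> (\<Sum>n<N. (om (Suc k) - om k) * of_bool (P k n) * 2 ^ m n / 2 ^ n)" .
    qed
    also have "\<dots> = (\<Sum>n<N. \<Sum>k<N. (om (Suc k) - om k) * of_bool (P k n) * 2 ^ m n / 2 ^ n)"
      by (rule sum.swap)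
    also have "\<dots> \<le> (\<Sum>n<N. c n / 2 ^ n)"
    proof (rule sum_mono)
      fix n
      have "(\<Sum>k<N. (om (Suc k) - om k) * of_bool (P k n) * 2 ^ m n / 2 ^ n)
          = (\<Sum>k<N. (om (Suc k) - om k) * of_bool (P k n)) * 2 ^ m n / 2 ^ n"
        by (simp only: sum_distrib_right sum_divide_distrib)
      also have "\<dots> \<le> c n / 2 ^ n"
        by (intro divide_right_mono c) simp
      finally show "(\<Sum>k<N. (om (Suc k) - om k) * of_bool (P k n) * 2 ^ m n / 2 ^ n) \<le> c n / 2 ^ n" .
    qed
    also have "\<dots> \<le> 2 ^ C" by (rule C)
    finally show ?thesis .
  qed
  \<comment> \<open>Since \<open>2 ^ C\<close> bounds the whole integral, the numbers
    \<open>\<delta> k / 2 ^ C\<close> are admissible weights. \<open>L k\<close> rounds them down to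
    powers of two and loses at most a factor 2; the disjunct \<open>E k = 0\<close> keeps the search
    total.\<close>
  define L where "L k = (LEAST l. E k = 0 \<or> 2 ^ (2 * k + 1 + C) \<le> E k * 2 ^ l)" for k
  have ex: "\<exists>l. E k = 0 \<or> 2 ^ (2 * k + 1 + C) \<le> E k * 2 ^ l" for k
    by (intro exI[of _ "2 * k + 1 + C"]) auto
  have L1: "1 / 2 ^ L k \<le> \<delta> k / 2 ^ C" if "E k \<noteq> 0" for k
  proof -
    have "2 ^ (2 * k + 1 + C) \<le> E k * 2 ^ L k"
      using LeastI_ex[OF ex, of k] that unfolding L_def[symmetric] by blast
    then have "real (2 ^ (2 * k + 1 + C)) \<le> real (E k * 2 ^ L k)"
      by (simp only: of_nat_le_iff)
    then show ?thesis
      unfolding \<delta>_E by (simp add: power_add field_simps)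
  qed
  have \<delta>_le: "\<delta> k \<le> 2 ^ C" for k
  proof -
    have "\<delta> k \<le> (\<Sum>k<Suc k. \<delta> k)"
      by (intro member_le_sum \<delta>_nonneg) auto
    then show ?thesis using \<delta>_sum[of "Suc k"] by linarith
  qed
  have L2: "\<delta> k \<le> 2 ^ Suc C * (of_bool (E k \<noteq> 0) / 2 ^ L k)" for k
  proof (cases "E k = 0")
    case True
    then show ?thesis by (simp add: \<delta>_E)
  next
    case False
    show ?thesis
    proof (cases "L k")
      \<comment> \<open>No smaller exponent failed the test here, so the upper bound has to come
        from the total of the integral.\<close>
      case 0
      have "\<delta> k \<le> 2 ^ C" by (rule \<delta>_le)
      also have "\<dots> \<le> 2 ^ Suc C" by simp
      finally show ?thesis using 0 False by simp
    next
      case (Suc l)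
      then have "l < L k" by simp
      then have "\<not> (2 ^ (2 * k + 1 + C) \<le> E k * 2 ^ l)"
        using not_less_Least unfolding L_def by blast
      then have "E k * 2 ^ l \<le> 2 ^ (2 * k + 1 + C)" by simp
      then have "real (E k * 2 ^ l) \<le> real (2 ^ (2 * k + 1 + C))"
        by (simp only: of_nat_le_iff)
      then show ?thesis
        unfolding \<delta>_E Suc using False by (simp add: power_add field_simps)
    qed
  qed
  have "recursive E"
    unfolding E_def by (intro rec_intros recursive_comp[OF m] recursive_app2[OF P])
  then have "recursive L"
    unfolding L_def by (intro recursive_Least rec_intros recursive_comp[OF \<open>recursive E\<close>] ex)
  have I: "decidable (\<lambda>k. E k \<noteq> 0)"
    by (intro rec_intros \<open>recursive E\<close>)
  have "(\<Sum>k<N. of_bool (E k \<noteq> 0) / 2 ^ L k :: real) \<le> 1" for N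
  proof -
    have "(\<Sum>k<N. of_bool (E k \<noteq> 0) / 2 ^ L k :: real) \<le> (\<Sum>k<N. \<delta> k / 2 ^ C)"
    proof (rule sum_mono)
      fix k
      show "of_bool (E k \<noteq> 0) / 2 ^ L k \<le> \<delta> k / 2 ^ C"
        using L1[of k] \<delta>_nonneg[of k] by (cases "E k = 0") auto
    qed
    also have "\<dots> \<le> 1"
      unfolding sum_divide_distrib[symmetric] using \<delta>_sum[of N] by simp
    finally show ?thesis .
  qed
  then obtain d :: nat where
    d: "\<And>K N. (\<Sum>k=K..<N. of_bool (E k \<noteq> 0) / 2 ^ L k) \<le> 2 ^ d * (Omega V - om K)"
    by (rule remaining_measure[OF opt I \<open>recursive L\<close>]) (rule that)
  show ?thesis
  proof (rule that[of "Suc C + d"], intro allI impI)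
    fix N
    assume ev: "\<forall>n<N. \<forall>\<^sub>F k in sequentially. P k n"
    define F where "F = (\<Sum>n<N. 2 ^ m n / 2 ^ n :: real)"
    have "\<forall>\<^sub>F k in sequentially. \<forall>n\<in>{..<N}. P k n"
      using ev by (intro eventually_ball_finite) auto
    then obtain K0 where K0: "\<And>k n. K0 \<le> k \<Longrightarrow> n < N \<Longrightarrow> P k n"
      unfolding eventually_sequentially by blast
    \<comment> \<open>From stage \<open>K\<close> on every \<open>n < N\<close> contributes:
      \<open>K0\<close> makes \<open>P k n\<close> true, and \<open>N\<close> puts \<open>n\<close>
      into the range of the inner sum.\<close>
    define K where "K = max K0 N"
    have \<delta>_ge: "(om (Suc k) - om k) * F \<le> \<delta> k" if "K \<le> k" for k
    proof -
      have "F = (\<Sum>n<N. of_bool (P k n) * 2 ^ m n / 2 ^ n)"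
        unfolding F_def using K0 that by (intro sum.cong refl) (simp add: K_def)
      also have "\<dots> \<le> (\<Sum>n<k. of_bool (P k n) * 2 ^ m n / 2 ^ n)"
        using that by (intro sum_mono2) (auto simp: K_def)
      finally show ?thesis
        unfolding \<delta>_def by (intro mult_left_mono om_diff_nonneg)
    qed
    define Z where "Z = 2 ^ (Suc C + d) * (Omega V - om K)"
    have "(om M - om K) * F \<le> Z" if "K \<le> M" for M
    proof -
      have "(om M - om K) * F = (\<Sum>k=K..<M. (om (Suc k) - om k) * F)"
        unfolding sum_distrib_right[symmetric] using that by (simp add: sum_Suc_diff')
      also have "\<dots> \<le> (\<Sum>k=K..<M. \<delta> k)"
        by (intro sum_mono \<delta>_ge) auto
      also have "\<dots> \<le> (\<Sum>k=K..<M. 2 ^ Suc C * (of_bool (E k \<noteq> 0) / 2 ^ L k))"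
        by (intro sum_mono L2)
      also have "\<dots> \<le> 2 ^ Suc C * (2 ^ d * (Omega V - om K))"
        unfolding sum_distrib_left[symmetric] by (intro mult_left_mono d) simp
      also have "\<dots> = Z"
        by (simp add: Z_def power_add)
      finally show ?thesis .
    qed
    moreover have "(\<lambda>M. (om M - om K) * F) \<longlonglongrightarrow> (Omega V - om K) * F"
      by (intro tendsto_intros om_tendsto)
    ultimately have "(Omega V - om K) * F \<le> Z"
      by (intro LIMSEQ_le_const2) auto
    then have "(Omega V - om K) * F \<le> (Omega V - om K) * 2 ^ (Suc C + d)"
      by (simp add: Z_def mult.commute)
    then show "F \<le> 2 ^ (Suc C + d)"
      using om_less[OF opt, of K] by (simp add: mult_le_cancel_left)
  qed
qed

section \<open>Halting probabilities are not dyadic\<close>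

lemma om_increments_le:
  assumes "lo \<le> hi"
  shows "(\<Sum>k<N. (om (Suc k) - om k) * of_bool (lo \<le> om k \<and> om (Suc k) \<le> hi)) \<le> hi - lo"
proof -
  \<comment> \<open>Clamped to the interval, \<open>om\<close> is still monotone; its increments
    dominate the counted ones and telescope.\<close>
  define cl where "cl y = max lo (min hi y)" for y
  have "(\<Sum>k<N. (om (Suc k) - om k) * of_bool (lo \<le> om k \<and> om (Suc k) \<le> hi))
      \<le> (\<Sum>k<N. cl (om (Suc k)) - cl (om k))"
  proof (rule sum_mono)
    fix k
    have "om k \<le> om (Suc k)"
      using incseq_om by (simp add: incseq_Suc_iff)
    then show "(om (Suc k) - om k) * of_bool (lo \<le> om k \<and> om (Suc k) \<le> hi) \<le> cl (om (Suc k)) - cl (om k)"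
      by (cases "lo \<le> om k \<and> om (Suc k) \<le> hi") (auto simp: cl_def min_def max_def)
  qed
  also have "\<dots> = cl (om N) - cl (om 0)"
    by (rule sum_lessThan_telescope)
  also have "\<dots> \<le> hi - lo"
    using assms by (simp add: cl_def min_def max_def)
  finally show ?thesis .
qed

text \<open>For a dyadic \<open>Omega V\<close> it would be decidable whether \<open>om k\<close> is
  within \<open>1 / 2 ^ n\<close> of it. The number of such \<open>n\<close> grows like the
  logarithm of \<open>1 / (Omega V - om k)\<close>: as an integrand it has a finite integral but is
  unbounded, against \<open>integral_test\<close>.\<close>

lemma Omega_not_dyadic:
  assumes opt: "optimal_computer V"
  shows "Omega V \<noteq> real a / 2 ^ b"
proof
  assume \<Omega>: "Omega V = real a / 2 ^ b"
  define P where "P k n \<longleftrightarrow> a * 2 ^ (k + n) \<le> numer k * 2 ^ (n + b) + 2 ^ (k + b)" for k n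
  have P: "P k n \<longleftrightarrow> Omega V - 1 / 2 ^ n \<le> om k" for k n
  proof -
    have "P k n \<longleftrightarrow> real (a * 2 ^ (k + n)) \<le> real (numer k * 2 ^ (n + b) + 2 ^ (k + b))"
      unfolding P_def by (simp only: of_nat_le_iff)
    also have "\<dots> \<longleftrightarrow> Omega V - 1 / 2 ^ n \<le> om k"
      unfolding \<Omega> om_numer by (simp add: power_add field_simps)
    finally show ?thesis .
  qed
  have "decidable2 P"
    unfolding P_def by (intro rec_intros)
  moreover have "(\<Sum>k<N. (om (Suc k) - om k) * of_bool (P k n)) * 2 ^ n \<le> 1" for n N
  proof -
    have "(\<Sum>k<N. (om (Suc k) - om k) * of_bool (Omega V - 1 / 2 ^ n \<le> om k \<and> om (Suc k) \<le> Omega V))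
        \<le> Omega V - (Omega V - 1 / 2 ^ n)"
      by (rule om_increments_le) simp
    then show ?thesis
      by (simp add: P om_le field_simps)
  qed
  moreover have "(\<Sum>n<N. 1 / 2 ^ n :: real) \<le> 2 ^ 1" for N
  proof -
    have "(\<Sum>n<N. 1 / 2 ^ n :: real) = 2 - 2 / 2 ^ N"
      by (induction N) (auto simp: field_simps)
    then show ?thesis by simp
  qed
  \<comment> \<open>With \<open>m n = n\<close> and \<open>c n = 1\<close>, every \<open>n\<close>
    has weight 1 in the integrand and contributes at most \<open>1 / 2 ^ n\<close> to the
    integral.\<close>
  ultimately obtain B :: nat where B: "\<forall>N. (\<forall>n<N. \<forall>\<^sub>F k in sequentially. P k n) \<longrightarrow>
    (\<Sum>n<N. 2 ^ n / 2 ^ n) \<le> (2 ^ B :: real)"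
    by (rule integral_test[OF opt recursive_id, of P "\<lambda>_. 1" 1])
  have "\<forall>\<^sub>F k in sequentially. P k n" for n
  proof -
    have "\<forall>\<^sub>F k in sequentially. Omega V - 1 / 2 ^ n < om k"
      using om_tendsto by (rule order_tendstoD) simp
    then show ?thesis
      unfolding P by (rule eventually_mono) simp
  qed
  then have "(\<Sum>n<Suc (2 ^ B). 2 ^ n / 2 ^ n) \<le> (2 ^ B :: real)"
    using B by blast
  then show False by simp
qed

lemma Omega_less_1: "optimal_computer V \<Longrightarrow> Omega V < 1"
  using Omega_le_1[OF computer] Omega_not_dyadic[of 1 0] by simp

lemma frac_Omega: "optimal_computer V \<Longrightarrow> frac (Omega V) = Omega V"
  using Omega_less_1 om_nonneg[of 0] om_le[of 0] by (simp add: frac_eq)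

section \<open>Digits of the approximations\<close>

definition trunc :: "nat \<Rightarrow> nat \<Rightarrow> nat" where
  "trunc m k = 2 ^ m * numer k div 2 ^ k"

lemma recursive_trunc [rec_intros]:
  "recursive f \<Longrightarrow> recursive g \<Longrightarrow> recursive (\<lambda>x. trunc (f x) (g x))"
  unfolding trunc_def by (intro rec_intros)

lemma trunc_floor: "int (trunc m k) = \<lfloor>2 ^ m * om k\<rfloor>"
  unfolding trunc_def om_numer
  using floor_divide_of_nat_eq[of "2 ^ m * numer k" "2 ^ k", where 'a = real] by simp

lemma trunc_eq: "trunc m k = a \<longleftrightarrow> a / 2 ^ m \<le> om k \<and> om k < (real a + 1) / 2 ^ m"
proof -
  have "trunc m k = a \<longleftrightarrow> int (trunc m k) = int a"
    by simp
  also have "\<dots> \<longleftrightarrow> real a \<le> 2 ^ m * om k \<and> 2 ^ m * om k < real a + 1"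
    unfolding trunc_floor by (simp add: floor_eq_iff)
  also have "\<dots> \<longleftrightarrow> a / 2 ^ m \<le> om k \<and> om k < (real a + 1) / 2 ^ m"
    by (simp add: field_simps)
  finally show ?thesis .
qed

lemma trunc_mono: "k \<le> k' \<Longrightarrow> trunc m k \<le> trunc m k'"
proof -
  assume "k \<le> k'"
  then have "\<lfloor>2 ^ m * om k\<rfloor> \<le> \<lfloor>2 ^ m * om k'\<rfloor>"
    using incseq_om by (intro floor_mono) (simp add: incseq_def)
  then show ?thesis
    unfolding trunc_floor[symmetric] by simp
qed

lemma trunc_le_Omega:
  assumes "optimal_computer V"
  shows "trunc (nat m) k \<le> bval (real_prefix (Omega V) m)"
proof -
  have "\<lfloor>2 ^ nat m * om k\<rfloor> \<le> \<lfloor>2 ^ nat m * frac (Omega V)\<rfloor>"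
    unfolding frac_Omega[OF assms] using om_le[of k] by (intro floor_mono) simp
  then show ?thesis
    unfolding trunc_floor[symmetric] bval_real_prefix[symmetric] real_prefix_nat[symmetric] by simp
qed

text \<open>Not being dyadic, \<open>Omega V\<close> lies strictly above the left end of its dyadic
  interval, so \<open>om\<close> enters that interval. For a dyadic limit and large \<open>m\<close>
  the floor would stay one too small.\<close>

lemma eventually_trunc:
  assumes "optimal_computer V"
  shows "\<forall>\<^sub>F k in sequentially. trunc (nat m) k = bval (real_prefix (Omega V) m)"
proof -
  define a where "a = bval (real_prefix (Omega V) m)"
  have a: "int a = \<lfloor>2 ^ nat m * Omega V\<rfloor>"
    unfolding a_def by (subst real_prefix_nat) (simp only: bval_real_prefix frac_Omega[OF assms])
  then have "real a \<le> 2 ^ nat m * Omega V"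
    by linarith
  moreover have "Omega V \<noteq> a / 2 ^ nat m"
    by (rule Omega_not_dyadic[OF assms])
  ultimately have "a / 2 ^ nat m < Omega V"
    by (simp add: field_simps)
  with om_tendsto have "\<forall>\<^sub>F k in sequentially. a / 2 ^ nat m < om k"
    by (rule order_tendstoD)
  then show ?thesis
  proof eventually_elim
    case (elim k)
    then have "real a \<le> 2 ^ nat m * om k"
      by (simp add: field_simps)
    then have "int a \<le> int (trunc (nat m) k)"
      unfolding trunc_floor by (simp add: le_floor_iff)
    then show ?case
      using trunc_le_Omega[OF assms, of m k] unfolding a_def by simp
  qed
qed

text \<open>Both ends of a counted step truncate to \<open>a\<close>, so the step runs inside one
  dyadic interval of length \<open>1 / 2 ^ m\<close>. A condition on the left end alone would let a
  step leave the interval.\<close>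

lemma om_increments_trunc_le:
  "(\<Sum>k<N. (om (Suc k) - om k) * of_bool (trunc m k = a \<and> trunc m (Suc k) = a)) * 2 ^ m \<le> 1"
proof -
  have "(\<Sum>k<N. (om (Suc k) - om k) * of_bool (trunc m k = a \<and> trunc m (Suc k) = a))
      \<le> (\<Sum>k<N. (om (Suc k) - om k) * of_bool (a / 2 ^ m \<le> om k \<and> om (Suc k) \<le> (real a + 1) / 2 ^ m))"
  proof (rule sum_mono)
    fix k
    have "0 \<le> om (Suc k) - om k"
      using incseq_om by (simp add: incseq_Suc_iff)
    then show "(om (Suc k) - om k) * of_bool (trunc m k = a \<and> trunc m (Suc k) = a)
        \<le> (om (Suc k) - om k) * of_bool (a / 2 ^ m \<le> om k \<and> om (Suc k) \<le> (real a + 1) / 2 ^ m)"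
      by (intro mult_left_mono) (auto simp: trunc_eq of_bool_def)
  qed
  also have "\<dots> \<le> (real a + 1) / 2 ^ m - a / 2 ^ m"
    by (rule om_increments_le) (simp add: divide_right_mono)
  finally show ?thesis
    by (simp add: field_simps)
qed

end

section \<open>Recursive simulation of oracle machines\<close>

subsection \<open>Stores: numbers coding finitely supported functions\<close>

text \<open>An association list with the newest entry in front. 0 is the empty list, and absent keys
  get the value 0, which therefore serves as the code of a blank cell.\<close>

definition put :: "nat \<Rightarrow> nat \<Rightarrow> nat \<Rightarrow> nat" where
  "put N e v = Suc (npair (npair e v) N)"

definition next_entry :: "nat \<Rightarrow> nat" where "next_entry N = nsnd (N - 1)"

definition entry_key :: "nat \<Rightarrow> nat" where "entry_key N = nfst (nfst (N - 1))"

definition drop_entries :: "nat \<Rightarrow> nat \<Rightarrow> nat" where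
  "drop_entries N j = rec_nat N (\<lambda>_ r. next_entry r) j"

definition find_entry :: "nat \<Rightarrow> nat \<Rightarrow> nat" where
  "find_entry N e = (LEAST j. drop_entries N j = 0 \<or> entry_key (drop_entries N j) = e)"

definition get :: "nat \<Rightarrow> nat \<Rightarrow> nat" where
  "get N e = (let R = drop_entries N (find_entry N e) in if R = 0 then 0 else nsnd (nfst (R - 1)))"

lemma drop_entries_le: "drop_entries N j \<le> N - j"
proof (induction j)
  case (Suc j)
  have "drop_entries N (Suc j) \<le> drop_entries N j - 1"
    by (simp add: drop_entries_def next_entry_def nsnd_le)
  then show ?case using Suc by simp
qed (simp add: drop_entries_def)

lemma find_entry_ex: "\<exists>j. drop_entries N j = 0 \<or> entry_key (drop_entries N j) = e"
  using drop_entries_le[of N N] by (intro exI[of _ N]) simp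

lemma recursive_put [rec_intros]:
  "recursive f \<Longrightarrow> recursive g \<Longrightarrow> recursive h \<Longrightarrow> recursive (\<lambda>x. put (f x) (g x) (h x))"
  unfolding put_def by (intro rec_intros)

lemma recursive_get [rec_intros]:
  assumes "recursive f" "recursive g"
  shows "recursive (\<lambda>x. get (f x) (g x))"
proof -
  have find: "recursive2 find_entry"
    unfolding find_entry_def
    by (rule recursive_Least) (unfold drop_entries_def next_entry_def entry_key_def,
      intro rec_intros, fold drop_entries_def next_entry_def entry_key_def, rule find_entry_ex)
  have "recursive2 get"
    unfolding get_def Let_def drop_entries_def next_entry_def
    by (intro rec_intros recursive_app2[OF find])
  from recursive_app2[OF this assms] show ?thesis .
qed

lemma get_0 [simp]: "get 0 e = 0"
proof -
  have "drop_entries 0 j = 0" for j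
    using drop_entries_le[of 0 j] by simp
  then show ?thesis by (simp add: get_def)
qed

lemma get_put: "get (put N e v) e' = (if e' = e then v else get N e')"
proof -
  have 0: "drop_entries (put N e v) 0 = put N e v"
    by (simp add: drop_entries_def)
  have S: "drop_entries (put N e v) (Suc j) = drop_entries N j" for j
  proof (induction j)
    case (Suc j)
    then show ?case by (simp add: drop_entries_def)
  qed (simp add: drop_entries_def next_entry_def put_def)
  show ?thesis
  proof (cases "e' = e")
    case True
    then have "find_entry (put N e v) e' = 0"
      unfolding find_entry_def 0 by (intro Least_eq_0) (simp add: 0, simp add: entry_key_def put_def)
    then show ?thesis
      unfolding get_def Let_def \<open>find_entry (put N e v) e' = 0\<close> 0 using True by (simp add: put_def)
  next
    case False
    have "find_entry (put N e v) e' = Suc (find_entry N e')"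
      unfolding find_entry_def S[symmetric]
    proof (rule Least_Suc)
      show "drop_entries (put N e v) (Suc (find_entry N e')) = 0 \<or>
          entry_key (drop_entries (put N e v) (Suc (find_entry N e'))) = e'"
        unfolding S find_entry_def by (rule LeastI_ex[OF find_entry_ex])
      show "\<not> (drop_entries (put N e v) 0 = 0 \<or> entry_key (drop_entries (put N e v) 0) = e')"
        unfolding 0 using False by (simp add: entry_key_def put_def)
    qed
    then show ?thesis
      using False by (simp add: get_def S)
  qed
qed

text \<open>A key cannot exceed the code that contains it. This ends the scan in
  \<open>tape_value\<close> for every number, also for one that codes no configuration.\<close>

lemma get_large:
  assumes "N < e"
  shows "get N e = 0"
proof -
  define R where "R = drop_entries N (find_entry N e)"
  have "R = 0 \<or> entry_key R = e"
    unfolding R_def find_entry_def by (rule LeastI_ex[OF find_entry_ex])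
  moreover have "R \<le> N"
    unfolding R_def using drop_entries_le[of N "find_entry N e"] by simp
  moreover have "entry_key R \<le> R"
    unfolding entry_key_def using nfst_le[of "nfst (R - 1)"] nfst_le[of "R - 1"] by simp
  ultimately have "R = 0"
    using assms by auto
  then show ?thesis
    unfolding get_def R_def[symmetric] by simp
qed

text \<open>The transition function of a machine is an arbitrary function. It becomes recursive
  because it is consulted in finitely many situations only, which fit into a table.\<close>

lemma recursive_finite_support:
  assumes "finite {x. f x \<noteq> 0}"
  shows "recursive f"
proof -
  have "recursive (\<lambda>x. \<Sum>a\<in>A. if x = a then f a else 0)" if "finite A" for A
    using that
  proof (induction A)
    case (insert a A)
    then show ?case
      unfolding sum.insert[OF insert.hyps] by (intro rec_intros)
  qed (simp add: recursive_const)
  from this[OF assms] have "recursive (\<lambda>x. \<Sum>a\<in>{x. f x \<noteq> 0}. if x = a then f a else 0)" .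
  moreover have "(\<Sum>a\<in>{x. f x \<noteq> 0}. if x = a then f a else 0) = f x" for x
    using assms by (simp add: sum.delta')
  ultimately show ?thesis by (simp only:)
qed

subsection \<open>Codes of configurations\<close>

text \<open>\<open>Blank\<close> gets the default value of a store. The bits get 1 and 2, the digits
  that \<open>str_num\<close> adds, so that the content of a tape is read off as a position by one
  recursion.\<close>

fun symbol_code :: "symbol \<Rightarrow> nat" where
  "symbol_code Blank = 0"
| "symbol_code (Bit b) = (if b then 2 else 1)"
| "symbol_code (Mark n) = n + 3"

lemma inj_symbol_code: "inj symbol_code"
proof (rule injI)
  fix a b assume "symbol_code a = symbol_code b"
  then show "a = b"
    by (cases a; cases b) (auto split: if_splits)
qed

lemma symbol_code_Bit: "symbol_code a \<in> {1, 2} \<longleftrightarrow> a \<in> range Bit"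
  by (cases a) (auto split: if_splits)

fun move_code :: "move \<Rightarrow> nat" where
  "move_code Go_Left = 0"
| "move_code Stay = 1"
| "move_code Go_Right = 2"

text \<open>Under \<open>int_encode\<close> the even numbers code 0, 1, 2, ... and the odd numbers
  -1, -2, ...; the cases \<open>e = 1\<close> and \<open>e = 0\<close> are the passages between -1
  and 0.\<close>

definition shift_code :: "nat \<Rightarrow> nat \<Rightarrow> nat" where
  "shift_code d e = (if d = 1 then e
     else if d = 2 then (if even e then e + 2 else if e = 1 then 0 else e - 2)
     else (if odd e then e + 2 else if e = 0 then 1 else e - 2))"

lemma int_encode_if: "int_encode h = (if 0 \<le> h then 2 * nat h else Suc (2 * nat (- h - 1)))"
  by (simp add: int_encode_def sum_encode_def)

lemma int_encode_of_nat: "int_encode (int i) = 2 * i"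
  by (simp add: int_encode_if)

lemma shift_code: "shift_code (move_code d) (int_encode h) = int_encode (shift d h)"
  by (cases d) (auto simp: shift_code_def int_encode_if)

lemma recursive_shift_code [rec_intros]:
  "recursive f \<Longrightarrow> recursive g \<Longrightarrow> recursive (\<lambda>x. shift_code (f x) (g x))"
  unfolding shift_code_def by (intro rec_intros)

lemma bval_nth: "i < length s \<Longrightarrow> s ! i \<longleftrightarrow> odd (bval s div 2 ^ (length s - Suc i))"
proof (induction s arbitrary: i rule: rev_induct)
  case (snoc b s)
  show ?case
  proof (cases "i = length s")
    case False
    with snoc.prems have i: "i < length s" by simp
    then have "length (s @ [b]) - Suc i = Suc (length s - Suc i)" by simp
    then have "bval (s @ [b]) div 2 ^ (length (s @ [b]) - Suc i)
        = (2 * bval s + of_bool b) div 2 div 2 ^ (length s - Suc i)"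
      by (simp only: bval_snoc power_Suc div_mult2_eq)
    also have "(2 * bval s + of_bool b) div 2 = bval s" by simp
    finally show ?thesis
      using snoc.IH[OF i] i by (simp add: nth_append)
  qed simp
qed simp

definition str_bit :: "nat \<Rightarrow> nat \<Rightarrow> nat" where
  "str_bit x i = of_bool (odd ((Suc x - 2 ^ length (num_str x)) div 2 ^ (length (num_str x) - Suc i)))"

lemma str_bit: "i < length (num_str x) \<Longrightarrow> str_bit x i = of_bool (num_str x ! i)"
  using Suc_str_num[of "num_str x"] bval_nth[of i "num_str x"] by (simp add: str_bit_def)

lemma recursive_str_bit [rec_intros]:
  "recursive f \<Longrightarrow> recursive g \<Longrightarrow> recursive (\<lambda>x. str_bit (f x) (g x))"
  unfolding str_bit_def by (intro rec_intros)

text \<open>\<open>int_encode\<close> doubles nonnegative integers, so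
  \<open>npair (Suc j) (2 * i)\<close> is the key of cell \<open>i\<close> of tape \<open>j\<close>.
  The search finds the end of the block of bits.\<close>

definition tape_value :: "nat \<Rightarrow> nat \<Rightarrow> nat" where
  "tape_value j N = rec_nat 0 (\<lambda>i r. 2 * r + get N (npair (Suc j) (2 * i)))
     (LEAST i. \<not> (get N (npair (Suc j) (2 * i)) = 1 \<or> get N (npair (Suc j) (2 * i)) = 2))"

lemma recursive_tape_value [rec_intros]:
  assumes "recursive f"
  shows "recursive (\<lambda>x. tape_value j (f x))"
proof -
  have "recursive (tape_value j)"
    unfolding tape_value_def
  proof (intro rec_intros recursive_Least)
    fix N
    have "N < 2 * Suc N" by simp
    also have "\<dots> \<le> npair (Suc j) (2 * Suc N)" by (rule le_npair2)
    finally have "N < npair (Suc j) (2 * Suc N)" .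
    from get_large[OF this]
    show "\<exists>i. \<not> (get N (npair (Suc j) (2 * i)) = 1 \<or> get N (npair (Suc j) (2 * i)) = 2)"
      by (intro exI[of _ "Suc N"]) simp
  qed
  from recursive_comp[OF this assms] show ?thesis .
qed

lemma tape_value:
  assumes "\<And>c. get N (npair (Suc j) (int_encode c)) = symbol_code (fst T c)"
  shows "tape_value j N = str_num (tape_string T)"
proof -
  have g: "get N (npair (Suc j) (2 * i)) = symbol_code (fst T (int i))" for i
    using assms[of "int i"] by (simp add: int_encode_of_nat)
  define l where "l = (LEAST i::nat. fst T (int i) \<notin> range Bit)"
  have l: "(LEAST i. \<not> (get N (npair (Suc j) (2 * i)) = 1 \<or> get N (npair (Suc j) (2 * i)) = 2)) = l"
    unfolding l_def g using symbol_code_Bit by simp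
  have bit: "fst T (int i) \<in> range Bit" if "i < l" for i
    using that not_less_Least unfolding l_def by blast
  have "rec_nat 0 (\<lambda>i r. 2 * r + get N (npair (Suc j) (2 * i))) n
      = str_num (map (\<lambda>i. fst T (int i) = Bit True) [0..<n])" if "n \<le> l" for n
    using that
  proof (induction n)
    case (Suc n)
    then obtain b where "fst T (int n) = Bit b"
      using bit[of n] by auto
    with Suc show ?case by (simp add: g)
  qed simp
  from this[OF order_refl] show ?thesis
    unfolding tape_value_def l by (cases T) (simp add: l_def)
qed

section \<open>Simulation of a fixed oracle machine\<close>

locale simulated_machine =
  fixes M :: otm
  assumes M: "oracle_machine M"
begin

definition wf_config :: "config \<Rightarrow> bool" where
  "wf_config cfg \<longleftrightarrow> fst cfg \<in> states M \<and> length (snd cfg) = tapes M \<and>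
     (\<forall>T\<in>set (snd cfg). \<forall>c. fst T c \<in> alphabet M)"

lemma M_facts: "finite (states M)" "finite (alphabet M)" "3 \<le> tapes M"
    "Blank \<in> alphabet M" "Bit b \<in> alphabet M"
    "start_state M \<in> states M" "yes_state M \<in> states M" "no_state M \<in> states M"
    "halt_state M \<noteq> query_state M"
proof -
  have *: "finite (states M) \<and> finite (alphabet M) \<and> 3 \<le> tapes M \<and> {Blank, Bit False, Bit True} \<subseteq> alphabet M \<and>
    {start_state M, halt_state M, query_state M, yes_state M, no_state M} \<subseteq> states M \<and>
    halt_state M \<noteq> query_state M"
    using M unfolding oracle_machine_def by (elim conjE, intro conjI)
  show "finite (states M)" using * by (elim conjE)
  show "finite (alphabet M)" using * by (elim conjE)
  show "3 \<le> tapes M" using * by (elim conjE)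
  show "Blank \<in> alphabet M" using * by simp
  show "Bit b \<in> alphabet M" using * by (cases b) simp_all
  show "start_state M \<in> states M" using * by simp
  show "yes_state M \<in> states M" using * by simp
  show "no_state M \<in> states M" using * by simp
  show "halt_state M \<noteq> query_state M" using * by (elim conjE)
qed

lemma trans_closed:
  assumes "q \<in> states M" "q \<noteq> halt_state M" "q \<noteq> query_state M"
    "set as \<subseteq> alphabet M" "length as = tapes M" "trans M q as = (q', acts)"
  shows "q' \<in> states M" "length acts = tapes M" "fst ` set acts \<subseteq> alphabet M"
proof -
  have "\<forall>q \<in> states M - {halt_state M, query_state M}. \<forall>as.
      set as \<subseteq> alphabet M \<and> length as = tapes M \<longrightarrow>
      (case trans M q as of (q', acts) \<Rightarrow>
        q' \<in> states M \<and> length acts = tapes M \<and> fst ` set acts \<subseteq> alphabet M)"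
    using M unfolding oracle_machine_def by (elim conjE)
  moreover have "q \<in> states M - {halt_state M, query_state M}"
    using assms by simp
  ultimately have "\<forall>as. set as \<subseteq> alphabet M \<and> length as = tapes M \<longrightarrow>
      (case trans M q as of (q', acts) \<Rightarrow>
        q' \<in> states M \<and> length acts = tapes M \<and> fst ` set acts \<subseteq> alphabet M)"
    by (rule bspec)
  then have "case trans M q as of (q', acts) \<Rightarrow>
        q' \<in> states M \<and> length acts = tapes M \<and> fst ` set acts \<subseteq> alphabet M"
    by (rule allE) (erule mp, intro conjI assms)
  then have "q' \<in> states M \<and> length acts = tapes M \<and> fst ` set acts \<subseteq> alphabet M"
    unfolding assms(6) by simp
  then show "q' \<in> states M" "length acts = tapes M" "fst ` set acts \<subseteq> alphabet M"
    by simp_all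
qed

lemma wf_init: "wf_config (otm_init M x)"
proof -
  have "fst T c \<in> alphabet M" if "T = string_tape x \<or> T = blank_tape" for T c
    using that M_facts(4,5) by (auto simp: string_tape_def blank_tape_def)
  moreover have "T = string_tape x \<or> T = blank_tape" if "T \<in> set (snd (otm_init M x))" for T
    using that by (auto simp: otm_init_def)
  ultimately show ?thesis
    unfolding wf_config_def using M_facts(3,6) by (simp add: otm_init_def)
qed

lemma read_alphabet:
  assumes "wf_config (q, ts)"
  shows "set (map tape_read ts) \<subseteq> alphabet M" "length (map tape_read ts) = tapes M"
proof -
  have "tape_read T \<in> alphabet M" if "T \<in> set ts" for T
  proof -
    have "fst T c \<in> alphabet M" for c
      using assms that unfolding wf_config_def by auto
    moreover have "tape_read T = fst T (snd T)"
      by (cases T) simp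
    ultimately show ?thesis by simp
  qed
  then show "set (map tape_read ts) \<subseteq> alphabet M" by auto
  show "length (map tape_read ts) = tapes M"
    using assms unfolding wf_config_def by simp
qed

lemma wf_step:
  assumes "wf_config cfg"
  shows "wf_config (otm_step M A cfg)"
proof -
  obtain q ts where cfg: "cfg = (q, ts)" by (cases cfg)
  have q: "q \<in> states M" and ts: "length ts = tapes M" "\<forall>T\<in>set ts. \<forall>c. fst T c \<in> alphabet M"
    using assms unfolding wf_config_def cfg by auto
  show ?thesis
  proof (cases "q = halt_state M \<or> q = query_state M")
    case True
    then show ?thesis
      using q ts M_facts unfolding cfg wf_config_def by auto
  next
    case False
    obtain q' acts where t: "trans M q (map tape_read ts) = (q', acts)"
      by (cases "trans M q (map tape_read ts)")
    have nh: "q \<noteq> halt_state M" "q \<noteq> query_state M"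
      using False by simp_all
    note cl = trans_closed[OF q nh read_alphabet[OF assms[unfolded cfg]] t]
    have "fst (tape_act a T) c \<in> alphabet M" if "(a, T) \<in> set (zip acts ts)" for a T c
    proof -
      have "fst a \<in> alphabet M"
        using cl(3) set_zip_leftD[OF that] by auto
      moreover have "fst T c \<in> alphabet M" for c
        using ts(2) set_zip_rightD[OF that] by auto
      ultimately show ?thesis
        by (cases a; cases T) auto
    qed
    then show ?thesis
      using False cl ts unfolding cfg wf_config_def by (auto simp: t)
  qed
qed

definition represents :: "nat \<Rightarrow> config \<Rightarrow> bool" where
  "represents N cfg \<longleftrightarrow> get N (npair 0 (tapes M)) = fst cfg \<and>
     (\<forall>i<tapes M. get N (npair 0 i) = int_encode (snd (snd cfg ! i)) \<and>
       (\<forall>c. get N (npair (Suc i) (int_encode c)) = symbol_code (fst (snd cfg ! i) c)))"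

definition situation :: "nat \<Rightarrow> nat" where
  "situation N = list_encode (get N (npair 0 (tapes M)) #
     map (\<lambda>i. get N (npair (Suc i) (get N (npair 0 i)))) [0..<tapes M])"

definition situations :: "nat set" where
  "situations = (\<lambda>(q, as). list_encode (q # map symbol_code as)) `
     ((states M) \<times> {as. set as \<subseteq> alphabet M \<and> length as = tapes M})"

lemma finite_situations: "finite situations"
  unfolding situations_def
  by (intro finite_imageI finite_cartesian_product finite_lists_length_eq M_facts)

definition trans_at :: "nat \<Rightarrow> nat \<times> (symbol \<times> move) list" where
  "trans_at x = trans M (hd (list_decode x)) (map (inv symbol_code) (tl (list_decode x)))"

lemma trans_at: "trans_at (list_encode (q # map symbol_code as)) = trans M q as"
proof -
  have "list_decode (list_encode (q # map symbol_code as)) = q # map symbol_code as"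
    by (rule list_encode_inverse)
  then show ?thesis
    unfolding trans_at_def by (simp only: list.sel list.map_comp) (simp add: comp_def inv_f_f[OF inj_symbol_code])
qed

definition state_table :: "nat \<Rightarrow> nat" where
  "state_table x = (if x \<in> situations then fst (trans_at x) else 0)"

definition write_table :: "nat \<Rightarrow> nat \<Rightarrow> nat" where
  "write_table i x = (if x \<in> situations then symbol_code (fst (snd (trans_at x) ! i)) else 0)"

definition move_table :: "nat \<Rightarrow> nat \<Rightarrow> nat" where
  "move_table i x = (if x \<in> situations then move_code (snd (snd (trans_at x) ! i)) else 0)"

lemma recursive_tables: "recursive state_table" "recursive (write_table i)" "recursive (move_table i)"
  unfolding state_table_def write_table_def move_table_def
  by (rule recursive_finite_support, rule finite_subset[OF _ finite_situations], auto)+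

lemma recursive_situation: "recursive situation"
proof -
  have "recursive (\<lambda>N. list_encode (map (\<lambda>i. get N (npair (Suc i) (get N (npair 0 i)))) [0..<tapes M]))"
    by (rule recursive_list_encode) (intro rec_intros)
  then show ?thesis
    unfolding situation_def list_encode_Cons by (intro rec_intros)
qed

text \<open>Heads and situation are read from the old store \<open>N\<close> and only the writes go
  to the new one, so the tapes act simultaneously.\<close>

definition act_upto :: "nat \<Rightarrow> nat \<Rightarrow> nat" where
  "act_upto n N = rec_nat N (\<lambda>i R. put (put R (npair (Suc i) (get N (npair 0 i))) (write_table i (situation N)))
     (npair 0 i) (shift_code (move_table i (situation N)) (get N (npair 0 i)))) n"

lemma recursive_act_upto: "recursive (act_upto n)"
proof (induction n)
  case 0
  show ?case unfolding act_upto_def by (simp add: recursive_id)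
next
  case (Suc n)
  have "recursive (\<lambda>N. put (put (act_upto n N) (npair (Suc n) (get N (npair 0 n))) (write_table n (situation N)))
     (npair 0 n) (shift_code (move_table n (situation N)) (get N (npair 0 n))))"
    by (intro rec_intros Suc recursive_comp[OF recursive_tables(2)] recursive_comp[OF recursive_tables(3)]
      recursive_situation)
  then show ?case
    by (simp add: act_upto_def)
qed

lemma get_act_upto_head:
  "get (act_upto n N) (npair 0 i) = (if i < n then shift_code (move_table i (situation N)) (get N (npair 0 i))
     else get N (npair 0 i))"
  by (induction n) (auto simp: act_upto_def get_put less_Suc_eq)

lemma get_act_upto_cell:
  "get (act_upto n N) (npair (Suc i) e) = (if i < n \<and> e = get N (npair 0 i) then write_table i (situation N)
     else get N (npair (Suc i) e))"
  by (induction n) (auto simp: act_upto_def get_put less_Suc_eq)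

text \<open>The oracle is a decidable relation with a parameter \<open>p\<close> instead of a fixed
  set. Stage and length bound can then be arguments of the simulation.\<close>

definition step_code :: "(nat \<Rightarrow> nat \<Rightarrow> bool) \<Rightarrow> nat \<Rightarrow> nat \<Rightarrow> nat" where
  "step_code Q p N =
    (if get N (npair 0 (tapes M)) = halt_state M then N
     else if get N (npair 0 (tapes M)) = query_state M then
       put N (npair 0 (tapes M)) (if Q p (tape_value 1 N) then yes_state M else no_state M)
     else put (act_upto (tapes M) N) (npair 0 (tapes M)) (state_table (situation N)))"

lemma represents_step:
  assumes rep: "represents N cfg" and wf: "wf_config cfg"
  shows "represents (step_code Q p N) (otm_step M {s. Q p (str_num s)} cfg)"
proof -
  obtain q ts where cfg: "cfg = (q, ts)" by (cases cfg)
  have q: "q \<in> states M" and ts: "length ts = tapes M"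
    using wf unfolding wf_config_def cfg by auto
  have state: "get N (npair 0 (tapes M)) = q"
    and head: "\<And>i. i < tapes M \<Longrightarrow> get N (npair 0 i) = int_encode (snd (ts ! i))"
    and cell: "\<And>i c. i < tapes M \<Longrightarrow> get N (npair (Suc i) (int_encode c)) = symbol_code (fst (ts ! i) c)"
    using rep unfolding represents_def cfg by auto
  consider "q = halt_state M" | "q = query_state M" "q \<noteq> halt_state M"
    | "q \<noteq> halt_state M" "q \<noteq> query_state M" by blast
  then show ?thesis
  proof cases
    case 1
    then show ?thesis
      using rep unfolding cfg by (simp add: step_code_def state)
  next
    case 2
    have "tape_value 1 N = str_num (tape_string (ts ! 1))"
      by (rule tape_value) (use cell[of 1] M_facts(3) in simp)
    then show ?thesis
      using 2 unfolding represents_def cfg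
      by (simp add: step_code_def state get_put head cell)
  next
    case 3
    obtain q' acts where t: "trans M q (map tape_read ts) = (q', acts)"
      by (cases "trans M q (map tape_read ts)")
    note read = read_alphabet[OF wf[unfolded cfg]]
    have acts: "length acts = tapes M"
      by (rule trans_closed(2)[OF q 3 read t])
    have "situation N = list_encode (q # map symbol_code (map tape_read ts))"
    proof -
      have "map (\<lambda>i. get N (npair (Suc i) (get N (npair 0 i)))) [0..<tapes M]
          = map symbol_code (map tape_read ts)"
      proof (rule nth_equalityI)
        fix i assume "i < length (map (\<lambda>i. get N (npair (Suc i) (get N (npair 0 i)))) [0..<tapes M])"
        then have i: "i < tapes M" by simp
        have "tape_read (ts ! i) = fst (ts ! i) (snd (ts ! i))"
          by (cases "ts ! i") simp
        then show "map (\<lambda>i. get N (npair (Suc i) (get N (npair 0 i)))) [0..<tapes M] ! i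
            = map symbol_code (map tape_read ts) ! i"
          using i ts by (simp add: head cell)
      qed (simp add: ts)
      then show ?thesis
        unfolding situation_def state by (simp only:)
    qed
    moreover have "list_encode (q # map symbol_code (map tape_read ts)) \<in> situations"
      unfolding situations_def using q read by (intro image_eqI[of _ _ "(q, map tape_read ts)"]) auto
    moreover have "trans_at (list_encode (q # map symbol_code (map tape_read ts))) = (q', acts)"
      unfolding trans_at by (rule t)
    ultimately have "situation N \<in> situations" "trans_at (situation N) = (q', acts)"
      by (simp_all only:)
    then have tab: "state_table (situation N) = q'"
      "write_table i (situation N) = symbol_code (fst (acts ! i))"
      "move_table i (situation N) = move_code (snd (acts ! i))" for i
      unfolding state_table_def write_table_def move_table_def by simp_all
    have "step_code Q p N = put (act_upto (tapes M) N) (npair 0 (tapes M)) q'"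
      using 3 by (simp add: step_code_def state tab)
    moreover have "otm_step M {s. Q p (str_num s)} cfg = (q', map2 tape_act acts ts)"
      using 3 by (simp add: cfg t)
    moreover have "represents (put (act_upto (tapes M) N) (npair 0 (tapes M)) q') (q', map2 tape_act acts ts)"
      unfolding represents_def fst_conv snd_conv
    proof (intro conjI allI impI)
      fix i assume i: "i < tapes M"
      obtain a d where a: "acts ! i = (a, d)" by (cases "acts ! i")
      obtain T h where T: "ts ! i = (T, h)" by (cases "ts ! i")
      have nth: "map2 tape_act acts ts ! i = (T(h := a), shift d h)"
        using i acts ts by (simp add: a T)
      show "get (put (act_upto (tapes M) N) (npair 0 (tapes M)) q') (npair 0 i) = int_encode (snd (map2 tape_act acts ts ! i))"
        unfolding nth using i by (simp add: get_put get_act_upto_head tab head a T shift_code)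
      fix c
      show "get (put (act_upto (tapes M) N) (npair 0 (tapes M)) q') (npair (Suc i) (int_encode c))
          = symbol_code (fst (map2 tape_act acts ts ! i) c)"
        unfolding nth using i by (simp add: get_put get_act_upto_cell tab head cell a T int_encode_eq)
    qed (simp add: get_put)
    ultimately show ?thesis by simp
  qed
qed

definition init_code :: "nat \<Rightarrow> nat" where
  "init_code x = rec_nat (put 0 (npair 0 (tapes M)) (start_state M))
     (\<lambda>i r. put r (npair 1 (2 * i)) (Suc (str_bit x i))) (length (num_str x))"

lemma represents_init: "represents (init_code x) (otm_init M (num_str x))"
proof -
  define F where "F n = rec_nat (put 0 (npair 0 (tapes M)) (start_state M))
     (\<lambda>i r. put r (npair 1 (2 * i)) (Suc (str_bit x i))) n" for n
  have F: "get (F n) (npair 0 i) = (if i = tapes M then start_state M else 0)"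
    "get (F n) (npair 1 (2 * i)) = (if i < n then Suc (str_bit x i) else 0)"
    "odd e \<Longrightarrow> get (F n) (npair 1 e) = 0"
    "get (F n) (npair (Suc (Suc i)) e) = 0" for n i e
    by (induction n) (auto simp: F_def get_put less_Suc_eq)
  have init: "init_code x = F (length (num_str x))"
    by (simp add: init_code_def F_def)
  show ?thesis
    unfolding represents_def
  proof (intro conjI allI impI)
    show "get (init_code x) (npair 0 (tapes M)) = fst (otm_init M (num_str x))"
      by (simp add: init F otm_init_def)
    fix i assume i: "i < tapes M"
    show "get (init_code x) (npair 0 i) = int_encode (snd (snd (otm_init M (num_str x)) ! i))"
      using i by (cases i) (simp_all add: init F otm_init_def string_tape_def blank_tape_def int_encode_if)
    fix c
    show "get (init_code x) (npair (Suc i) (int_encode c))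
        = symbol_code (fst (snd (otm_init M (num_str x)) ! i) c)"
    proof (cases i)
      case 0
      show ?thesis
      proof (cases "0 \<le> c")
        case True
        then obtain m where c: "c = int m" using nonneg_eq_int by blast
        show ?thesis
          using F(2)[of "length (num_str x)" m]
          by (simp add: 0 c init int_encode_of_nat otm_init_def string_tape_def str_bit)
      next
        case False
        then have "odd (int_encode c)"
          by (simp add: int_encode_if)
        from F(3)[OF this] show ?thesis
          using False by (simp add: 0 init otm_init_def string_tape_def)
      qed
    next
      case (Suc j)
      then show ?thesis
        using i F(4) by (simp add: init otm_init_def blank_tape_def)
    qed
  qed
qed

definition run_code :: "(nat \<Rightarrow> nat \<Rightarrow> bool) \<Rightarrow> nat \<Rightarrow> nat \<Rightarrow> nat \<Rightarrow> nat" where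
  "run_code Q p x t = rec_nat (init_code x) (\<lambda>_ r. step_code Q p r) t"

lemma represents_run:
  "represents (run_code Q p x t) (otm_run M {s. Q p (str_num s)} (num_str x) t) \<and>
   wf_config (otm_run M {s. Q p (str_num s)} (num_str x) t)"
proof (induction t)
  case 0
  show ?case
    using represents_init wf_init by (simp add: run_code_def otm_run_def)
next
  case (Suc t)
  then show ?case
    using represents_step wf_step by (simp add: run_code_def otm_run_def)
qed

definition output_code :: "(nat \<Rightarrow> nat \<Rightarrow> bool) \<Rightarrow> nat \<Rightarrow> nat \<Rightarrow> nat \<Rightarrow> nat" where
  "output_code Q p x t = (if get (run_code Q p x t) (npair 0 (tapes M)) = halt_state M
     then Suc (tape_value 2 (run_code Q p x t)) else 0)"

lemma output_code:
  "output_code Q p x t =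
    (if fst (otm_run M {s. Q p (str_num s)} (num_str x) t) = halt_state M
     then Suc (str_num (tape_string (snd (otm_run M {s. Q p (str_num s)} (num_str x) t) ! 2))) else 0)"
proof -
  have rep: "represents (run_code Q p x t) (otm_run M {s. Q p (str_num s)} (num_str x) t)"
    using represents_run by blast
  have "tape_value 2 (run_code Q p x t)
      = str_num (tape_string (snd (otm_run M {s. Q p (str_num s)} (num_str x) t) ! 2))"
  proof (rule tape_value)
    have "2 < tapes M"
      using M_facts(3) by simp
    then show "get (run_code Q p x t) (npair (Suc 2) (int_encode c))
        = symbol_code (fst (snd (otm_run M {s. Q p (str_num s)} (num_str x) t) ! 2) c)" for c
      using rep unfolding represents_def by blast
  qed
  with rep show ?thesis
    by (simp add: output_code_def represents_def)
qed

lemma recursive_output_code: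
  assumes Q: "decidable2 Q"
  shows "recursive3 (output_code Q)"
proof -
  have step: "recursive2 (step_code Q)"
    unfolding step_code_def
    by (intro rec_intros recursive_app2[OF Q] recursive_comp[OF recursive_act_upto]
      recursive_comp[OF recursive_tables(1)] recursive_comp[OF recursive_situation])
  have init: "recursive init_code"
    unfolding init_code_def by (intro rec_intros)
  have "recursive3 (run_code Q)"
    unfolding run_code_def by (intro rec_intros recursive_app2[OF step] recursive_comp[OF init])
  then show ?thesis
    unfolding output_code_def by (intro rec_intros)
qed

end

lemma otm_run_halted:
  assumes "fst (otm_run M A x t) = halt_state M" "t \<le> t'"
  shows "otm_run M A x t' = otm_run M A x t"
  using assms(2)
proof (induction t' rule: dec_induct)
  case (step n)
  obtain q ts where "otm_run M A x t = (q, ts)" by (cases "otm_run M A x t")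
  with step assms(1) show ?case
    by (simp add: otm_run_def)
qed simp

lemma otm_output_eqI:
  assumes "fst (otm_run M A x t) = halt_state M"
  shows "otm_output M A x = Some (tape_string (snd (otm_run M A x t) ! 2))"
proof -
  define l where "l = (LEAST t. fst (otm_run M A x t) = halt_state M)"
  have l: "fst (otm_run M A x l) = halt_state M" "l \<le> t"
    unfolding l_def using assms by (auto intro: LeastI Least_le)
  have "otm_run M A x t = otm_run M A x l"
    by (rule otm_run_halted[OF l])
  then show ?thesis
    unfolding otm_output_def l_def[symmetric] using assms by auto
qed

section \<open>A machine yields summability\<close>

text \<open>The function given by \<open>total_recursive_pos\<close> is undefined at 0, while the
  closure rules ask for total functions. The search for a stage with a known value is stopped by
  \<open>x = 0\<close>.\<close>

lemma total_recursive_pos_extend: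
  assumes "total_recursive_pos f"
  obtains g where "recursive g" "\<And>n. 1 \<le> n \<Longrightarrow> g n = f n"
proof (rule partial_recursive_stages[OF assms[unfolded total_recursive_pos_def]])
  fix S
  assume S: "recursive2 S" "\<And>k x v. S k x = Suc v \<Longrightarrow> (if 1 \<le> x then Some (f x) else None) = Some v"
    "\<And>x v. (if 1 \<le> x then Some (f x) else None) = Some v \<Longrightarrow> \<exists>k. S k x = Suc v"
  define t where "t x = (LEAST k. x = 0 \<or> S k x \<noteq> 0)" for x
  have ex: "\<exists>k. x = 0 \<or> S k x \<noteq> 0" for x
  proof (cases "x = 0")
    case False
    then obtain k where "S k x = Suc (f x)"
      using S(3)[of x "f x"] by auto
    then have "S k x \<noteq> 0" by simp
    then show ?thesis by blast
  qed simp
  have "recursive t"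
    unfolding t_def by (intro recursive_Least rec_intros recursive_app2[OF S(1)] ex)
  then have "recursive (\<lambda>x. S (t x) x - 1)"
    by (intro rec_intros recursive_app2[OF S(1)])
  moreover have "S (t x) x - 1 = f x" if "1 \<le> x" for x
  proof -
    have "S (t x) x \<noteq> 0"
      using LeastI_ex[OF ex, of x] that unfolding t_def[symmetric] by simp
    then obtain v where "S (t x) x = Suc v"
      by (metis not0_implies_Suc)
    with S(2)[OF this] that show ?thesis by simp
  qed
  ultimately show thesis by (rule that)
qed

lemma finite_set_upto: "finite (set_upto S (int n))"
proof (rule finite_subset)
  show "set_upto S (int n) \<subseteq> {s. set s \<subseteq> UNIV \<and> length s \<le> n}"
    by (auto simp: set_upto_def)
qed (rule finite_lists_length_le, simp)

lemma sum_of_bool_le_power: "(\<Sum>n<N. of_bool (l \<le> n) / 2 ^ n :: real) \<le> 2 / 2 ^ l"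
proof -
  have "(\<Sum>n<N. of_bool (l \<le> n) / 2 ^ n :: real) = (if N \<le> l then 0 else 2 / 2 ^ l - 2 / 2 ^ N)"
  proof (induction N)
    case (Suc N)
    consider "Suc N \<le> l" | "l = N" | "l < N" by linarith
    then show ?case
      by cases (use Suc in simp_all)
  qed simp
  then show ?thesis by simp
qed

text \<open>A string \<open>s\<close> in the domain is counted in all \<open>set_upto (dom V) n\<close> with
  \<open>length s \<le> n\<close>, which costs \<open>2 / 2 ^ length s\<close> in total.\<close>

lemma sum_card_set_upto:
  assumes "computer V"
  shows "(\<Sum>n<N. real (card (set_upto (dom V) (int n))) / 2 ^ n) \<le> 2"
proof -
  let ?E = "\<lambda>n. set_upto (dom V) (int n)"
  have "(\<Sum>n<N. real (card (?E n)) / 2 ^ n) = (\<Sum>n<N. \<Sum>s\<in>?E N. of_bool (length s \<le> n) / 2 ^ n)"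
  proof (intro sum.cong refl)
    fix n assume "n \<in> {..<N}"
    then have "?E n = {s \<in> ?E N. length s \<le> n}"
      by (auto simp: set_upto_def)
    moreover have "(\<Sum>s\<in>?E N. of_bool (length s \<le> n) / 2 ^ n :: real)
        = (\<Sum>s\<in>{s \<in> ?E N. length s \<le> n}. 1 / 2 ^ n)"
      by (intro sum.mono_neutral_cong_right) (auto simp: finite_set_upto)
    ultimately show "real (card (?E n)) / 2 ^ n = (\<Sum>s\<in>?E N. of_bool (length s \<le> n) / 2 ^ n)"
      by simp
  qed
  also have "\<dots> = (\<Sum>s\<in>?E N. \<Sum>n<N. of_bool (length s \<le> n) / 2 ^ n)"
    by (rule sum.swap)
  also have "\<dots> \<le> (\<Sum>s\<in>?E N. 2 * (1 / 2 ^ length s))"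
    by (intro sum_mono) (use sum_of_bool_le_power in simp)
  also have "\<dots> \<le> 2 * 1"
    unfolding sum_distrib_left[symmetric]
    by (intro mult_left_mono kraft_computer[OF assms] finite_set_upto) (auto simp: set_upto_def)
  finally show ?thesis by simp
qed

lemma summable_of_machine:
  assumes V: "optimal_computer V" and W: "optimal_computer W" and f: "total_recursive_pos f"
    and M: "oracle_machine M"
    and out: "\<And>n. 1 \<le> n \<Longrightarrow> otm_output M (set_upto (dom V) (int n)) (num_str n) =
      Some (real_prefix (Omega W) (int n - int (f n) - int c))"
  shows "summable (\<lambda>n. 1 / 2 ^ f (Suc n) :: real)"
proof -
  obtain g where g: "recursive g" "\<And>n. 1 \<le> n \<Longrightarrow> g n = f n"
    by (rule total_recursive_pos_extend[OF f]) (rule that)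
  have "computer V" "computer W"
    using V W unfolding optimal_computer_def by blast+
  obtain SV where "staged_computer V SV"
    by (rule staged_computer_exists[OF \<open>computer V\<close>])
  then interpret V: staged_computer V SV .
  obtain SW where "staged_computer W SW"
    by (rule staged_computer_exists[OF \<open>computer W\<close>])
  then interpret W: staged_computer W SW .
  interpret M: simulated_machine M
    by unfold_locales (rule M)
  \<comment> \<open>Truncated subtraction gives 0 where \<open>n - f n - c\<close> is negative, in
    accordance with the empty output prescribed there.\<close>
  define m where "m n = n - (g n + c)" for n
  have m: "nat (int n - int (f n) - int c) = m n" if "1 \<le> n" for n
    using g(2)[OF that] by (simp add: m_def)
  have recm: "recursive m"
    unfolding m_def by (intro rec_intros g(1))
  define Q where "Q p q \<longleftrightarrow> q < nfst p \<and> SV (nfst p) q \<noteq> 0 \<and> length (num_str q) \<le> nsnd p" for p q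
  have recQ: "decidable2 Q"
    unfolding Q_def by (intro rec_intros V.recursive_S_app)
  define A where "A k n = {s. Q (npair k n) (str_num s)}" for k n
  have A: "A k n = {s. str_num s \<in> V.D k \<and> length s \<le> n}" for k n
    unfolding A_def Q_def V.D_def by auto
  have A_sub: "A k n \<subseteq> set_upto (dom V) (int n)" for k n
  proof
    fix s assume "s \<in> A k n"
    then have "num_str (str_num s) \<in> dom V" "length s \<le> n"
      using V.D_dom[of k] unfolding A by blast+
    then show "s \<in> set_upto (dom V) (int n)"
      by (simp add: set_upto_def)
  qed
  have A_mono: "A k n \<subseteq> A k' n" if "k \<le> k'" for k k' n
    using V.D_mono[OF that] unfolding A by blast
  have A_finite: "finite (A k n)" for k n
    by (rule finite_subset[OF A_sub finite_set_upto])
  \<comment> \<open>The stage \<open>k\<close> serves both as approximation of the oracle and as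
    time bound.\<close>
  define res where "res k n = M.output_code Q (npair k n) n k" for k n
  have res: "res k n = (if fst (otm_run M (A k n) (num_str n) k) = halt_state M
     then Suc (str_num (tape_string (snd (otm_run M (A k n) (num_str n) k) ! 2))) else 0)" for k n
    unfolding res_def A_def by (rule M.output_code)
  \<comment> \<open>By \<open>Suc_str_num\<close> the right-hand side is \<open>Suc\<close> of the
    position of the string of \<open>m n\<close> digits of \<open>W.om k\<close>. The last conjunct
    keeps the step of \<open>W.om\<close> in one dyadic interval. Index 0, about which
    \<open>out\<close> says nothing, is always counted.\<close>
  define P where "P k n \<longleftrightarrow> n = 0 \<or>
    (res k n = 2 ^ m n + W.trunc (m n) k \<and> W.trunc (m n) (Suc k) = W.trunc (m n) k)" for k n
  have recP: "decidable2 P"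
    unfolding P_def res_def
    by (intro rec_intros W.recursive_trunc recursive_comp[OF recm] recursive_app3[OF M.recursive_output_code[OF recQ]])
  have P_eventually: "\<forall>\<^sub>F k in sequentially. P k n" for n
  proof (cases "n = 0")
    case True
    then show ?thesis by (simp add: P_def)
  next
    case False
    then have n: "1 \<le> n" by simp
    let ?E = "set_upto (dom V) (int n)"
    define r where "r = real_prefix (Omega W) (int n - int (f n) - int c)"
    have "otm_output M ?E (num_str n) \<noteq> None"
      using out[OF n] by simp
    then obtain t where t: "fst (otm_run M ?E (num_str n) t) = halt_state M"
      unfolding otm_output_def by (meson option.distinct)
    have r: "tape_string (snd (otm_run M ?E (num_str n) t) ! 2) = r"
      using otm_output_eqI[OF t] out[OF n] by (simp add: r_def)
    have "length r = m n"
      unfolding r_def using m[OF n] by simp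
    then have sr: "Suc (str_num r) = 2 ^ m n + bval r"
      using Suc_str_num[of r] by simp
    have ev1: "\<forall>\<^sub>F k in sequentially. \<forall>s\<in>?E. str_num s \<in> V.D k"
      by (intro eventually_ball_finite finite_set_upto ballI V.eventually_D) (simp add: set_upto_def)
    have ev2: "\<forall>\<^sub>F k in sequentially. W.trunc (m n) k = bval r"
      using W.eventually_trunc[OF W, of "int n - int (f n) - int c"] unfolding r_def m[OF n] .
    have ev3: "\<forall>\<^sub>F k in sequentially. W.trunc (m n) (Suc k) = bval r"
      using ev2 by (rule eventually_compose_filterlim[OF _ filterlim_Suc])
    show ?thesis
      using ev1 ev2 ev3 eventually_ge_at_top[of t]
    proof eventually_elim
      case (elim k)
      have "?E \<subseteq> A k n"
        using elim(1) unfolding A by (auto simp: set_upto_def)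
      with A_sub[of k n] have "A k n = ?E" by blast
      then have "res k n = Suc (str_num r)"
        unfolding res using otm_run_halted[OF t elim(4)] t r by simp
      then show ?case
        using elim(2,3) sr by (simp add: P_def)
    qed
  qed
  \<comment> \<open>Equal oracles give equal runs, and a halted run no longer changes, so the output
    does not depend on the number of steps allowed.\<close>
  have res_eq: "res k n = res k' n" if "A k n = A k' n" "res k n \<noteq> 0" "res k' n \<noteq> 0" "k \<le> k'" for k k' n
  proof -
    have "fst (otm_run M (A k n) (num_str n) k) = halt_state M"
      using that(2) unfolding res by (metis (full_types))
    from otm_run_halted[OF this that(4)] show ?thesis
      using that unfolding res by simp
  qed
  \<comment> \<open>An increasing chain of subsets of a set with \<open>J\<close> elements takes at
    most \<open>J + 1\<close> values.\<close>
  define c' where "c' n = real (card (set_upto (dom V) (int n))) + 1" for n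
  have P_sum: "(\<Sum>k<N. (W.om (Suc k) - W.om k) * of_bool (P k n)) * 2 ^ m n \<le> c' n" for n N
  proof (cases "n = 0")
    case True
    have "(\<Sum>k<N. (W.om (Suc k) - W.om k) * of_bool (0 \<le> W.om k \<and> W.om (Suc k) \<le> 1)) \<le> 1 - 0"
      by (rule W.om_increments_le) simp
    moreover have "W.om k \<le> 1" for k
      using W.om_le[of k] Omega_le_1[OF \<open>computer W\<close>] by simp
    ultimately show ?thesis
      using True by (simp add: P_def W.om_nonneg m_def c'_def)
  next
    case False
    \<comment> \<open>The sets \<open>A k n\<close> increase with \<open>k\<close>, so each is
      identified by its cardinality.\<close>
    define j where "j k = card (A k n)" for k
    define J where "J = card (set_upto (dom V) (int n))"
    have j_le: "j k \<le> J" for k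
      unfolding j_def J_def by (rule card_mono[OF finite_set_upto A_sub])
    have j_eq: "A k n = A k' n" if "j k = j k'" "k \<le> k'" for k k'
      using card_subset_eq[OF A_finite A_mono[OF that(2)]] that(1) unfolding j_def by blast
    \<comment> \<open>While the oracle has \<open>i\<close> elements the output of \<open>M\<close>
      is constant, and agreement with it pins down the truncation.\<close>
    define a where "a i = W.trunc (m n) (SOME k. P k n \<and> j k = i)" for i
    have a: "W.trunc (m n) k = a (j k)" if "P k n" for k
    proof -
      define l where "l = (SOME l. P l n \<and> j l = j k)"
      have "P l n \<and> j l = j k"
        unfolding l_def by (rule someI[of _ k]) (use that in simp)
      then have l: "P l n" "j l = j k" by simp_all
      have *: "res k n = 2 ^ m n + W.trunc (m n) k" "res l n = 2 ^ m n + W.trunc (m n) l"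
        using that l(1) False unfolding P_def by blast+
      then have nz: "res k n \<noteq> 0" "res l n \<noteq> 0" by simp_all
      have "res k n = res l n"
      proof (cases "k \<le> l")
        case True
        show ?thesis
          by (rule res_eq[OF j_eq[OF l(2)[symmetric] True] nz True])
      next
        case False
        then have "l \<le> k" by simp
        show ?thesis
          by (rule res_eq[OF j_eq[OF l(2) \<open>l \<le> k\<close>] nz(2,1) \<open>l \<le> k\<close>, symmetric])
      qed
      with * show ?thesis
        unfolding a_def l_def[symmetric] by simp
    qed
    have nonneg: "0 \<le> W.om (Suc k) - W.om k" for k
      using W.incseq_om by (simp add: incseq_Suc_iff)
    have "(\<Sum>k<N. (W.om (Suc k) - W.om k) * of_bool (P k n))
        \<le> (\<Sum>k<N. \<Sum>i\<le>J. (W.om (Suc k) - W.om k) * of_bool (W.trunc (m n) k = a i \<and> W.trunc (m n) (Suc k) = a i))"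
    proof (rule sum_mono)
      fix k
      show "(W.om (Suc k) - W.om k) * of_bool (P k n)
          \<le> (\<Sum>i\<le>J. (W.om (Suc k) - W.om k) * of_bool (W.trunc (m n) k = a i \<and> W.trunc (m n) (Suc k) = a i))"
      proof (cases "P k n")
        case True
        then have "W.trunc (m n) k = a (j k)" "W.trunc (m n) (Suc k) = a (j k)"
          using a[OF True] False unfolding P_def by simp_all
        then have "(W.om (Suc k) - W.om k) * of_bool (P k n)
            = (W.om (Suc k) - W.om k) * of_bool (W.trunc (m n) k = a (j k) \<and> W.trunc (m n) (Suc k) = a (j k))"
          using True by simp
        also have "\<dots> \<le> (\<Sum>i\<le>J. (W.om (Suc k) - W.om k) * of_bool (W.trunc (m n) k = a i \<and> W.trunc (m n) (Suc k) = a i))"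
          using nonneg[of k] j_le[of k]
          by (intro member_le_sum[of "j k" "{..J}"
            "\<lambda>i. (W.om (Suc k) - W.om k) * of_bool (W.trunc (m n) k = a i \<and> W.trunc (m n) (Suc k) = a i)"]) auto
        finally show ?thesis .
      qed (use nonneg[of k] in \<open>simp add: sum_nonneg\<close>)
    qed
    also have "\<dots> = (\<Sum>i\<le>J. \<Sum>k<N. (W.om (Suc k) - W.om k) * of_bool (W.trunc (m n) k = a i \<and> W.trunc (m n) (Suc k) = a i))"
      by (rule sum.swap)
    finally have "(\<Sum>k<N. (W.om (Suc k) - W.om k) * of_bool (P k n)) * 2 ^ m n
        \<le> (\<Sum>i\<le>J. \<Sum>k<N. (W.om (Suc k) - W.om k) * of_bool (W.trunc (m n) k = a i \<and> W.trunc (m n) (Suc k) = a i)) * 2 ^ m n"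
      by (rule mult_right_mono) simp
    also have "\<dots> \<le> (\<Sum>i\<le>J. 1)"
      unfolding sum_distrib_right[of _ "{..J}"] by (intro sum_mono W.om_increments_trunc_le)
    also have "\<dots> = c' n"
      by (simp add: c'_def J_def)
    finally show ?thesis .
  qed
  \<comment> \<open>The bound 4 consists of 2 for the elements of the domain and 2 for the summand 1
    in \<open>c'\<close>.\<close>
  have c'_sum: "(\<Sum>n<N. c' n / 2 ^ n) \<le> 2 ^ 2" for N
  proof -
    have "(\<Sum>n<N. c' n / 2 ^ n) = (\<Sum>n<N. real (card (set_upto (dom V) (int n))) / 2 ^ n) + (\<Sum>n<N. of_bool (0 \<le> n) / 2 ^ n)"
      by (simp add: c'_def add_divide_distrib sum.distrib)
    also have "\<dots> \<le> 2 + 2 / 2 ^ 0"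
      by (intro add_mono sum_card_set_upto[OF \<open>computer V\<close>] sum_of_bool_le_power)
    finally show ?thesis by simp
  qed
  obtain B :: nat where B: "\<forall>N. (\<forall>n<N. \<forall>\<^sub>F k in sequentially. P k n) \<longrightarrow>
    (\<Sum>n<N. 2 ^ m n / 2 ^ n) \<le> (2 ^ B :: real)"
    by (rule W.integral_test[OF W recm recP P_sum c'_sum])
  show ?thesis
  proof (rule summableI_nonneg_bounded)
    fix N
    have "(\<Sum>n<N. 1 / 2 ^ f (Suc n) :: real) \<le> (\<Sum>n<N. 2 ^ c * (2 ^ m (Suc n) / 2 ^ Suc n))"
    proof (rule sum_mono)
      fix n
      \<comment> \<open>Truncation in \<open>m\<close> can only raise the number of digits, so the
        inequality also holds where \<open>m (Suc n)\<close> is 0.\<close>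
      have "Suc n \<le> c + m (Suc n) + f (Suc n)"
        using g(2)[of "Suc n"] by (simp add: m_def)
      then have "(2::real) ^ Suc n \<le> 2 ^ (c + m (Suc n) + f (Suc n))"
        by (rule power_increasing) simp
      then show "1 / 2 ^ f (Suc n) \<le> 2 ^ c * (2 ^ m (Suc n) / 2 ^ Suc n :: real)"
        by (simp add: power_add field_simps)
    qed
    also have "\<dots> \<le> 2 ^ c * (\<Sum>n<Suc N. 2 ^ m n / 2 ^ n)"
      unfolding sum_distrib_left[symmetric] sum.lessThan_Suc_shift by (intro mult_left_mono) auto
    also have "\<dots> \<le> 2 ^ c * 2 ^ B"
      by (intro mult_left_mono B[rule_format] P_eventually) simp
    finally show "(\<Sum>n<N. 1 / 2 ^ f (Suc n) :: real) \<le> 2 ^ c * 2 ^ B" .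
  qed simp
qed

section \<open>Structured programs for oracle machines\<close>

datatype com =
    Skip
  | Act nat "symbol option" move
  | Seq com com
  | While nat "symbol set" com
  | If nat "symbol set" com com
  | Query com com

type_synonym store = "nat \<Rightarrow> tape"

definition act :: "symbol option \<Rightarrow> move \<Rightarrow> tape \<Rightarrow> tape" where
  "act w d T = tape_act (case w of None \<Rightarrow> tape_read T | Some a \<Rightarrow> a, d) T"

inductive exec :: "str set \<Rightarrow> com \<Rightarrow> store \<Rightarrow> store \<Rightarrow> bool" for A where
  exec_Skip: "exec A Skip \<sigma> \<sigma>"
| exec_Act: "exec A (Act i w d) \<sigma> (\<sigma>(i := act w d (\<sigma> i)))"
| exec_Seq: "exec A c1 \<sigma> \<sigma>' \<Longrightarrow> exec A c2 \<sigma>' \<sigma>'' \<Longrightarrow> exec A (Seq c1 c2) \<sigma> \<sigma>''"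
| exec_While_stop: "tape_read (\<sigma> i) \<notin> X \<Longrightarrow> exec A (While i X c) \<sigma> \<sigma>"
| exec_While_step: "tape_read (\<sigma> i) \<in> X \<Longrightarrow> exec A c \<sigma> \<sigma>' \<Longrightarrow> exec A (While i X c) \<sigma>' \<sigma>'' \<Longrightarrow>
    exec A (While i X c) \<sigma> \<sigma>''"
| exec_If_true: "tape_read (\<sigma> i) \<in> X \<Longrightarrow> exec A c1 \<sigma> \<sigma>' \<Longrightarrow> exec A (If i X c1 c2) \<sigma> \<sigma>'"
| exec_If_false: "tape_read (\<sigma> i) \<notin> X \<Longrightarrow> exec A c2 \<sigma> \<sigma>' \<Longrightarrow> exec A (If i X c1 c2) \<sigma> \<sigma>'"
| exec_Query_yes: "tape_string (\<sigma> 1) \<in> A \<Longrightarrow> exec A c1 \<sigma> \<sigma>' \<Longrightarrow> exec A (Query c1 c2) \<sigma> \<sigma>'"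
| exec_Query_no: "tape_string (\<sigma> 1) \<notin> A \<Longrightarrow> exec A c2 \<sigma> \<sigma>' \<Longrightarrow> exec A (Query c1 c2) \<sigma> \<sigma>'"

fun tapes_used :: "com \<Rightarrow> nat" where
  "tapes_used Skip = 0"
| "tapes_used (Act i w d) = Suc i"
| "tapes_used (Seq c1 c2) = max (tapes_used c1) (tapes_used c2)"
| "tapes_used (While i X c) = max (Suc i) (tapes_used c)"
| "tapes_used (If i X c1 c2) = max (Suc i) (max (tapes_used c1) (tapes_used c2))"
| "tapes_used (Query c1 c2) = max (tapes_used c1) (tapes_used c2)"

fun written :: "com \<Rightarrow> symbol set" where
  "written Skip = {}"
| "written (Act i w d) = set_option w"
| "written (Seq c1 c2) = written c1 \<union> written c2"
| "written (While i X c) = written c"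
| "written (If i X c1 c2) = written c1 \<union> written c2"
| "written (Query c1 c2) = written c1 \<union> written c2"

fun csize :: "com \<Rightarrow> nat" where
  "csize Skip = 0"
| "csize (Act i w d) = 1"
| "csize (Seq c1 c2) = csize c1 + csize c2"
| "csize (While i X c) = csize c + 2"
| "csize (If i X c1 c2) = csize c1 + csize c2 + 2"
| "csize (Query c1 c2) = csize c1 + csize c2 + 4"

definition idle :: "symbol list \<Rightarrow> (symbol \<times> move) list" where
  "idle as = map (\<lambda>a. (a, Stay)) as"

text \<open>\<open>code k c p\<close> is the transition table of \<open>c\<close> on the states \<open>p, \<dots>, p + csize c - 1\<close>,
  with exit state \<open>p + csize c\<close>. A query at state \<open>p\<close> leaves its return address as
  \<open>Mark p\<close> on the extra tape \<open>k\<close>, because all queries share the states \<open>0\<close> (query),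
  \<open>1\<close> (yes) and \<open>2\<close> (no); the answer is received in state \<open>p + 1\<close> or \<open>p + 2\<close>.\<close>

fun code :: "nat \<Rightarrow> com \<Rightarrow> nat \<Rightarrow> nat \<Rightarrow> symbol list \<Rightarrow> nat \<times> (symbol \<times> move) list" where
  "code k Skip p q as = (p, idle as)"
| "code k (Act i w d) p q as =
    (p + 1, (idle as)[i := (case w of None \<Rightarrow> as ! i | Some a \<Rightarrow> a, d)])"
| "code k (Seq c1 c2) p q as =
    (if q < p + csize c1 then code k c1 p q as else code k c2 (p + csize c1) q as)"
| "code k (While i X c) p q as =
    (if q = p then (if as ! i \<in> X then p + 1 else p + csize c + 2, idle as)
     else if q = p + 1 + csize c then (p, idle as)
     else code k c (p + 1) q as)"
| "code k (If i X c1 c2) p q as =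
    (if q = p then (if as ! i \<in> X then p + 1 else p + 2 + csize c1, idle as)
     else if q < p + 1 + csize c1 then code k c1 (p + 1) q as
     else if q = p + 1 + csize c1 then (p + csize c1 + csize c2 + 2, idle as)
     else code k c2 (p + 2 + csize c1) q as)"
| "code k (Query c1 c2) p q as =
    (if q = p then (0, (idle as)[k := (Mark p, Stay)])
     else if q = p + 1 then (p + 3, idle as)
     else if q = p + 2 then (p + 4 + csize c1, idle as)
     else if q < p + 3 + csize c1 then code k c1 (p + 3) q as
     else if q = p + 3 + csize c1 then (p + csize c1 + csize c2 + 4, idle as)
     else code k c2 (p + 4 + csize c1) q as)"

text \<open>\<open>min\<close> keeps the return addresses inside the state set for every mark of the
  alphabet, including marks that \<open>c\<close> itself may write. For a mark left by a query it
  has no effect, since such a mark lies below \<open>4 + csize c\<close>.\<close>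

definition machine :: "com \<Rightarrow> nat \<Rightarrow> otm" where
  "machine c k = \<lparr>
    states = {..csize c + 6},
    alphabet = {Blank, Bit False, Bit True} \<union> Mark ` {..csize c + 4} \<union> written c,
    tapes = Suc k, start_state = 4, halt_state = 3, query_state = 0, yes_state = 1, no_state = 2,
    trans = (\<lambda>q as.
      if q = 1 then (case as ! k of Mark p \<Rightarrow> min (p + 1) (csize c + 6) | _ \<Rightarrow> 3, idle as)
      else if q = 2 then (case as ! k of Mark p \<Rightarrow> min (p + 2) (csize c + 6) | _ \<Rightarrow> 3, idle as)
      else if q < 4 + csize c then code k c 4 q as
      else (3, idle as))\<rparr>"

lemma finite_written: "finite (written c)"
  by (induction c) auto

lemma length_idle [simp]: "length (idle as) = length as"
  and fst_set_idle [simp]: "fst ` set (idle as) = set as"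
  by (auto simp: idle_def image_image)

lemma fst_set_list_update: "fst ` set (xs[i := (a, d)]) \<subseteq> insert a (fst ` set xs)"
  using set_update_subset_insert[of xs i "(a, d)"] by auto

lemma code_closed:
  assumes "p \<le> q" "q < p + csize c" "length as = Suc k" "tapes_used c \<le> k"
  shows "fst (code k c p q as) \<le> p + csize c \<and> length (snd (code k c p q as)) = Suc k \<and>
    fst ` set (snd (code k c p q as)) \<subseteq> set as \<union> Mark ` {..<p + csize c} \<union> written c"
  using assms
proof (induction c arbitrary: p)
  case (Act i w d)
  have "i < length as"
    using Act.prems by simp
  then have "(case w of None \<Rightarrow> as ! i | Some a \<Rightarrow> a) \<in> set as \<union> set_option w"
    by (cases w) auto
  then show ?case
    using Act.prems fst_set_list_update[of "idle as" i "case w of None \<Rightarrow> as ! i | Some a \<Rightarrow> a" d] by auto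
next
  case (Seq c1 c2)
  show ?case
  proof (cases "q < p + csize c1")
    case True
    then show ?thesis
      using Seq.IH(1)[of p] Seq.prems by auto
  next
    case False
    then show ?thesis
      using Seq.IH(2)[of "p + csize c1"] Seq.prems by (auto simp: add.assoc)
  qed
next
  case (While i X c)
  show ?case
  proof (cases "q = p \<or> q = p + 1 + csize c")
    case False
    then show ?thesis
      using While.IH[of "p + 1"] While.prems by auto
  qed (use While.prems in auto)
next
  case (If i X c1 c2)
  consider "q = p \<or> q = p + 1 + csize c1" | "p < q" "q < p + 1 + csize c1" | "p + 1 + csize c1 < q"
    using If.prems by linarith
  then show ?case
  proof cases
    case 2
    then show ?thesis
      using If.IH(1)[of "p + 1"] If.prems by auto
  next
    case 3
    then show ?thesis
      using If.IH(2)[of "p + 2 + csize c1"] If.prems by (auto simp: add.assoc)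
  qed (use If.prems in auto)
next
  case (Query c1 c2)
  consider "q = p" | "q = p + 1 \<or> q = p + 2 \<or> q = p + 3 + csize c1" | "p + 2 < q" "q < p + 3 + csize c1"
    | "p + 3 + csize c1 < q"
    using Query.prems by linarith
  then show ?case
  proof cases
    case 1
    then show ?thesis
      using Query.prems fst_set_list_update[of "idle as" k "Mark p" Stay] by auto
  next
    case 3
    then show ?thesis
      using Query.IH(1)[of "p + 3"] Query.prems by auto
  next
    case 4
    then show ?thesis
      using Query.IH(2)[of "p + 4 + csize c1"] Query.prems by (auto simp: add.assoc)
  qed (use Query.prems in auto)
qed simp

lemma oracle_machine_machine:
  assumes k: "3 \<le> k" "tapes_used c \<le> k"
  shows "oracle_machine (machine c k)"
proof -
  define S where "S = {..csize c + 6}"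
  define \<Sigma> where "\<Sigma> = {Blank, Bit False, Bit True} \<union> Mark ` {..csize c + 4} \<union> written c"
  have closed: "fst (trans (machine c k) q as) \<in> S \<and> length (snd (trans (machine c k) q as)) = Suc k \<and>
      fst ` set (snd (trans (machine c k) q as)) \<subseteq> \<Sigma>"
    if q: "q \<noteq> 3" "q \<noteq> 0" and as: "set as \<subseteq> \<Sigma>" "length as = Suc k" for q as
  proof (cases "q < 3 \<or> 4 + csize c \<le> q")
    case True
    show ?thesis
      using True q as unfolding machine_def S_def
      by (auto split: symbol.splits)
  next
    case False
    then have "4 \<le> q" "q < 4 + csize c"
      using q by auto
    from code_closed[OF this as(2) k(2)] show ?thesis
      using \<open>4 \<le> q\<close> \<open>q < 4 + csize c\<close> as(1) unfolding machine_def S_def \<Sigma>_def by auto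
  qed
  have fields: "states (machine c k) = S" "alphabet (machine c k) = \<Sigma>" "tapes (machine c k) = Suc k"
    "halt_state (machine c k) = 3" "query_state (machine c k) = 0"
    by (simp_all add: machine_def S_def \<Sigma>_def)
  show ?thesis
    unfolding oracle_machine_def
  proof (intro conjI ballI allI impI)
    fix q as
    assume "q \<in> states (machine c k) - {halt_state (machine c k), query_state (machine c k)}"
      and as: "set as \<subseteq> alphabet (machine c k) \<and> length as = tapes (machine c k)"
    then have q: "q \<noteq> 3" "q \<noteq> 0"
      unfolding fields by simp_all
    from closed[OF q] as show "case trans (machine c k) q as of (q', acts) \<Rightarrow>
        q' \<in> states (machine c k) \<and> length acts = tapes (machine c k) \<and> fst ` set acts \<subseteq> alphabet (machine c k)"
      unfolding fields case_prod_beta by blast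
  qed (use k finite_written in \<open>simp_all add: machine_def\<close>)
qed

section \<open>Correctness of the compiled machine\<close>

definition encode_store :: "nat \<Rightarrow> store \<Rightarrow> tape \<Rightarrow> tape list" where
  "encode_store k \<sigma> Y = map \<sigma> [0..<k] @ [Y]"

lemma length_encode_store [simp]: "length (encode_store k \<sigma> Y) = Suc k"
  by (simp add: encode_store_def)

lemma nth_encode_store: "i < k \<Longrightarrow> encode_store k \<sigma> Y ! i = \<sigma> i"
  and nth_encode_store_last: "encode_store k \<sigma> Y ! k = Y"
  by (simp_all add: encode_store_def nth_append)

lemma encode_store_update: "i < k \<Longrightarrow> (encode_store k \<sigma> Y)[i := T] = encode_store k (\<sigma>(i := T)) Y"
  by (rule nth_equalityI) (auto simp: encode_store_def nth_append nth_list_update)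

lemma encode_store_update_last: "(encode_store k \<sigma> Y)[k := T] = encode_store k \<sigma> T"
  by (simp add: encode_store_def list_update_append)

lemma tape_act_idle: "tape_act (tape_read T, Stay) T = T"
  by (cases T) simp

lemma map2_idle: "map2 tape_act (idle (map tape_read ts)) ts = ts"
  by (rule nth_equalityI) (simp_all add: idle_def tape_act_idle)

lemma map2_idle_update:
  "i < length ts \<Longrightarrow> map2 tape_act ((idle (map tape_read ts))[i := (a, d)]) ts = ts[i := tape_act (a, d) (ts ! i)]"
  by (rule nth_equalityI) (auto simp: idle_def tape_act_idle nth_list_update)

definition reaches :: "otm \<Rightarrow> str set \<Rightarrow> config \<Rightarrow> config \<Rightarrow> bool" where
  "reaches M A cfg cfg' \<longleftrightarrow> (\<exists>t. (otm_step M A ^^ t) cfg = cfg')"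

lemma reaches_refl: "reaches M A cfg cfg"
  unfolding reaches_def by (intro exI[of _ 0]) simp

lemma reaches_trans: "reaches M A x y \<Longrightarrow> reaches M A y z \<Longrightarrow> reaches M A x z"
  unfolding reaches_def
proof (elim exE)
  fix s t assume "(otm_step M A ^^ s) x = y" "(otm_step M A ^^ t) y = z"
  then have "(otm_step M A ^^ (t + s)) x = z"
    by (simp add: funpow_add)
  then show "\<exists>t. (otm_step M A ^^ t) x = z" by blast
qed

lemma reaches_step: "otm_step M A x = y \<Longrightarrow> reaches M A y z \<Longrightarrow> reaches M A x z"
  by (rule reaches_trans[of M A x y]) (auto simp: reaches_def intro: exI[of _ 1])

text \<open>The induction over executions knows the transition function only on the block of the
  current subprogram. What all blocks share, the special states and the return from a query, is
  fixed here; \<open>bound\<close> limits the marks from which the return is correct.\<close>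

locale compiled =
  fixes M :: otm and k :: nat and bound :: nat and A :: "str set"
  assumes halt: "halt_state M = 3" and query: "query_state M = 0"
    and yes: "yes_state M = 1" and no: "no_state M = 2"
    and trans_yes: "\<And>as p. as ! k = Mark p \<Longrightarrow> p < bound \<Longrightarrow> trans M 1 as = (p + 1, idle as)"
    and trans_no: "\<And>as p. as ! k = Mark p \<Longrightarrow> p < bound \<Longrightarrow> trans M 2 as = (p + 2, idle as)"
begin

lemma step_idle:
  assumes "q \<noteq> 3" "q \<noteq> 0" "trans M q (map tape_read ts) = (q', idle (map tape_read ts))"
  shows "otm_step M A (q, ts) = (q', ts)"
  using assms by (simp add: halt query map2_idle)

lemma reaches_idle:
  assumes "q \<noteq> 3" "q \<noteq> 0" "trans M q (map tape_read ts) = (q', idle (map tape_read ts))"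
    "reaches M A (q', ts) z"
  shows "reaches M A (q, ts) z"
  by (rule reaches_step[OF step_idle[OF assms(1-3)] assms(4)])

lemma query_reaches:
  assumes "3 < p" "p < bound" "2 \<le> k"
    and trans: "\<And>as. trans M p as = (0, (idle as)[k := (Mark p, Stay)])"
  obtains Z where "reaches M A (p, encode_store k \<sigma> Y)
    (if tape_string (\<sigma> 1) \<in> A then p + 1 else p + 2, encode_store k \<sigma> Z)"
proof -
  define Z where "Z = tape_act (Mark p, Stay) Y"
  let ?ts = "encode_store k \<sigma> Y" and ?us = "encode_store k \<sigma> Z"
  have 1: "otm_step M A (p, ?ts) = (0, ?us)"
    using assms(1) trans
    by (simp add: halt query map2_idle_update nth_encode_store_last encode_store_update_last Z_def)
  have "?us ! 1 = \<sigma> 1"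
    using assms(3) by (simp add: nth_encode_store)
  then have 2: "otm_step M A (0, ?us) = (if tape_string (\<sigma> 1) \<in> A then 1 else 2, ?us)"
    by (simp add: halt query yes no)
  have "tape_read Z = Mark p"
    unfolding Z_def by (cases Y) simp
  then have mark: "map tape_read ?us ! k = Mark p"
    by (simp add: nth_encode_store_last)
  have 3: "otm_step M A (1, ?us) = (p + 1, ?us)" "otm_step M A (2, ?us) = (p + 2, ?us)"
    by (rule step_idle, simp, simp, rule trans_yes[OF mark assms(2)])
      (rule step_idle, simp, simp, rule trans_no[OF mark assms(2)])
  have "reaches M A (if tape_string (\<sigma> 1) \<in> A then 1 else 2, ?us)
      (if tape_string (\<sigma> 1) \<in> A then p + 1 else p + 2, ?us)"
    using reaches_step[OF 3(1) reaches_refl] reaches_step[OF 3(2) reaches_refl] by simp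
  from reaches_step[OF 1 reaches_step[OF 2 this]] show ?thesis by (rule that)
qed

text \<open>The start state \<open>p\<close> is arbitrary because a subprogram may sit anywhere in
  the table, and \<open>4 \<le> p\<close> keeps its block away from the four special states. The
  final content of the mark tape is existential because queries overwrite it.\<close>

lemma exec_reaches:
  assumes "exec A c \<sigma> \<sigma>'" "tapes_used c \<le> k" "2 \<le> k" "4 \<le> p" "p + csize c \<le> bound"
    "\<And>q as. p \<le> q \<Longrightarrow> q < p + csize c \<Longrightarrow> trans M q as = code k c p q as"
  shows "\<exists>Y'. reaches M A (p, encode_store k \<sigma> Y) (p + csize c, encode_store k \<sigma>' Y')"
  using assms
proof (induction c \<sigma> \<sigma>' arbitrary: p Y rule: exec.induct)
  case (exec_Skip \<sigma>)
  show ?case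
    using reaches_refl[of M A "(p, encode_store k \<sigma> Y)"] by (intro exI[of _ Y]) simp
next
  case (exec_Act i w d \<sigma>)
  let ?ts = "encode_store k \<sigma> Y"
  have i: "i < k" using exec_Act.prems by simp
  have "trans M p (map tape_read ?ts) = code k (Act i w d) p p (map tape_read ?ts)"
    by (rule exec_Act.prems(5)) simp_all
  also have "\<dots> = (p + 1, (idle (map tape_read ?ts))[i := (case w of None \<Rightarrow> tape_read (\<sigma> i) | Some a \<Rightarrow> a, d)])"
    using i by (cases w) (simp_all add: nth_encode_store)
  finally have "otm_step M A (p, ?ts) = (p + 1, ?ts[i := act w d (\<sigma> i)])"
    using exec_Act.prems(3) i
    by (simp add: halt query map2_idle_update nth_encode_store act_def)
  then have "otm_step M A (p, ?ts) = (p + 1, encode_store k (\<sigma>(i := act w d (\<sigma> i))) Y)"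
    using i by (simp only: encode_store_update)
  from reaches_step[OF this reaches_refl] show ?case
    by (intro exI[of _ Y]) (simp add: fun_upd_def)
next
  case (exec_Seq c1 \<sigma> \<sigma>' c2 \<sigma>'')
  have "trans M q as = code k c1 p q as" if "p \<le> q" "q < p + csize c1" for q as
    using exec_Seq.prems(5)[of q as] that by simp
  then obtain Y' where 1: "reaches M A (p, encode_store k \<sigma> Y) (p + csize c1, encode_store k \<sigma>' Y')"
    using exec_Seq.IH(1)[of p Y] exec_Seq.prems by auto
  have "trans M q as = code k c2 (p + csize c1) q as" if "p + csize c1 \<le> q" "q < p + csize c1 + csize c2" for q as
    using exec_Seq.prems(5)[of q as] that by simp
  then obtain Y'' where 2: "reaches M A (p + csize c1, encode_store k \<sigma>' Y') (p + csize c1 + csize c2, encode_store k \<sigma>'' Y'')"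
    using exec_Seq.IH(2)[of "p + csize c1" Y'] exec_Seq.prems by auto
  show ?case
    using reaches_trans[OF 1 2] by (intro exI[of _ Y'']) (simp add: add.assoc)
next
  case (exec_While_stop \<sigma> i X c)
  let ?ts = "encode_store k \<sigma> Y"
  have i: "i < k" using exec_While_stop.prems by simp
  have "trans M p (map tape_read ?ts) = (p + csize c + 2, idle (map tape_read ?ts))"
    using exec_While_stop.prems(5)[of p "map tape_read ?ts"] exec_While_stop.hyps i
    by (simp add: nth_encode_store)
  from step_idle[OF _ _ this] have "otm_step M A (p, ?ts) = (p + csize c + 2, ?ts)"
    using exec_While_stop.prems(3) by simp
  from reaches_step[OF this reaches_refl] show ?case
    by (intro exI[of _ Y]) (simp add: add.assoc)
next
  case (exec_While_step \<sigma> i X c \<sigma>' \<sigma>'')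
  let ?ts = "encode_store k \<sigma> Y"
  have i: "i < k" using exec_While_step.prems by simp
  have "trans M p (map tape_read ?ts) = (p + 1, idle (map tape_read ?ts))"
    using exec_While_step.prems(5)[of p "map tape_read ?ts"] exec_While_step.hyps i
    by (simp add: nth_encode_store)
  from step_idle[OF _ _ this] have 1: "otm_step M A (p, ?ts) = (p + 1, ?ts)"
    using exec_While_step.prems(3) by simp
  have "trans M q as = code k c (p + 1) q as" if "p + 1 \<le> q" "q < p + 1 + csize c" for q as
    using exec_While_step.prems(5)[of q as] that by simp
  then obtain Y' where 2: "reaches M A (p + 1, ?ts) (p + 1 + csize c, encode_store k \<sigma>' Y')"
    using exec_While_step.IH(1)[of "p + 1" Y] exec_While_step.prems by auto
  let ?ts' = "encode_store k \<sigma>' Y'"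
  have "trans M (p + 1 + csize c) (map tape_read ?ts') = (p, idle (map tape_read ?ts'))"
    using exec_While_step.prems(5)[of "p + 1 + csize c" "map tape_read ?ts'"] by simp
  from step_idle[OF _ _ this] have 3: "otm_step M A (p + 1 + csize c, ?ts') = (p, ?ts')"
    using exec_While_step.prems(3) by simp
  obtain Y'' where 4: "reaches M A (p, ?ts') (p + csize (While i X c), encode_store k \<sigma>'' Y'')"
    using exec_While_step.IH(2)[OF exec_While_step.prems] by blast
  from reaches_step[OF 1 reaches_trans[OF 2 reaches_step[OF 3 4]]] show ?case by blast
next
  case (exec_If_true \<sigma> i X c1 \<sigma>' c2)
  let ?ts = "encode_store k \<sigma> Y"
  have i: "i < k" using exec_If_true.prems by simp
  have "trans M p (map tape_read ?ts) = (p + 1, idle (map tape_read ?ts))"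
    using exec_If_true.prems(5)[of p "map tape_read ?ts"] exec_If_true.hyps i
    by (simp add: nth_encode_store)
  from step_idle[OF _ _ this] have 1: "otm_step M A (p, ?ts) = (p + 1, ?ts)"
    using exec_If_true.prems(3) by simp
  have "trans M q as = code k c1 (p + 1) q as" if "p + 1 \<le> q" "q < p + 1 + csize c1" for q as
    using exec_If_true.prems(5)[of q as] that by simp
  then obtain Y' where 2: "reaches M A (p + 1, ?ts) (p + 1 + csize c1, encode_store k \<sigma>' Y')"
    using exec_If_true.IH[of "p + 1" Y] exec_If_true.prems by auto
  let ?ts' = "encode_store k \<sigma>' Y'"
  have "trans M (p + 1 + csize c1) (map tape_read ?ts') = (p + csize c1 + csize c2 + 2, idle (map tape_read ?ts'))"
    using exec_If_true.prems(5)[of "p + 1 + csize c1" "map tape_read ?ts'"] by simp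
  from step_idle[OF _ _ this] have 3: "otm_step M A (p + 1 + csize c1, ?ts') = (p + csize c1 + csize c2 + 2, ?ts')"
    using exec_If_true.prems(3) by simp
  from reaches_step[OF 1 reaches_trans[OF 2 reaches_step[OF 3 reaches_refl]]] show ?case
    by (intro exI[of _ Y']) (simp add: add.assoc)
next
  case (exec_If_false \<sigma> i X c2 \<sigma>' c1)
  let ?ts = "encode_store k \<sigma> Y"
  have i: "i < k" using exec_If_false.prems by simp
  have "trans M p (map tape_read ?ts) = (p + 2 + csize c1, idle (map tape_read ?ts))"
    using exec_If_false.prems(5)[of p "map tape_read ?ts"] exec_If_false.hyps i
    by (simp add: nth_encode_store)
  from step_idle[OF _ _ this] have 1: "otm_step M A (p, ?ts) = (p + 2 + csize c1, ?ts)"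
    using exec_If_false.prems(3) by simp
  have "trans M q as = code k c2 (p + 2 + csize c1) q as"
    if "p + 2 + csize c1 \<le> q" "q < p + 2 + csize c1 + csize c2" for q as
    using exec_If_false.prems(5)[of q as] that by simp
  then obtain Y' where 2: "reaches M A (p + 2 + csize c1, ?ts) (p + 2 + csize c1 + csize c2, encode_store k \<sigma>' Y')"
    using exec_If_false.IH[of "p + 2 + csize c1" Y] exec_If_false.prems by auto
  from reaches_step[OF 1 2] show ?case
    by (intro exI[of _ Y']) (simp add: ac_simps)
next
  case (exec_Query_yes \<sigma> c1 \<sigma>' c2)
  have "trans M p as = (0, (idle as)[k := (Mark p, Stay)])" for as
    using exec_Query_yes.prems(5)[of p as] by simp
  then obtain Z where 1: "reaches M A (p, encode_store k \<sigma> Y) (p + 1, encode_store k \<sigma> Z)"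
    by (rule query_reaches[of p \<sigma> Y, rotated 3]) (use exec_Query_yes.prems exec_Query_yes.hyps in auto)
  let ?us = "encode_store k \<sigma> Z"
  have "trans M q as = code k c1 (p + 3) q as" if "p + 3 \<le> q" "q < p + 3 + csize c1" for q as
    using exec_Query_yes.prems(5)[of q as] that by simp
  then obtain Y' where 2: "reaches M A (p + 3, ?us) (p + 3 + csize c1, encode_store k \<sigma>' Y')"
    using exec_Query_yes.IH[of "p + 3" Z] exec_Query_yes.prems by auto
  have 3: "reaches M A (p + 1, ?us) (p + 3 + csize c1, encode_store k \<sigma>' Y')"
    by (rule reaches_idle[OF _ _ _ 2]) (use exec_Query_yes.prems(3,5) in auto)
  have "reaches M A (p + 3 + csize c1, encode_store k \<sigma>' Y')
      (p + csize (Query c1 c2), encode_store k \<sigma>' Y')"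
    by (rule reaches_idle[OF _ _ _ reaches_refl]) (use exec_Query_yes.prems(3,5) in auto)
  from reaches_trans[OF 1 reaches_trans[OF 3 this]] show ?case by blast
next
  case (exec_Query_no \<sigma> c2 \<sigma>' c1)
  have "trans M p as = (0, (idle as)[k := (Mark p, Stay)])" for as
    using exec_Query_no.prems(5)[of p as] by simp
  then obtain Z where 1: "reaches M A (p, encode_store k \<sigma> Y) (p + 2, encode_store k \<sigma> Z)"
    by (rule query_reaches[of p \<sigma> Y, rotated 3]) (use exec_Query_no.prems exec_Query_no.hyps in auto)
  let ?us = "encode_store k \<sigma> Z"
  have "trans M q as = code k c2 (p + 4 + csize c1) q as"
    if "p + 4 + csize c1 \<le> q" "q < p + 4 + csize c1 + csize c2" for q as
    using exec_Query_no.prems(5)[of q as] that by simp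
  then obtain Y' where 2: "reaches M A (p + 4 + csize c1, ?us) (p + 4 + csize c1 + csize c2, encode_store k \<sigma>' Y')"
    using exec_Query_no.IH[of "p + 4 + csize c1" Z] exec_Query_no.prems by auto
  have "reaches M A (p + 2, ?us) (p + 4 + csize c1 + csize c2, encode_store k \<sigma>' Y')"
    by (rule reaches_idle[OF _ _ _ 2]) (use exec_Query_no.prems(3,5) in auto)
  from reaches_trans[OF 1 this] show ?case
    by (intro exI[of _ Y']) (simp add: ac_simps)
qed

end

lemma machine_output:
  assumes ex: "exec A c \<sigma> \<sigma>'" and k: "3 \<le> k" "tapes_used c \<le> k"
    and \<sigma>: "\<sigma> 0 = string_tape x" "\<And>i. 0 < i \<Longrightarrow> i < k \<Longrightarrow> \<sigma> i = blank_tape"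
  shows "otm_output (machine c k) A x = Some (tape_string (\<sigma>' 2))"
proof -
  let ?M = "machine c k"
  interpret compiled ?M k "4 + csize c" A
    by unfold_locales (auto simp: machine_def)
  have "trans ?M q as = code k c 4 q as" if "4 \<le> q" "q < 4 + csize c" for q as
    using that by (simp add: machine_def)
  then obtain Y where 1: "reaches ?M A (4, encode_store k \<sigma> blank_tape) (4 + csize c, encode_store k \<sigma>' Y)"
    using exec_reaches[OF ex k(2), of 4 blank_tape] k(1) by auto
  have "trans ?M (4 + csize c) as = (3, idle as)" for as
    by (simp add: machine_def)
  then have "otm_step ?M A (4 + csize c, encode_store k \<sigma>' Y) = (3, encode_store k \<sigma>' Y)"
    by (intro step_idle) auto
  from reaches_trans[OF 1 reaches_step[OF this reaches_refl]]
  obtain t where t: "(otm_step ?M A ^^ t) (4, encode_store k \<sigma> blank_tape) = (3, encode_store k \<sigma>' Y)"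
    unfolding reaches_def by blast
  have "encode_store k \<sigma> blank_tape = string_tape x # replicate k blank_tape"
  proof (rule nth_equalityI)
    fix i assume "i < length (encode_store k \<sigma> blank_tape)"
    then have "i < Suc k" by simp
    then consider "i = 0" | "0 < i" "i < k" | "i = k" by linarith
    then show "encode_store k \<sigma> blank_tape ! i = (string_tape x # replicate k blank_tape) ! i"
      using \<sigma> k(1) by cases (auto simp: nth_encode_store nth_encode_store_last nth_Cons')
  qed simp
  then have "otm_init ?M x = (4, encode_store k \<sigma> blank_tape)"
    by (simp add: otm_init_def machine_def)
  then have run: "otm_run ?M A x t = (3, encode_store k \<sigma>' Y)"
    unfolding otm_run_def by (simp only: t)
  then have "fst (otm_run ?M A x t) = halt_state ?M"
    by (simp add: halt)
  from otm_output_eqI[OF this] show ?thesis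
    unfolding run using k(1) by (simp add: nth_encode_store)
qed

section \<open>Register programs\<close>

text \<open>Tapes \<open>0\<close>, \<open>1\<close>, \<open>2\<close> are the input, oracle and output tapes; tape
  \<open>r + 3\<close> is register \<open>r\<close>, whose value is the position of its head. \<open>Mark 0\<close> in
  cell \<open>0\<close> makes zero visible.\<close>

definition register_tape :: "nat \<Rightarrow> tape" where
  "register_tape v = (\<lambda>i. if i = 0 then Mark 0 else Blank, int v)"

definition store_of :: "(nat \<Rightarrow> tape) \<Rightarrow> (nat \<Rightarrow> nat) \<Rightarrow> store" where
  "store_of T e i = (if i < 3 then T i else register_tape (e (i - 3)))"

lemma store_of_register: "store_of T e (r + 3) = register_tape (e r)"
  and store_of_tape: "j < 3 \<Longrightarrow> store_of T e j = T j"
  by (simp_all add: store_of_def)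

lemma store_of_update_register: "(store_of T e)(r + 3 := register_tape v) = store_of T (e(r := v))"
proof
  fix i
  show "((store_of T e)(r + 3 := register_tape v)) i = store_of T (e(r := v)) i"
    by (cases "i = r + 3") (auto simp: store_of_def)
qed

lemma store_of_update_tape: "j < 3 \<Longrightarrow> (store_of T e)(j := Z) = store_of (T(j := Z)) e"
  by (rule ext) (simp add: store_of_def)

lemma read_register: "tape_read (register_tape v) = Blank \<longleftrightarrow> v \<noteq> 0"
  by (simp add: register_tape_def)

lemma act_None: "act None d (Z, h) = (Z, shift d h)"
  by (simp add: act_def)

definition inc :: "nat \<Rightarrow> com" where "inc r = Act (r + 3) None Go_Right"
definition dec :: "nat \<Rightarrow> com" where "dec r = Act (r + 3) None Go_Left"
definition loop :: "nat \<Rightarrow> com \<Rightarrow> com" where "loop r c = While (r + 3) {Blank} c"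
definition clear :: "nat \<Rightarrow> com" where "clear r = loop r (dec r)"
text \<open>The value of a register is only accessible by counting it down, so \<open>t\<close>
  receives a second copy from which \<open>x\<close> is restored.\<close>

definition copy :: "nat \<Rightarrow> nat \<Rightarrow> nat \<Rightarrow> com" where
  "copy x y t = Seq (Seq (clear y) (clear t))
    (Seq (loop x (Seq (dec x) (Seq (inc y) (inc t)))) (loop t (Seq (dec t) (inc x))))"

lemma exec_inc: "exec A (inc r) (store_of T e) (store_of T (e(r := Suc (e r))))"
proof -
  have "act None Go_Right (store_of T e (r + 3)) = register_tape (Suc (e r))"
    unfolding store_of_register by (simp add: register_tape_def act_None)
  then have "(store_of T e)(r + 3 := act None Go_Right (store_of T e (r + 3))) = store_of T (e(r := Suc (e r)))"
    by (simp only: store_of_update_register)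
  then show ?thesis
    unfolding inc_def using exec_Act[of A "r + 3" None Go_Right "store_of T e"] by (simp only:)
qed

lemma exec_dec: "e r = Suc v \<Longrightarrow> exec A (dec r) (store_of T e) (store_of T (e(r := v)))"
proof -
  assume "e r = Suc v"
  then have "act None Go_Left (store_of T e (r + 3)) = register_tape v"
    unfolding store_of_register by (simp add: register_tape_def act_None)
  then have "(store_of T e)(r + 3 := act None Go_Left (store_of T e (r + 3))) = store_of T (e(r := v))"
    by (simp only: store_of_update_register)
  then show ?thesis
    unfolding dec_def using exec_Act[of A "r + 3" None Go_Left "store_of T e"] by (simp only:)
qed

lemma exec_loop_stop: "e r = 0 \<Longrightarrow> exec A (loop r c) (store_of T e) (store_of T e)"
  unfolding loop_def by (rule exec_While_stop) (simp only: store_of_register read_register singleton_iff simp_thms)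

lemma exec_loop_step:
  "e r \<noteq> 0 \<Longrightarrow> exec A c (store_of T e) \<sigma> \<Longrightarrow> exec A (loop r c) \<sigma> \<sigma>' \<Longrightarrow>
   exec A (loop r c) (store_of T e) \<sigma>'"
  unfolding loop_def by (rule exec_While_step) (simp_all only: store_of_register read_register singleton_iff simp_thms)

lemma exec_clear: "exec A (clear r) (store_of T e) (store_of T (e(r := 0)))"
  unfolding clear_def
proof (induction "e r" arbitrary: e)
  case 0
  then have "e(r := 0) = e" by auto
  then show ?case using exec_loop_stop[of e r A "dec r" T] 0 by simp
next
  case (Suc v)
  have "exec A (loop r (dec r)) (store_of T (e(r := v))) (store_of T (e(r := 0)))"
    using Suc.hyps(1)[of "e(r := v)"] by simp
  then show ?case
    by (rule exec_loop_step[rotated 2, OF _ _ exec_dec]) (use Suc.hyps(2) in auto)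
qed

lemma exec_copy:
  assumes "x \<noteq> y" "x \<noteq> t" "y \<noteq> t"
  shows "exec A (copy x y t) (store_of T e) (store_of T (e(y := e x, t := 0)))"
proof -
  have 1: "exec A (loop x (Seq (dec x) (Seq (inc y) (inc t)))) (store_of T e)
      (store_of T (e(x := 0, y := e y + e x, t := e t + e x)))" for e
  proof (induction "e x" arbitrary: e)
    case 0
    then have "e(x := 0, y := e y + e x, t := e t + e x) = e" by auto
    then show ?case
      by (simp only:) (rule exec_loop_stop, use 0 in simp)
  next
    case (Suc v)
    let ?e = "e(x := v, y := Suc (e y), t := Suc (e t))"
    have body: "exec A (Seq (dec x) (Seq (inc y) (inc t))) (store_of T e) (store_of T ?e)"
      using exec_Seq[OF exec_dec[of e x v, OF Suc.hyps(2)[symmetric]] exec_Seq[OF exec_inc[of A y] exec_inc[of A t]], of T]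
        assms by simp
    have "v = ?e x" using assms by simp
    from Suc.hyps(1)[of ?e, OF this]
    have "exec A (loop x (Seq (dec x) (Seq (inc y) (inc t)))) (store_of T ?e)
        (store_of T (e(x := 0, y := e y + e x, t := e t + e x)))"
      using assms Suc.hyps(2)[symmetric] by (simp add: fun_upd_twist)
    from exec_loop_step[of e x, OF _ body this] show ?case
      using Suc.hyps(2) by simp
  qed
  have 2: "exec A (loop t (Seq (dec t) (inc x))) (store_of T e)
      (store_of T (e(t := 0, x := e x + e t)))" for e
  proof (induction "e t" arbitrary: e)
    case 0
    then have "e(t := 0, x := e x + e t) = e" by auto
    then show ?case
      by (simp only:) (rule exec_loop_stop, use 0 in simp)
  next
    case (Suc v)
    let ?e = "e(t := v, x := Suc (e x))"
    have body: "exec A (Seq (dec t) (inc x)) (store_of T e) (store_of T ?e)"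
      using exec_Seq[OF exec_dec[of e t v, OF Suc.hyps(2)[symmetric]] exec_inc[of A x], of T] assms by simp
    have "v = ?e t" using assms by simp
    from Suc.hyps(1)[of ?e, OF this]
    have "exec A (loop t (Seq (dec t) (inc x))) (store_of T ?e)
        (store_of T (e(t := 0, x := e x + e t)))"
      using assms Suc.hyps(2)[symmetric] by (simp add: fun_upd_twist)
    from exec_loop_step[of e t, OF _ body this] show ?case
      using Suc.hyps(2) by simp
  qed
  have "e(t := 0, x := e x, y := e x) = e(t := 0, y := e x)"
    using assms by auto
  then show ?thesis
    using exec_Seq[OF exec_Seq[OF exec_clear[of A y T e] exec_clear[of A t]]
      exec_Seq[OF 1[of "e(y := 0, t := 0)"] 2]] assms
    unfolding copy_def by (simp add: fun_upd_twist)
qed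

subsection \<open>Runs modulo scratch registers\<close>

definition agree :: "nat \<Rightarrow> (nat \<Rightarrow> nat) \<Rightarrow> (nat \<Rightarrow> nat) \<Rightarrow> bool" where
  "agree s e e' \<longleftrightarrow> (\<forall>r<s. e r = e' r)"

text \<open>Registers from \<open>s\<close> on are scratch: arbitrary before and unspecified after
  the run. Quantifying over all initial scratch contents makes such statements composable.\<close>

definition runs :: "nat \<Rightarrow> str set \<Rightarrow> com \<Rightarrow> (nat \<Rightarrow> tape) \<Rightarrow> (nat \<Rightarrow> nat) \<Rightarrow> (nat \<Rightarrow> tape) \<Rightarrow> (nat \<Rightarrow> nat) \<Rightarrow> bool" where
  "runs s A c T e T' e' \<longleftrightarrow> (\<forall>e1. agree s e e1 \<longrightarrow>
     (\<exists>e2. exec A c (store_of T e1) (store_of T' e2) \<and> agree s e' e2))"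

lemma agree_refl: "agree s e e"
  and agree_trans: "agree s e e' \<Longrightarrow> agree s e' e'' \<Longrightarrow> agree s e e''"
  and agree_mono: "agree s' e e' \<Longrightarrow> s \<le> s' \<Longrightarrow> agree s e e'"
  and agree_update: "agree s e e' \<Longrightarrow> agree s (e(r := v)) (e'(r := v))"
  by (auto simp: agree_def)

lemma agree_map: "agree s e e' \<Longrightarrow> set is \<subseteq> {..<s} \<Longrightarrow> map e' is = map e is"
  by (auto simp: agree_def)

lemma runsI:
  assumes "\<And>e1. agree s e e1 \<Longrightarrow> \<exists>e2. exec A c (store_of T e1) (store_of T' e2) \<and> agree s e' e2"
  shows "runs s A c T e T' e'"
  using assms unfolding runs_def by blast

lemma runsE:
  assumes "runs s A c T e T' e'" "agree s e e1"
  obtains e2 where "exec A c (store_of T e1) (store_of T' e2)" "agree s e' e2"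
  using assms unfolding runs_def by blast

lemma runs_Skip: "runs s A Skip T e T e"
  by (rule runsI) (blast intro: exec_Skip)

lemma runs_Seq:
  assumes "runs s A c1 T e T' e'" "runs s A c2 T' e' T'' e''"
  shows "runs s A (Seq c1 c2) T e T'' e''"
proof (rule runsI)
  fix e1 assume "agree s e e1"
  then obtain e2 where 2: "exec A c1 (store_of T e1) (store_of T' e2)" "agree s e' e2"
    by (rule runsE[OF assms(1)])
  from 2(2) obtain e3 where "exec A c2 (store_of T' e2) (store_of T'' e3)" "agree s e'' e3"
    by (rule runsE[OF assms(2)])
  with 2(1) show "\<exists>e2. exec A (Seq c1 c2) (store_of T e1) (store_of T'' e2) \<and> agree s e'' e2"
    by (blast intro: exec_Seq)
qed

lemma runs_simple:
  assumes "\<And>e1. agree s e e1 \<Longrightarrow> exec A c (store_of T e1) (store_of T' (h e1)) \<and> agree s e' (h e1)"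
  shows "runs s A c T e T' e'"
  using assms by (intro runsI) blast

lemma runs_inc: "r < s \<Longrightarrow> runs s A (inc r) T e T (e(r := Suc (e r)))"
  by (rule runs_simple, rule conjI, rule exec_inc) (auto simp: agree_def)

lemma runs_dec: "r < s \<Longrightarrow> e r = Suc v \<Longrightarrow> runs s A (dec r) T e T (e(r := v))"
  by (rule runs_simple, rule conjI, rule exec_dec) (auto simp: agree_def)

lemma runs_clear: "runs s A (clear r) T e T (e(r := 0))"
  by (rule runs_simple, rule conjI, rule exec_clear) (rule agree_update)

lemma runs_copy: "x < s \<Longrightarrow> y < s \<Longrightarrow> x \<noteq> y \<Longrightarrow> runs s A (copy x y s) T e T (e(y := e x))"
  by (rule runs_simple, rule conjI, rule exec_copy) (auto simp: agree_def)

lemma runs_loop_stop: "r < s \<Longrightarrow> e r = 0 \<Longrightarrow> runs s A (loop r c) T e T e"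
  by (rule runs_simple, rule conjI, rule exec_loop_stop) (auto simp: agree_def)

lemma runs_loop_step:
  assumes "r < s" "e r \<noteq> 0" "runs s A c T e T' e'" "runs s A (loop r c) T' e' T'' e''"
  shows "runs s A (loop r c) T e T'' e''"
proof (rule runsI)
  fix e1 assume 1: "agree s e e1"
  then have "e1 r \<noteq> 0" using assms(1,2) by (simp add: agree_def)
  from 1 obtain e2 where 2: "exec A c (store_of T e1) (store_of T' e2)" "agree s e' e2"
    by (rule runsE[OF assms(3)])
  from 2(2) obtain e3 where 3: "exec A (loop r c) (store_of T' e2) (store_of T'' e3)" "agree s e'' e3"
    by (rule runsE[OF assms(4)])
  from exec_loop_step[of e1, OF \<open>e1 r \<noteq> 0\<close> 2(1) 3(1)] 3(2)
  show "\<exists>e2. exec A (loop r c) (store_of T e1) (store_of T'' e2) \<and> agree s e'' e2"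
    by blast
qed

text \<open>Raising the threshold to \<open>s'\<close> turns the registers from \<open>s\<close> to
  \<open>s' - 1\<close> into local variables of \<open>c\<close>, whose final values are
  forgotten.\<close>

lemma runs_local:
  assumes "s \<le> s'" and "\<And>e1. agree s e e1 \<Longrightarrow> \<exists>e2. runs s' A c T e1 T' e2 \<and> agree s e' e2"
  shows "runs s A c T e T' e'"
proof (rule runsI)
  fix e1 assume "agree s e e1"
  then obtain e2 where 2: "runs s' A c T e1 T' e2" "agree s e' e2"
    using assms(2) by blast
  obtain e3 where "exec A c (store_of T e1) (store_of T' e3)" "agree s' e2 e3"
    by (rule runsE[OF 2(1) agree_refl])
  moreover have "agree s e' e3"
    using 2(2) \<open>agree s' e2 e3\<close> assms(1) by (blast intro: agree_trans agree_mono)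
  ultimately show "\<exists>e2. exec A c (store_of T e1) (store_of T' e2) \<and> agree s e' e2"
    by blast
qed

subsection \<open>Compilation of partial recursive functions\<close>

text \<open>Nothing is demanded where \<open>F\<close> is undefined; there the program may diverge
  or leave anything behind.\<close>

definition compiles :: "nat \<Rightarrow> nat list \<Rightarrow> nat \<Rightarrow> (nat list \<Rightarrow> nat option) \<Rightarrow> com \<Rightarrow> bool" where
  "compiles s is o' F c \<longleftrightarrow> (\<forall>A T e v. F (map e is) = Some v \<longrightarrow> runs s A c T e T (e(o' := v)))"

definition compilable :: "nat \<Rightarrow> (nat list \<Rightarrow> nat option) \<Rightarrow> bool" where
  "compilable n F \<longleftrightarrow> (\<forall>is o' s. length is = n \<and> set is \<subseteq> {..<s} \<and> o' < s \<and> o' \<notin> set is \<longrightarrow>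
     (\<exists>c. compiles s is o' F c))"

lemma compilableE:
  assumes "compilable n F" "length is = n" "set is \<subseteq> {..<s}" "o' < s" "o' \<notin> set is"
  obtains c where "compiles s is o' F c"
  using assms unfolding compilable_def by blast

lemma compilableI:
  assumes "\<And>is o' s. length is = n \<Longrightarrow> set is \<subseteq> {..<s} \<Longrightarrow> o' < s \<Longrightarrow> o' \<notin> set is \<Longrightarrow>
    \<exists>c. compiles s is o' F c"
  shows "compilable n F"
  using assms unfolding compilable_def by blast

lemma compiles_runs: "compiles s is o' F c \<Longrightarrow> F (map e is) = Some v \<Longrightarrow> runs s A c T e T (e(o' := v))"
  unfolding compiles_def by blast

lemma compilable_proj: "i < n \<Longrightarrow> compilable n (\<lambda>xs. Some (xs ! i))"
proof (rule compilableI)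
  fix "is" :: "nat list" and o' s :: nat
  assume a: "i < n" "length is = n" "set is \<subseteq> {..<s}" "o' < s" "o' \<notin> set is"
  then have i: "is ! i \<in> set is" by simp
  then have "is ! i < s"
    using a(3) by blast
  moreover have "is ! i \<noteq> o'"
    using a(5) i by metis
  ultimately have "compiles s is o' (\<lambda>xs. Some (xs ! i)) (copy (is ! i) o' s)"
    unfolding compiles_def using a runs_copy[of "is ! i" s o'] by auto
  then show "\<exists>c. compiles s is o' (\<lambda>xs. Some (xs ! i)) c" by blast
qed

lemma compilable_succ: "compilable 1 (\<lambda>xs. Some (Suc (hd xs)))"
proof (rule compilableI)
  fix "is" :: "nat list" and o' s :: nat
  assume a: "length is = 1" "set is \<subseteq> {..<s}" "o' < s" "o' \<notin> set is"
  then obtain i where i: "is = [i]" "i < s" "i \<noteq> o'"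
    by (auto simp: length_Suc_conv)
  have "runs s A (Seq (copy i o' s) (inc o')) T e T (e(o' := Suc (e i)))" for A T e
    using runs_Seq[OF runs_copy[OF i(2) a(3) i(3)] runs_inc[OF a(3)], of A T e] by simp
  then have "compiles s is o' (\<lambda>xs. Some (Suc (hd xs))) (Seq (copy i o' s) (inc o'))"
    unfolding compiles_def by (simp add: i(1))
  then show "\<exists>c. compiles s is o' (\<lambda>xs. Some (Suc (hd xs))) c" by blast
qed

text \<open>Inputs lie below \<open>b\<close>, where nothing is changed, so they are still intact
  for the next function. In the induction \<open>b\<close> advances by one, which protects the
  result just computed.\<close>

lemma compile_list:
  assumes "\<forall>G\<in>set Gs. compilable (length is) G" "set is \<subseteq> {..<b}" "b + length Gs \<le> s"
  shows "\<exists>c. \<forall>A T e vs. those (map (\<lambda>G. G (map e is)) Gs) = Some vs \<longrightarrow>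
    (\<exists>e'. runs s A c T e T e' \<and> map e' [b..<b + length Gs] = vs \<and>
      (\<forall>r. r < b \<longrightarrow> e' r = e r))"
  using assms
proof (induction Gs arbitrary: b)
  case Nil
  show ?case
    by (intro exI[of _ Skip]) (auto intro: runs_Skip)
next
  case (Cons G Gs)
  have "set is \<subseteq> {..<s}" "b < s" "b \<notin> set is"
    using Cons.prems by auto
  then obtain c1 where c1: "compiles s is b G c1"
    using compilableE[of "length is" G "is" s b] Cons.prems(1) by auto
  have "\<forall>G\<in>set Gs. compilable (length is) G" "set is \<subseteq> {..<Suc b}" "Suc b + length Gs \<le> s"
    using Cons.prems by auto
  from Cons.IH[OF this] obtain c2 where c2: "\<And>A T e vs. those (map (\<lambda>G. G (map e is)) Gs) = Some vs \<Longrightarrow>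
    (\<exists>e'. runs s A c2 T e T e' \<and> map e' [Suc b..<Suc b + length Gs] = vs \<and>
      (\<forall>r. r < Suc b \<longrightarrow> e' r = e r))"
    by blast
  show ?case
  proof (intro exI[of _ "Seq c1 c2"] allI impI)
    fix A T e vs
    assume "those (map (\<lambda>G. G (map e is)) (G # Gs)) = Some vs"
    then have "map (\<lambda>G. G (map e is)) (G # Gs) = map Some vs"
      unfolding those_eq_Some .
    then obtain v vs' where vs: "vs = v # vs'" "G (map e is) = Some v"
      "map (\<lambda>G. G (map e is)) Gs = map Some vs'"
      by (cases vs) auto
    have 1: "runs s A c1 T e T (e(b := v))"
      by (rule compiles_runs[OF c1 vs(2)])
    have "map (e(b := v)) is = map e is"
      using \<open>b \<notin> set is\<close> by auto
    then have "those (map (\<lambda>G. G (map (e(b := v)) is)) Gs) = Some vs'"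
      using vs(3) by (simp only: those_eq_Some)
    from c2[OF this, of A T] obtain e' where e': "runs s A c2 T (e(b := v)) T e'"
      "map e' [Suc b..<Suc b + length Gs] = vs'" "\<And>r. r < Suc b \<Longrightarrow> e' r = (e(b := v)) r"
      by blast
    have "map e' [b..<b + length (G # Gs)] = vs"
      using e'(2) e'(3)[of b] vs(1) by (simp add: upt_conv_Cons del: upt_Suc)
    moreover have "\<forall>r. r < b \<longrightarrow> e' r = e r"
      using e'(3) by simp
    ultimately show "\<exists>e'. runs s A (Seq c1 c2) T e T e' \<and> map e' [b..<b + length (G # Gs)] = vs \<and>
      (\<forall>r. r < b \<longrightarrow> e' r = e r)"
      using runs_Seq[OF 1 e'(1)] by blast
  qed
qed

lemma compilable_comp:
  assumes "compilable (length Gs) F" "\<forall>G\<in>set Gs. compilable n G"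
  shows "compilable n (\<lambda>xs. Option.bind (those (map (\<lambda>G. G xs) Gs)) F)"
proof (rule compilableI)
  fix "is" :: "nat list" and o' s :: nat
  assume a: "length is = n" "set is \<subseteq> {..<s}" "o' < s" "o' \<notin> set is"
  define s' where "s' = s + length Gs"
  have "\<forall>G\<in>set Gs. compilable (length is) G" "s + length Gs \<le> s'"
    using assms(2) a(1) by (simp_all add: s'_def)
  from compile_list[OF this(1) a(2) this(2)] obtain c1 where c1: "\<And>A T e vs.
    those (map (\<lambda>G. G (map e is)) Gs) = Some vs \<Longrightarrow>
    (\<exists>e'. runs s' A c1 T e T e' \<and> map e' [s..<s'] = vs \<and> (\<forall>r. r < s \<longrightarrow> e' r = e r))"
    unfolding s'_def by blast
  obtain c2 where c2: "compiles s' [s..<s'] o' F c2"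
    by (rule compilableE[OF assms(1), of "[s..<s']" s' o']) (use a in \<open>auto simp: s'_def\<close>)
  have "compiles s is o' (\<lambda>xs. Option.bind (those (map (\<lambda>G. G xs) Gs)) F) (Seq c1 c2)"
    unfolding compiles_def
  proof (intro allI impI)
    fix A T e v
    assume "Option.bind (those (map (\<lambda>G. G (map e is)) Gs)) F = Some v"
    then obtain vs where vs: "those (map (\<lambda>G. G (map e is)) Gs) = Some vs" "F vs = Some v"
      by (auto simp: bind_eq_Some_conv)
    show "runs s A (Seq c1 c2) T e T (e(o' := v))"
    proof (rule runs_local)
      show "s \<le> s'" by (simp add: s'_def)
      fix e1 assume 1: "agree s e e1"
      then have "map e1 is = map e is"
        using a(2) by (rule agree_map)
      then have "those (map (\<lambda>G. G (map e1 is)) Gs) = Some vs"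
        using vs(1) by (simp only:)
      from c1[OF this, of A T] obtain e' where e': "runs s' A c1 T e1 T e'" "map e' [s..<s'] = vs"
        "\<And>r. r < s \<Longrightarrow> e' r = e1 r"
        by blast
      have "runs s' A c2 T e' T (e'(o' := v))"
        by (rule compiles_runs[OF c2]) (simp only: e'(2) vs(2))
      moreover have "agree s (e(o' := v)) (e'(o' := v))"
        using 1 e'(3) by (auto simp: agree_def)
      ultimately show "\<exists>e2. runs s' A (Seq c1 c2) T e1 T e2 \<and> agree s (e(o' := v)) e2"
        using runs_Seq[OF e'(1)] by blast
    qed
  qed
  then show "\<exists>c. compiles s is o' (\<lambda>xs. Option.bind (those (map (\<lambda>G. G xs) Gs)) F) c"
    by blast
qed

text \<open>A strict recursion that is defined at the end has been defined all the way; hence the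
  compiled loop meets a value in every round.\<close>

lemma strict_rec_defined:
  assumes "\<And>i. R (Suc i) = Option.bind (R i) (H i)" "R (i + l) \<noteq> None"
  shows "R i \<noteq> None"
  using assms(2) by (induction l) (auto simp: assms(1) bind_eq_Some_conv)

lemma compilable_prim:
  assumes F: "compilable n F" and G: "compilable (Suc (Suc n)) G"
  shows "compilable (Suc n) (\<lambda>xs. rec_nat (F (tl xs))
      (\<lambda>y r. Option.bind r (\<lambda>v. G (y # v # tl xs))) (hd xs))"
proof (rule compilableI)
  fix "is" :: "nat list" and o' s :: nat
  assume a: "length is = Suc n" "set is \<subseteq> {..<s}" "o' < s" "o' \<notin> set is"
  then obtain h js where js: "is = h # js" "length js = n" "h < s" "set js \<subseteq> {..<s}" "h \<noteq> o'"
    by (auto simp: length_Suc_conv)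
  define s' where "s' = s + 4"
  define y where "y = s"
  define acc where "acc = s + 1"
  define cnt where "cnt = s + 2"
  define t where "t = s + 3"
  note regs = y_def acc_def cnt_def t_def s'_def
  have js_lt: "r \<in> set js \<Longrightarrow> r < s" for r
    using js(4) by auto
  obtain cF where cF: "compiles s' js acc F cF"
    by (rule compilableE[OF F js(2), of s' acc]) (use js_lt in \<open>fastforce simp: regs\<close>)+
  obtain cG where cG: "compiles s' (y # acc # js) t G cG"
    by (rule compilableE[OF G, of "y # acc # js" s' t]) (use js(2) js_lt in \<open>fastforce simp: regs\<close>)+
  define body where "body = Seq (Seq (dec cnt) cG) (Seq (copy t acc s') (inc y))"
  define c where "c = Seq (Seq (Seq cF (copy h cnt s')) (Seq (clear y) (loop cnt body))) (copy acc o' s')"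
  \<comment> \<open>Invariant: \<open>acc\<close> holds the value of the recursion at
    \<open>y\<close>, and \<open>cnt\<close> counts the rounds that remain.\<close>
  have loop: "\<exists>e'. runs s' A (loop cnt body) T e T e' \<and> e' acc = v \<and> agree s e e'"
    if "e cnt = j" "map e js = xs"
      "rec_nat (F xs) (\<lambda>y r. Option.bind r (\<lambda>v. G (y # v # xs))) (e y) = Some (e acc)"
      "rec_nat (F xs) (\<lambda>y r. Option.bind r (\<lambda>v. G (y # v # xs))) (e y + j) = Some v" for A T e j v xs
    using that
  proof (induction j arbitrary: e)
    case 0
    then show ?case
      by (intro exI[of _ e] conjI runs_loop_stop agree_refl) (auto simp: regs)
  next
    case (Suc j)
    define R where "R = rec_nat (F xs) (\<lambda>y r. Option.bind r (\<lambda>v. G (y # v # xs)))"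
    have R_Suc: "R (Suc i) = Option.bind (R i) (\<lambda>v. G (i # v # xs))" for i
      by (simp add: R_def)
    note R_defined = strict_rec_defined[of R, OF R_Suc]
    have R: "R (e y) = Some (e acc)" "R (e y + Suc j) = Some v"
      using Suc.prems unfolding R_def by blast+
    then have "R (Suc (e y)) \<noteq> None"
      using R_defined[of "Suc (e y)" j] by simp
    then obtain w where w: "R (Suc (e y)) = Some w" by auto
    then have Gw: "G (e y # e acc # xs) = Some w"
      using R(1) by (simp add: R_Suc)
    define e1 where "e1 = e(cnt := j)"
    define e2 where "e2 = e1(t := w)"
    define e3 where "e3 = e2(acc := e2 t)"
    define e4 where "e4 = e3(y := Suc (e3 y))"
    have js_same: "map e1 js = xs" "map e4 js = xs"
      using Suc.prems(2) js_lt by (fastforce simp: e1_def e2_def e3_def e4_def regs)+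
    have "runs s' A (dec cnt) T e T e1"
      unfolding e1_def using Suc.prems(1) by (intro runs_dec) (auto simp: regs)
    moreover have "runs s' A cG T e1 T e2"
      unfolding e2_def
    proof (rule compiles_runs[OF cG])
      show "G (map e1 (y # acc # js)) = Some w"
        using Gw js_same(1) by (simp add: e1_def regs)
    qed
    moreover have "runs s' A (copy t acc s') T e2 T e3"
      unfolding e3_def by (rule runs_copy) (auto simp: regs)
    moreover have "runs s' A (inc y) T e3 T e4"
      unfolding e4_def by (rule runs_inc) (auto simp: regs)
    ultimately have body: "runs s' A body T e T e4"
      unfolding body_def by (intro runs_Seq)
    have vals: "e4 cnt = j" "e4 y = Suc (e y)" "e4 acc = w"
      by (simp_all add: e1_def e2_def e3_def e4_def regs)
    have "\<exists>e'. runs s' A (loop cnt body) T e4 T e' \<and> e' acc = v \<and> agree s e4 e'"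
      by (rule Suc.IH) (use vals js_same(2) w R(2) in \<open>simp_all add: R_def\<close>)
    then obtain e' where e': "runs s' A (loop cnt body) T e4 T e'" "e' acc = v" "agree s e4 e'"
      by blast
    have "agree s e e4"
      by (auto simp: agree_def e1_def e2_def e3_def e4_def regs)
    with e'(3) have "agree s e e'" by (blast intro: agree_trans)
    moreover have "runs s' A (loop cnt body) T e T e'"
      by (rule runs_loop_step[OF _ _ body e'(1)]) (use Suc.prems(1) in \<open>auto simp: regs\<close>)
    ultimately show ?case
      using e'(2) by blast
  qed
  have "compiles s is o' (\<lambda>xs. rec_nat (F (tl xs)) (\<lambda>y r. Option.bind r (\<lambda>v. G (y # v # tl xs))) (hd xs)) c"
    unfolding compiles_def
  proof (intro allI impI)
    fix A T e v
    assume v: "rec_nat (F (tl (map e is))) (\<lambda>y r. Option.bind r (\<lambda>v. G (y # v # tl (map e is)))) (hd (map e is)) = Some v"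
    show "runs s A c T e T (e(o' := v))"
    proof (rule runs_local)
      show "s \<le> s'" by (simp add: s'_def)
      fix e1 assume 1: "agree s e e1"
      define xs where "xs = map e1 js"
      define R where "R = rec_nat (F xs) (\<lambda>y r. Option.bind r (\<lambda>v. G (y # v # xs)))"
      have R_Suc: "R (Suc i) = Option.bind (R i) (\<lambda>v. G (i # v # xs))" and R_0: "R 0 = F xs" for i
        by (simp_all add: R_def)
      note R_defined = strict_rec_defined[of R, OF R_Suc]
      have same: "map e1 is = map e is"
        using 1 a(2) by (rule agree_map)
      from v have Rv: "R (e1 h) = Some v"
        unfolding same[symmetric] by (simp add: js(1) xs_def R_def)
      then have "R 0 \<noteq> None"
        using R_defined[of 0 "e1 h"] by simp
      then obtain w where w: "F xs = Some w"
        by (auto simp: R_0)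
      define e2 where "e2 = e1(acc := w)"
      define e3 where "e3 = e2(cnt := e2 h)"
      define e4 where "e4 = e3(y := 0)"
      have r2: "runs s' A cF T e1 T e2"
        unfolding e2_def by (rule compiles_runs[OF cF]) (use w in \<open>simp add: xs_def\<close>)
      have r3: "runs s' A (copy h cnt s') T e2 T e3"
        unfolding e3_def by (rule runs_copy) (use js(3) in \<open>auto simp: regs\<close>)
      have r4: "runs s' A (clear y) T e3 T e4"
        unfolding e4_def by (rule runs_clear)
      have js_same: "map e4 js = xs"
        unfolding xs_def using js_lt by (fastforce simp: e2_def e3_def e4_def regs)
      have vals: "e4 cnt = e1 h" "e4 y = 0" "e4 acc = w"
        using js(3) by (auto simp: e2_def e3_def e4_def regs)
      have "\<exists>e'. runs s' A (loop cnt body) T e4 T e' \<and> e' acc = v \<and> agree s e4 e'"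
        by (rule loop[OF vals(1) js_same]) (use vals w Rv in \<open>simp_all add: R_def\<close>)
      then obtain e5 where r5: "runs s' A (loop cnt body) T e4 T e5" "e5 acc = v" "agree s e4 e5"
        by blast
      have r6: "runs s' A (copy acc o' s') T e5 T (e5(o' := e5 acc))"
        by (rule runs_copy) (use a(3) in \<open>auto simp: regs\<close>)
      have "runs s' A c T e1 T (e5(o' := e5 acc))"
        unfolding c_def by (intro runs_Seq[OF _ r6] runs_Seq[OF _ runs_Seq[OF r4 r5(1)]] runs_Seq[OF r2 r3])
      moreover have "agree s (e(o' := v)) (e5(o' := e5 acc))"
      proof -
        have "agree s e1 e4"
          by (auto simp: agree_def e2_def e3_def e4_def regs)
        then have "agree s e e5"
          using 1 r5(3) by (blast intro: agree_trans)
        then show ?thesis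
          unfolding r5(2) by (rule agree_update)
      qed
      ultimately show "\<exists>e2. runs s' A c T e1 T e2 \<and> agree s (e(o' := v)) e2"
        by blast
    qed
  qed
  then show "\<exists>c. compiles s is o' (\<lambda>xs. rec_nat (F (tl xs))
      (\<lambda>y r. Option.bind r (\<lambda>v. G (y # v # tl xs))) (hd xs)) c" by blast
qed

lemma compilable_mu:
  assumes F: "compilable (Suc n) F"
  shows "compilable n (\<lambda>xs. if \<exists>z. F (z # xs) = Some 0 \<and> (\<forall>y<z. F (y # xs) \<noteq> None)
      then Some (LEAST z. F (z # xs) = Some 0) else None)" (is "compilable n ?M")
proof (rule compilableI)
  fix "is" :: "nat list" and o' s :: nat
  assume a: "length is = n" "set is \<subseteq> {..<s}" "o' < s" "o' \<notin> set is"
  define s' where "s' = s + 2"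
  define y where "y = s"
  define t where "t = s + 1"
  note regs = y_def t_def s'_def
  have is_lt: "r \<in> set is \<Longrightarrow> r < s" for r
    using a(2) by auto
  obtain cF where cF: "compiles s' (y # is) t F cF"
    by (rule compilableE[OF F, of "y # is" s' t]) (use a(1) is_lt in \<open>fastforce simp: regs\<close>)+
  define body where "body = Seq (inc y) cF"
  define c where "c = Seq (Seq (Seq (clear y) cF) (loop t body)) (copy y o' s')"
  \<comment> \<open>Invariant: \<open>t\<close> holds the value of \<open>F\<close> at the current
    \<open>y\<close>, so the loop test is the test for a zero; \<open>j\<close> is the distance to
    the first zero \<open>z\<close>.\<close>
  have loop: "\<exists>e'. runs s' A (loop t body) T e T e' \<and> e' y = z \<and> agree s e e'"
    if "e y + j = z" "map e is = xs" "F (e y # xs) = Some (e t)" "F (z # xs) = Some 0"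
      "\<And>u. u < z \<Longrightarrow> F (u # xs) \<noteq> None \<and> F (u # xs) \<noteq> Some 0" for A T e j z xs
    using that(1-3)
  proof (induction j arbitrary: e)
    case 0
    then have "e t = 0"
      using that(4) by simp
    then show ?case
      using 0 by (intro exI[of _ e] conjI runs_loop_stop agree_refl) (auto simp: regs)
  next
    case (Suc j)
    have "F (Suc (e y) # xs) \<noteq> None"
      using that(4) that(5)[of "Suc (e y)"] Suc.prems(1) by (cases j) auto
    then obtain w where w: "F (Suc (e y) # xs) = Some w" by auto
    have nz: "e t \<noteq> 0"
      using that(5)[of "e y"] Suc.prems by auto
    define e1 where "e1 = e(y := Suc (e y))"
    define e2 where "e2 = e1(t := w)"
    have is_same: "map e1 is = xs" "map e2 is = xs"
      using Suc.prems(2) is_lt by (fastforce simp: e1_def e2_def regs)+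
    have "runs s' A (inc y) T e T e1"
      unfolding e1_def by (rule runs_inc) (simp add: regs)
    moreover have "runs s' A cF T e1 T e2"
      unfolding e2_def
    proof (rule compiles_runs[OF cF])
      show "F (map e1 (y # is)) = Some w"
        using w is_same(1) by (simp add: e1_def)
    qed
    ultimately have body: "runs s' A body T e T e2"
      unfolding body_def by (rule runs_Seq)
    have vals: "e2 y = Suc (e y)" "e2 t = w"
      by (simp_all add: e1_def e2_def regs)
    have "\<exists>e'. runs s' A (loop t body) T e2 T e' \<and> e' y = z \<and> agree s e2 e'"
      by (rule Suc.IH) (use vals is_same(2) w Suc.prems(1) in simp_all)
    then obtain e' where e': "runs s' A (loop t body) T e2 T e'" "e' y = z" "agree s e2 e'"
      by blast
    have "agree s e e2"
      by (auto simp: agree_def e1_def e2_def regs)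
    with e'(3) have "agree s e e'" by (blast intro: agree_trans)
    moreover have "runs s' A (loop t body) T e T e'"
      by (rule runs_loop_step[OF _ nz body e'(1)]) (simp add: regs)
    ultimately show ?case
      using e'(2) by blast
  qed
  have "compiles s is o' ?M c"
    unfolding compiles_def
  proof (intro allI impI)
    fix A T e v
    assume M: "?M (map e is) = Some v"
    define xs where "xs = map e is"
    have ex: "\<exists>z. F (z # xs) = Some 0 \<and> (\<forall>y<z. F (y # xs) \<noteq> None)"
    proof (rule ccontr)
      assume n: "\<not> ?thesis"
      from M show False
        unfolding xs_def[symmetric] if_not_P[OF n] by simp
    qed
    then have v: "v = (LEAST z. F (z # xs) = Some 0)"
      using M unfolding xs_def[symmetric] by simp
    obtain z where z: "F (z # xs) = Some 0" "\<forall>y<z. F (y # xs) \<noteq> None"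
      using ex by blast
    have v0: "F (v # xs) = Some 0"
      unfolding v by (rule LeastI[of _ z]) (rule z)
    have "v \<le> z"
      unfolding v by (rule Least_le) (rule z)
    then have before: "F (u # xs) \<noteq> None \<and> F (u # xs) \<noteq> Some 0" if "u < v" for u
      using that z(2) not_less_Least[of u "\<lambda>z. F (z # xs) = Some 0"] unfolding v by auto
    show "runs s A c T e T (e(o' := v))"
    proof (rule runs_local)
      show "s \<le> s'" by (simp add: s'_def)
      fix e1 assume 1: "agree s e e1"
      have xs1: "map e1 is = xs"
        unfolding xs_def using 1 a(2) by (rule agree_map)
      have "F (0 # xs) \<noteq> None"
        using v0 before[of 0] by (cases v) auto
      then obtain w where w: "F (0 # xs) = Some w" by auto
      define e2 where "e2 = e1(y := 0)"
      define e3 where "e3 = e2(t := w)"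
      have is_same: "map e2 is = xs" "map e3 is = xs"
        using xs1 is_lt by (fastforce simp: e2_def e3_def regs)+
      have r2: "runs s' A (clear y) T e1 T e2"
        unfolding e2_def by (rule runs_clear)
      have r3: "runs s' A cF T e2 T e3"
        unfolding e3_def
      proof (rule compiles_runs[OF cF])
        show "F (map e2 (y # is)) = Some w"
          using w is_same(1) by (simp add: e2_def)
      qed
      have vals: "e3 y = 0" "e3 t = w"
        by (simp_all add: e2_def e3_def regs)
      have "\<exists>e'. runs s' A (loop t body) T e3 T e' \<and> e' y = v \<and> agree s e3 e'"
        by (rule loop[OF _ is_same(2), of v]) (use vals w v0 before in simp_all)
      then obtain e4 where r4: "runs s' A (loop t body) T e3 T e4" "e4 y = v" "agree s e3 e4"
        by blast
      have r5: "runs s' A (copy y o' s') T e4 T (e4(o' := e4 y))"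
        by (rule runs_copy) (use a(3) in \<open>auto simp: regs\<close>)
      have "runs s' A c T e1 T (e4(o' := e4 y))"
        unfolding c_def by (intro runs_Seq[OF _ r5] runs_Seq[OF _ r4(1)] runs_Seq[OF r2 r3])
      moreover have "agree s (e(o' := v)) (e4(o' := e4 y))"
      proof -
        have "agree s e1 e3"
          by (auto simp: agree_def e2_def e3_def regs)
        then have "agree s e e4"
          using 1 r4(3) by (blast intro: agree_trans)
        then show ?thesis
          unfolding r4(2) by (rule agree_update)
      qed
      ultimately show "\<exists>e2. runs s' A c T e1 T e2 \<and> agree s (e(o' := v)) e2"
        by blast
    qed
  qed
  then show "\<exists>c. compiles s is o' ?M c" by blast
qed

lemma partrec_compilable: "partrec n F \<Longrightarrow> compilable n F"
proof (induction rule: partrec.induct)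
  case (zero n)
  show ?case
  proof (rule compilableI)
    fix "is" o' s
    show "\<exists>c. compiles s is o' (\<lambda>xs. Some 0) c"
      unfolding compiles_def by (intro exI[of _ "clear o'"]) (auto intro: runs_clear)
  qed
next
  case succ
  show ?case by (rule compilable_succ)
next
  case (proj i n)
  then show ?case by (rule compilable_proj)
next
  case (comp Gs F n)
  then show ?case by (intro compilable_comp) auto
next
  case (prim n F G)
  then show ?case by (intro compilable_prim)
next
  case (mu n F)
  show ?case by (rule compilable_mu[OF mu.IH])
qed

section \<open>Control flow and calls of recursive functions\<close>

lemma runs_Act: "j < 3 \<Longrightarrow> runs s A (Act j w d) T e (T(j := act w d (T j))) e"
proof (rule runs_simple)
  fix e1 assume j: "j < 3" and "agree s e e1"
  have "exec A (Act j w d) (store_of T e1) ((store_of T e1)(j := act w d (store_of T e1 j)))"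
    by (rule exec_Act)
  with \<open>agree s e e1\<close>
  show "exec A (Act j w d) (store_of T e1) (store_of (T(j := act w d (T j))) e1) \<and> agree s e e1"
    using j by (simp only: store_of_tape store_of_update_tape simp_thms)
qed

lemma runs_While_stop: "j < 3 \<Longrightarrow> tape_read (T j) \<notin> X \<Longrightarrow> runs s A (While j X c) T e T e"
  by (rule runs_simple, rule conjI, rule exec_While_stop) (simp_all only: store_of_tape not_False_eq_True)

lemma runs_While_step:
  assumes "j < 3" "tape_read (T j) \<in> X" "runs s A c T e T' e'" "runs s A (While j X c) T' e' T'' e''"
  shows "runs s A (While j X c) T e T'' e''"
proof (rule runsI)
  fix e1 assume 1: "agree s e e1"
  obtain e2 where 2: "exec A c (store_of T e1) (store_of T' e2)" "agree s e' e2"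
    by (rule runsE[OF assms(3) 1])
  obtain e3 where 3: "exec A (While j X c) (store_of T' e2) (store_of T'' e3)" "agree s e'' e3"
    by (rule runsE[OF assms(4) 2(2)])
  have "tape_read (store_of T e1 j) \<in> X"
    using assms(1,2) by (simp only: store_of_tape)
  from exec_While_step[OF this 2(1) 3(1)] 3(2)
  show "\<exists>e2. exec A (While j X c) (store_of T e1) (store_of T'' e2) \<and> agree s e'' e2"
    by blast
qed

lemma runs_cases:
  assumes "b \<Longrightarrow> runs s A c1 T e T' e'" "\<not> b \<Longrightarrow> runs s A c2 T e T' e'"
    and "\<And>e1 \<sigma>. agree s e e1 \<Longrightarrow> b \<Longrightarrow> exec A c1 (store_of T e1) \<sigma> \<Longrightarrow> exec A c (store_of T e1) \<sigma>"
    and "\<And>e1 \<sigma>. agree s e e1 \<Longrightarrow> \<not> b \<Longrightarrow> exec A c2 (store_of T e1) \<sigma> \<Longrightarrow> exec A c (store_of T e1) \<sigma>"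
  shows "runs s A c T e T' e'"
  using assms unfolding runs_def by (cases b) blast+

lemma runs_If:
  assumes "j < 3" "tape_read (T j) \<in> X \<Longrightarrow> runs s A c1 T e T' e'" "tape_read (T j) \<notin> X \<Longrightarrow> runs s A c2 T e T' e'"
  shows "runs s A (If j X c1 c2) T e T' e'"
  by (rule runs_cases[of "tape_read (T j) \<in> X", OF assms(2,3)])
    (use assms(1) in \<open>simp_all add: exec_If_true exec_If_false store_of_tape\<close>)

definition if_zero :: "nat \<Rightarrow> com \<Rightarrow> com \<Rightarrow> com" where
  "if_zero r c1 c2 = If (r + 3) {Blank} c2 c1"

lemma runs_if_zero:
  assumes "r < s" "e r = 0 \<Longrightarrow> runs s A c1 T e T' e'" "e r \<noteq> 0 \<Longrightarrow> runs s A c2 T e T' e'"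
  shows "runs s A (if_zero r c1 c2) T e T' e'"
proof (rule runs_cases[of "e r = 0", OF assms(2,3)])
  fix e1 \<sigma> assume "agree s e e1"
  then have "e1 r = e r"
    using assms(1) by (simp add: agree_def)
  then have read: "tape_read (store_of T e1 (r + 3)) \<in> {Blank} \<longleftrightarrow> e r \<noteq> 0"
    by (simp only: store_of_register read_register singleton_iff)
  show "exec A (if_zero r c1 c2) (store_of T e1) \<sigma>" if "e r = 0" "exec A c1 (store_of T e1) \<sigma>"
    unfolding if_zero_def by (rule exec_If_false) (use read that in blast)+
  show "exec A (if_zero r c1 c2) (store_of T e1) \<sigma>" if "e r \<noteq> 0" "exec A c2 (store_of T e1) \<sigma>"
    unfolding if_zero_def by (rule exec_If_true) (use read that in blast)+
qed

lemma runs_Query: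
  assumes "tape_string (T 1) \<in> A \<Longrightarrow> runs s A c1 T e T' e'" "tape_string (T 1) \<notin> A \<Longrightarrow> runs s A c2 T e T' e'"
  shows "runs s A (Query c1 c2) T e T' e'"
  by (rule runs_cases[of "tape_string (T 1) \<in> A", OF assms])
    (simp_all add: exec_Query_yes exec_Query_no store_of_tape)

text \<open>\<open>compilable\<close> wants the output register to differ from the inputs. The
  result goes to the scratch register \<open>s\<close> and is copied from there, so \<open>i\<close>
  and \<open>o'\<close> may coincide.\<close>

lemma compile_partial_recursive:
  assumes "partial_recursive g" "i < s" "o' < s"
  obtains c where "\<And>A T e v. g (e i) = Some v \<Longrightarrow> runs s A c T e T (e(o' := v))"
proof -
  obtain F where F: "partrec 1 F" "\<And>x. F [x] = g x"
    using assms unfolding partial_recursive_def by blast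
  obtain c where c: "compiles (Suc s) [i] s F c"
    by (rule compilableE[OF partrec_compilable[OF F(1)], of "[i]" "Suc s" s]) (use assms in auto)
  show ?thesis
  proof (rule that)
    fix A T e v
    assume g: "g (e i) = Some v"
    show "runs s A (Seq c (copy s o' (Suc s))) T e T (e(o' := v))"
    proof (rule runs_local)
      fix e1 assume 1: "agree s e e1"
      then have "e1 i = e i"
        using assms(2) by (simp add: agree_def)
      then have r1: "runs (Suc s) A c T e1 T (e1(s := v))"
        by (intro compiles_runs[OF c]) (simp add: F(2) g)
      have r2: "runs (Suc s) A (copy s o' (Suc s)) T (e1(s := v)) T ((e1(s := v))(o' := (e1(s := v)) s))"
        by (rule runs_copy) (use assms(3) in auto)
      have "agree s (e(o' := v)) ((e1(s := v))(o' := (e1(s := v)) s))"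
        using 1 by (auto simp: agree_def)
      with runs_Seq[OF r1 r2]
      show "\<exists>e2. runs (Suc s) A (Seq c (copy s o' (Suc s))) T e1 T e2 \<and> agree s (e(o' := v)) e2"
        by blast
    qed simp
  qed
qed

lemma compile_recursive:
  assumes "recursive f" "i < s" "o' < s"
  obtains c where "\<And>A T e. runs s A c T e T (e(o' := f (e i)))"
proof -
  have "partial_recursive (\<lambda>x. Some (f x))"
    using assms(1) unfolding recursive_partial_recursive .
  then show ?thesis
  proof (rule compile_partial_recursive[OF _ assms(2,3)])
    fix c
    assume c: "\<And>A T e v. Some (f (e i)) = Some v \<Longrightarrow> runs s A c T e T (e(o' := v))"
    show thesis
      by (rule that[of c]) (rule c, rule refl)
  qed
qed

lemma compile_recursive2:
  assumes f: "recursive2 f" and "i < s" "j < s" "o' < s"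
  obtains c where "\<And>A T e. runs s A c T e T (e(o' := f (e i) (e j)))"
proof -
  have "recursive_list 2 (\<lambda>xs. npair (xs ! 0) (xs ! 1))"
    by (intro recursive_list_npair recursive_list_nth) auto
  from recursive_list_recursive[OF f this] obtain F where
    F: "partrec 2 F" "\<And>xs. length xs = 2 \<Longrightarrow> F xs = Some (f (xs ! 0) (xs ! 1))"
    unfolding recursive_list_def by auto
  obtain c where c: "compiles (Suc s) [i, j] s F c"
    by (rule compilableE[OF partrec_compilable[OF F(1)], of "[i, j]" "Suc s" s]) (use assms in auto)
  show ?thesis
  proof (rule that)
    fix A T e
    let ?v = "f (e i) (e j)"
    show "runs s A (Seq c (copy s o' (Suc s))) T e T (e(o' := ?v))"
    proof (rule runs_local)
      fix e1 assume 1: "agree s e e1"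
      then have "e1 i = e i" "e1 j = e j"
        using assms(2,3) by (simp_all add: agree_def)
      then have r1: "runs (Suc s) A c T e1 T (e1(s := ?v))"
        by (intro compiles_runs[OF c]) (simp add: F(2))
      have r2: "runs (Suc s) A (copy s o' (Suc s)) T (e1(s := ?v)) T ((e1(s := ?v))(o' := (e1(s := ?v)) s))"
        by (rule runs_copy) (use assms(4) in auto)
      have "agree s (e(o' := ?v)) ((e1(s := ?v))(o' := (e1(s := ?v)) s))"
        using 1 by (auto simp: agree_def)
      with runs_Seq[OF r1 r2]
      show "\<exists>e2. runs (Suc s) A (Seq c (copy s o' (Suc s))) T e1 T e2 \<and> agree s (e(o' := ?v)) e2"
        by blast
    qed simp
  qed
qed

subsection \<open>Strings on tapes\<close>

definition prefix_tape :: "str \<Rightarrow> nat \<Rightarrow> tape" where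
  "prefix_tape s i = (\<lambda>c. if 0 \<le> c \<and> c < int i then Bit (s ! nat c) else Blank, int i)"

lemma prefix_tape_0: "prefix_tape s 0 = blank_tape"
  by (auto simp: prefix_tape_def blank_tape_def)

lemma act_append: "act (Some (Bit (s ! i))) Go_Right (prefix_tape s i) = prefix_tape s (Suc i)"
  by (auto simp: act_def prefix_tape_def fun_eq_iff)

lemma act_erase: "act (Some Blank) Stay (act None Go_Left (prefix_tape s (Suc i))) = prefix_tape s i"
  by (auto simp: act_def prefix_tape_def fun_eq_iff)

lemma tape_string_prefix_tape: "tape_string (prefix_tape s (length s)) = s"
proof -
  have "tape_string (prefix_tape s (length s)) = tape_string (string_tape s)"
    unfolding prefix_tape_def string_tape_def tape_string.simps ..
  then show ?thesis by simp
qed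

lemma write_program:
  assumes "j < 3" "x < s" "x \<noteq> 3" "x \<noteq> 4" "x \<noteq> 5" "5 < s"
  obtains c where "\<And>A T e. T j = blank_tape \<Longrightarrow> \<exists>e'.
    runs s A c T e (T(j := prefix_tape (num_str (e x)) (length (num_str (e x))))) e' \<and>
    (\<forall>r. r \<noteq> 3 \<and> r \<noteq> 4 \<and> r \<noteq> 5 \<longrightarrow> e' r = e r)"
proof -
  have "recursive (\<lambda>x. length (num_str x))"
    by (intro rec_intros)
  then obtain cl where cl: "\<And>A T e. runs s A cl T e T (e(3 := length (num_str (e x))))"
    by (rule compile_recursive[of _ x s 3]) (use assms in auto)
  have "recursive2 str_bit"
    by (intro rec_intros)
  then obtain cb where cb: "\<And>A T e. runs s A cb T e T (e(5 := str_bit (e x) (e 4)))"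
    by (rule compile_recursive2[of _ x s 4 5]) (use assms in auto)
  \<comment> \<open>Register 3 counts the symbols still to be written, register 4 is the position in
    the string and register 5 the current bit.\<close>
  define body where "body = Seq (Seq (dec 3) cb) (Seq (if_zero 5 (Act j (Some (Bit False)) Go_Right)
    (Act j (Some (Bit True)) Go_Right)) (inc 4))"
  have loop: "\<exists>e'. runs s A (loop 3 body) T e (T(j := prefix_tape (num_str v) (length (num_str v)))) e' \<and>
      (\<forall>r. r \<noteq> 3 \<and> r \<noteq> 4 \<and> r \<noteq> 5 \<longrightarrow> e' r = e r)"
    if "e 3 = l" "e 4 + l = length (num_str v)" "T j = prefix_tape (num_str v) (e 4)" "e x = v" for A T e v l
    using that
  proof (induction l arbitrary: T e)
    case 0
    have "T(j := prefix_tape (num_str v) (length (num_str v))) = T"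
      using 0 by auto
    then show ?case
      using runs_loop_stop[of 3 s e A body T] 0 assms by auto
  next
    case (Suc l)
    let ?i = "e 4"
    have i: "?i < length (num_str v)" using Suc.prems by simp
    define e1 where "e1 = e(3 := l)"
    define e2 where "e2 = e1(5 := str_bit (e1 x) (e1 4))"
    define T1 where "T1 = T(j := prefix_tape (num_str v) (Suc ?i))"
    define e3 where "e3 = e2(4 := Suc (e2 4))"
    have r1: "runs s A (dec 3) T e T e1"
      unfolding e1_def by (rule runs_dec) (use assms Suc.prems in auto)
    have r2: "runs s A cb T e1 T e2"
      unfolding e2_def by (rule cb)
    have bit: "e2 5 = of_bool (num_str v ! ?i)"
      using str_bit[OF i] assms Suc.prems by (simp add: e2_def e1_def)
    have r3: "runs s A (if_zero 5 (Act j (Some (Bit False)) Go_Right) (Act j (Some (Bit True)) Go_Right)) T e2 T1 e2"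
    proof (rule runs_if_zero)
      have *: "runs s A (Act j (Some (Bit (num_str v ! ?i))) Go_Right) T e2 T1 e2"
        using runs_Act[OF assms(1), of s A "Some (Bit (num_str v ! ?i))" Go_Right T e2]
        unfolding T1_def Suc.prems(3) act_append .
      show "runs s A (Act j (Some (Bit False)) Go_Right) T e2 T1 e2" if "e2 5 = 0"
        using * that bit by simp
      show "runs s A (Act j (Some (Bit True)) Go_Right) T e2 T1 e2" if "e2 5 \<noteq> 0"
        using * that bit by simp
    qed (use assms in auto)
    have r4: "runs s A (inc 4) T1 e2 T1 e3"
      unfolding e3_def by (rule runs_inc) (use assms in auto)
    have body: "runs s A body T e T1 e3"
      unfolding body_def by (rule runs_Seq[OF runs_Seq[OF r1 r2] runs_Seq[OF r3 r4]])
    have e3: "e3 3 = l" "e3 4 = Suc ?i" "e3 x = v" "\<And>r. r \<noteq> 3 \<and> r \<noteq> 4 \<and> r \<noteq> 5 \<Longrightarrow> e3 r = e r"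
      using assms Suc.prems by (auto simp: e3_def e2_def e1_def)
    have "\<exists>e'. runs s A (loop 3 body) T1 e3 (T1(j := prefix_tape (num_str v) (length (num_str v)))) e' \<and>
      (\<forall>r. r \<noteq> 3 \<and> r \<noteq> 4 \<and> r \<noteq> 5 \<longrightarrow> e' r = e3 r)"
      by (rule Suc.IH) (use e3 Suc.prems in \<open>simp_all add: T1_def\<close>)
    then obtain e' where e': "runs s A (loop 3 body) T1 e3 (T(j := prefix_tape (num_str v) (length (num_str v)))) e'"
      "\<And>r. r \<noteq> 3 \<and> r \<noteq> 4 \<and> r \<noteq> 5 \<Longrightarrow> e' r = e3 r"
      unfolding T1_def by auto
    have "runs s A (loop 3 body) T e (T(j := prefix_tape (num_str v) (length (num_str v)))) e'"
      by (rule runs_loop_step[OF _ _ body e'(1)]) (use assms Suc.prems in auto)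
    moreover have "\<forall>r. r \<noteq> 3 \<and> r \<noteq> 4 \<and> r \<noteq> 5 \<longrightarrow> e' r = e r"
      using e'(2) e3(4) by simp
    ultimately show ?case by blast
  qed
  show ?thesis
  proof (rule that)
    fix A T e
    assume blank: "T j = blank_tape"
    define e1 where "e1 = e(3 := length (num_str (e x)))"
    define e2 where "e2 = e1(4 := 0)"
    have r1: "runs s A cl T e T e1"
      unfolding e1_def by (rule cl)
    have r2: "runs s A (clear 4) T e1 T e2"
      unfolding e2_def by (rule runs_clear)
    have vals: "e2 3 = length (num_str (e x))" "e2 4 = 0" "e2 x = e x"
      using assms by (auto simp: e2_def e1_def)
    have "\<exists>e'. runs s A (loop 3 body) T e2 (T(j := prefix_tape (num_str (e x)) (length (num_str (e x))))) e' \<and>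
      (\<forall>r. r \<noteq> 3 \<and> r \<noteq> 4 \<and> r \<noteq> 5 \<longrightarrow> e' r = e2 r)"
      by (rule loop[where e = e2, OF vals(1)]) (use vals blank in \<open>simp_all add: prefix_tape_0\<close>)
    then obtain e' where e': "runs s A (loop 3 body) T e2 (T(j := prefix_tape (num_str (e x)) (length (num_str (e x))))) e'"
      "\<And>r. r \<noteq> 3 \<and> r \<noteq> 4 \<and> r \<noteq> 5 \<Longrightarrow> e' r = e2 r"
      by blast
    have "e' r = e r" if "r \<noteq> 3 \<and> r \<noteq> 4 \<and> r \<noteq> 5" for r
      using e'(2)[OF that] that by (simp add: e2_def e1_def)
    then show "\<exists>e'. runs s A (Seq (Seq cl (clear 4)) (loop 3 body)) T e
        (T(j := prefix_tape (num_str (e x)) (length (num_str (e x))))) e' \<and>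
      (\<forall>r. r \<noteq> 3 \<and> r \<noteq> 4 \<and> r \<noteq> 5 \<longrightarrow> e' r = e r)"
      using runs_Seq[OF runs_Seq[OF r1 r2] e'(1)] by blast
  qed
qed

text \<open>The next query has to start from \<open>blank_tape\<close>, which includes the head
  position 0, so the head walks back while it erases.\<close>

lemma erase_program:
  assumes "j < 3" "x < s" "x \<noteq> 3" "3 < s"
  obtains c where "\<And>A T e. T j = prefix_tape (num_str (e x)) (length (num_str (e x))) \<Longrightarrow>
    runs s A c T e (T(j := blank_tape)) (e(3 := 0))"
proof -
  have "recursive (\<lambda>x. length (num_str x))"
    by (intro rec_intros)
  then obtain cl where cl: "\<And>A T e. runs s A cl T e T (e(3 := length (num_str (e x))))"
    by (rule compile_recursive[of _ x s 3]) (use assms in auto)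
  define body where "body = Seq (dec 3) (Seq (Act j None Go_Left) (Act j (Some Blank) Stay))"
  have loop: "runs s A (loop 3 body) T e (T(j := blank_tape)) (e(3 := 0))"
    if "e 3 = l" "T j = prefix_tape u l" for A T e u l
    using that
  proof (induction l arbitrary: T e)
    case 0
    have "T(j := blank_tape) = T" "e(3 := 0) = e"
      using 0 by (auto simp: prefix_tape_0)
    then show ?case
      using runs_loop_stop[of 3 s e A body T] 0 assms by auto
  next
    case (Suc l)
    define e1 where "e1 = e(3 := l)"
    define T1 where "T1 = T(j := act None Go_Left (T j))"
    define T2 where "T2 = T1(j := act (Some Blank) Stay (T1 j))"
    have r1: "runs s A (dec 3) T e T e1"
      unfolding e1_def by (rule runs_dec) (use assms Suc.prems in auto)
    have r2: "runs s A (Act j None Go_Left) T e1 T1 e1"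
      unfolding T1_def by (rule runs_Act[OF assms(1)])
    have r3: "runs s A (Act j (Some Blank) Stay) T1 e1 T2 e1"
      unfolding T2_def by (rule runs_Act[OF assms(1)])
    have body: "runs s A body T e T2 e1"
      unfolding body_def by (rule runs_Seq[OF r1 runs_Seq[OF r2 r3]])
    have "T2 j = prefix_tape u l"
      unfolding T2_def T1_def fun_upd_same Suc.prems(2) by (rule act_erase)
    moreover have "e1 3 = l"
      by (simp add: e1_def)
    ultimately have r4: "runs s A (loop 3 body) T2 e1 (T2(j := blank_tape)) (e1(3 := 0))"
      by (intro Suc.IH)
    have eq: "T2(j := blank_tape) = T(j := blank_tape)" "e1(3 := 0) = e(3 := 0)"
      by (simp_all add: T2_def T1_def e1_def)
    show ?case
      by (rule runs_loop_step[OF _ _ body r4[unfolded eq]]) (use assms Suc.prems in auto)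
  qed
  show ?thesis
  proof (rule that)
    fix A T e
    assume T: "T j = prefix_tape (num_str (e x)) (length (num_str (e x)))"
    have "runs s A (loop 3 body) T (e(3 := length (num_str (e x)))) (T(j := blank_tape))
        ((e(3 := length (num_str (e x))))(3 := 0))"
      by (rule loop) (use T in auto)
    then have "runs s A (loop 3 body) T (e(3 := length (num_str (e x)))) (T(j := blank_tape)) (e(3 := 0))"
      by simp
    from runs_Seq[OF cl this] show "runs s A (Seq cl (loop 3 body)) T e (T(j := blank_tape)) (e(3 := 0))" .
  qed
qed

text \<open>Collecting the answers as the binary digits of one number turns the oracle into an
  ordinary argument of a recursive function. Register 1 runs through the positions from the top
  downwards.\<close>

lemma oracle_program:
  assumes "5 < s"
  obtains c where "\<And>A T e. T 1 = blank_tape \<Longrightarrow> \<exists>e'. runs s A c T e T e' \<and> e' 0 = e 0 \<and>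
    e' 2 = e 2 + (\<Sum>q<e 1. of_bool (num_str q \<in> A) * 2 ^ q)"
proof -
  obtain cw where cw: "\<And>A T e. T 1 = blank_tape \<Longrightarrow> \<exists>e'.
    runs s A cw T e (T(1 := prefix_tape (num_str (e 1)) (length (num_str (e 1))))) e' \<and>
    (\<forall>r. r \<noteq> 3 \<and> r \<noteq> 4 \<and> r \<noteq> 5 \<longrightarrow> e' r = e r)"
    by (rule write_program[of 1 1 s]) (use assms that in auto)
  obtain ce where ce: "\<And>A T e. T 1 = prefix_tape (num_str (e 1)) (length (num_str (e 1))) \<Longrightarrow>
    runs s A ce T e (T(1 := blank_tape)) (e(3 := 0))"
    by (rule erase_program[of 1 1 s]) (use assms that in auto)
  have "recursive2 (\<lambda>b q. b + 2 ^ q)"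
    by (intro rec_intros)
  then obtain cb where cb: "\<And>A T e. runs s A cb T e T (e(2 := e 2 + 2 ^ e 1))"
    by (rule compile_recursive2[of _ 2 s 1 2]) (use assms in auto)
  define body where "body = Seq (Seq (dec 1) cw) (Seq (Query cb Skip) ce)"
  have loop: "\<exists>e'. runs s A (loop 1 body) T e T e' \<and> e' 0 = e 0 \<and>
    e' 2 = e 2 + (\<Sum>q<m. of_bool (num_str q \<in> A) * 2 ^ q)"
    if "e 1 = m" "T 1 = blank_tape" for A T e m
    using that(1)
  proof (induction m arbitrary: e)
    case 0
    then show ?case
      using runs_loop_stop[of 1 s e A body T] assms by (intro exI[of _ e]) auto
  next
    case (Suc m)
    define e1 where "e1 = e(1 := m)"
    let ?u = "num_str m"
    define T1 where "T1 = T(1 := prefix_tape ?u (length ?u))"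
    have r1: "runs s A (dec 1) T e T e1"
      unfolding e1_def by (rule runs_dec) (use assms Suc.prems in auto)
    have "e1 1 = m" by (simp add: e1_def)
    with cw[where T = T and e = e1 and A = A, OF that(2)] obtain e2 where r2: "runs s A cw T e1 T1 e2"
      and e2: "\<And>r. r \<noteq> 3 \<and> r \<noteq> 4 \<and> r \<noteq> 5 \<Longrightarrow> e2 r = e1 r"
      unfolding T1_def by auto
    define e3 where "e3 = e2(2 := e2 2 + of_bool (?u \<in> A) * 2 ^ m)"
    have "e2 1 = m"
      using e2[of 1] by (simp add: e1_def)
    have r3: "runs s A (Query cb Skip) T1 e2 T1 e3"
    proof (rule runs_Query)
      have ts: "tape_string (T1 1) = ?u"
        by (simp add: T1_def tape_string_prefix_tape)
      show "runs s A cb T1 e2 T1 e3" if "tape_string (T1 1) \<in> A"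
        using cb[of A T1 e2] that ts \<open>e2 1 = m\<close> by (simp add: e3_def)
      have "e3 = e2" if "tape_string (T1 1) \<notin> A"
        using that ts by (simp add: e3_def)
      then show "runs s A Skip T1 e2 T1 e3" if "tape_string (T1 1) \<notin> A"
        using that by (simp add: runs_Skip)
    qed
    have "e3 1 = m"
      using \<open>e2 1 = m\<close> by (simp add: e3_def)
    then have "T1 1 = prefix_tape (num_str (e3 1)) (length (num_str (e3 1)))"
      by (simp add: T1_def)
    from ce[where T = T1 and e = e3 and A = A, OF this] have "runs s A ce T1 e3 (T1(1 := blank_tape)) (e3(3 := 0))" .
    moreover have "T1(1 := blank_tape) = T"
      using that(2) by (auto simp: T1_def)
    ultimately have r4: "runs s A ce T1 e3 T (e3(3 := 0))" by simp
    define e4 where "e4 = e3(3 := 0)"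
    have body: "runs s A body T e T e4"
      unfolding body_def e4_def by (rule runs_Seq[OF runs_Seq[OF r1 r2] runs_Seq[OF r3 r4]])
    have vals: "e4 1 = m" "e4 0 = e 0" "e4 2 = e 2 + of_bool (?u \<in> A) * 2 ^ m"
      using \<open>e3 1 = m\<close> e2[of 0] e2[of 2] by (simp_all add: e4_def e3_def e1_def)
    from Suc.IH[where e = e4, OF vals(1)] obtain e' where e': "runs s A (loop 1 body) T e4 T e'" "e' 0 = e4 0"
      "e' 2 = e4 2 + (\<Sum>q<m. of_bool (num_str q \<in> A) * 2 ^ q)"
      by blast
    have "runs s A (loop 1 body) T e T e'"
      by (rule runs_loop_step[OF _ _ body e'(1)]) (use assms Suc.prems in auto)
    then show ?case
      using e'(2,3) vals by (intro exI[of _ e']) simp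
  qed
  show ?thesis
    by (rule that[of "loop 1 body"]) (rule loop[OF refl])
qed

text \<open>Scanning from the left follows the recursion of \<open>str_num\<close> for an appended
  digit. The head on the input tape is not brought back, so \<open>T'\<close> is specified on the
  oracle and output tapes only.\<close>

lemma read_program:
  assumes "0 < s"
  obtains c where "\<And>A T e x. T 0 = string_tape x \<Longrightarrow> e 0 = 0 \<Longrightarrow>
    \<exists>T' e'. runs s A c T e T' e' \<and> e' 0 = str_num x \<and> T' 1 = T 1 \<and> T' 2 = T 2"
proof -
  have "recursive (\<lambda>v. 2 * v + 2)" "recursive (\<lambda>v. 2 * v + 1)"
    by (intro rec_intros)+
  obtain c2 where c2: "\<And>A T e. runs s A c2 T e T (e(0 := 2 * e 0 + 2))"
    by (rule compile_recursive[OF \<open>recursive (\<lambda>v. 2 * v + 2)\<close>, of 0 s 0]) (use assms in auto)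
  obtain c1 where c1: "\<And>A T e. runs s A c1 T e T (e(0 := 2 * e 0 + 1))"
    by (rule compile_recursive[OF \<open>recursive (\<lambda>v. 2 * v + 1)\<close>, of 0 s 0]) (use assms in auto)
  define body where "body = Seq (If 0 {Bit True} c2 c1) (Act 0 None Go_Right)"
  define W where "W = While 0 {Bit False, Bit True} body"
  have loop: "\<exists>T' e'. runs s A W T e T' e' \<and> e' 0 = str_num x \<and> T' 1 = T 1 \<and> T' 2 = T 2"
    if "T 0 = (fst (string_tape x), int i)" "i + l = length x" "e 0 = str_num (take i x)" for A T e x i l
    using that
  proof (induction l arbitrary: T e i)
    case 0
    have "tape_read (T 0) \<notin> {Bit False, Bit True}"
      using 0 by (simp add: string_tape_def)
    then have "runs s A W T e T e"
      unfolding W_def by (intro runs_While_stop) auto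
    then show ?case
      using 0 by auto
  next
    case (Suc l)
    have i: "i < length x" using Suc.prems by simp
    have read: "tape_read (T 0) = Bit (x ! i)"
      using Suc.prems(1) i by (simp add: string_tape_def)
    define e1 where "e1 = e(0 := str_num (take (Suc i) x))"
    define T1 where "T1 = T(0 := act None Go_Right (T 0))"
    have val: "str_num (take (Suc i) x) = 2 * e 0 + (if x ! i then 2 else 1)"
      unfolding take_Suc_conv_app_nth[OF i] Suc.prems(3) by simp
    have r1: "runs s A (If 0 {Bit True} c2 c1) T e T e1"
      unfolding e1_def val
      by (rule runs_If) (use c1[of A T e] c2[of A T e] in \<open>simp_all add: read\<close>)
    have r2: "runs s A (Act 0 None Go_Right) T e1 T1 e1"
      unfolding T1_def by (rule runs_Act) simp
    have body: "runs s A body T e T1 e1"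
      unfolding body_def by (rule runs_Seq[OF r1 r2])
    have "T1 0 = (fst (string_tape x), int (Suc i))"
      using Suc.prems(1) by (simp add: T1_def act_None)
    moreover have "Suc i + l = length x" "e1 0 = str_num (take (Suc i) x)"
      using Suc.prems(2) by (simp_all add: e1_def)
    ultimately obtain T' e' where
      r: "runs s A W T1 e1 T' e'" "e' 0 = str_num x" "T' 1 = T1 1" "T' 2 = T1 2"
      using Suc.IH[where T = T1 and i = "Suc i" and e = e1] by blast
    have "runs s A W T e T' e'"
      using r(1) unfolding W_def by (intro runs_While_step[OF _ _ body]) (auto simp: read)
    then show ?case
      using r by (intro exI[of _ T'] exI[of _ e']) (simp add: T1_def)
  qed
  show ?thesis
  proof (rule that[of W])
    fix A and T :: "nat \<Rightarrow> tape" and e :: "nat \<Rightarrow> nat" and x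
    assume "T 0 = string_tape x" "e 0 = 0"
    then show "\<exists>T' e'. runs s A W T e T' e' \<and> e' 0 = str_num x \<and> T' 1 = T 1 \<and> T' 2 = T 2"
      by (intro loop[where i = 0 and l = "length x"]) (simp_all add: string_tape_def)
  qed
qed

section \<open>A machine for a recursive function of input and oracle\<close>

primrec init_registers :: "nat \<Rightarrow> com" where
  "init_registers 0 = Skip"
| "init_registers (Suc r) = Seq (init_registers r) (Act (r + 3) (Some (Mark 0)) Stay)"

lemma tapes_used_init_registers: "tapes_used (init_registers r) \<le> r + 3"
  by (induction r) auto

text \<open>Tapes start blank, whereas a register must show \<open>Mark 0\<close> in cell 0.
  \<open>store_of\<close> has infinitely many registers; those from \<open>R\<close> on belong to no
  tape of the machine and are given their final form from the outset.\<close>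

lemma exec_init_registers:
  "exec A (init_registers R) (\<lambda>i. if i = 0 then string_tape x else if i < R + 3 then blank_tape else register_tape 0)
    (store_of (\<lambda>i. if i = 0 then string_tape x else blank_tape) (\<lambda>_. 0))"
proof -
  define F where "F r = (\<lambda>i. if i = 0 then string_tape x else if 3 \<le> i \<and> i < r + 3 then register_tape 0
    else if i < R + 3 then blank_tape else register_tape 0)" for r
  have act: "act (Some (Mark 0)) Stay blank_tape = register_tape 0"
    by (auto simp: act_def blank_tape_def register_tape_def)
  have "r \<le> R \<Longrightarrow> exec A (init_registers r) (F 0) (F r)" for r
  proof (induction r)
    case 0
    show ?case by (simp add: exec_Skip)
  next
    case (Suc r)
    have "exec A (Act (r + 3) (Some (Mark 0)) Stay) (F r) ((F r)(r + 3 := act (Some (Mark 0)) Stay (F r (r + 3))))"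
      by (rule exec_Act)
    moreover have "F r (r + 3) = blank_tape"
      using Suc.prems by (simp add: F_def)
    moreover have "(F r)(r + 3 := register_tape 0) = F (Suc r)"
      by (rule ext) (auto simp: F_def)
    ultimately have "exec A (Act (r + 3) (Some (Mark 0)) Stay) (F r) (F (Suc r))"
      by (simp only: act)
    with Suc show ?case
      by (auto intro: exec_Seq)
  qed
  then have "exec A (init_registers R) (F 0) (F R)" by simp
  moreover have "F 0 = (\<lambda>i. if i = 0 then string_tape x else if i < R + 3 then blank_tape else register_tape 0)"
    by (rule ext) (auto simp: F_def)
  moreover have "F R = store_of (\<lambda>i. if i = 0 then string_tape x else blank_tape) (\<lambda>_. 0)"
    by (rule ext) (auto simp: F_def store_of_def)
  ultimately show ?thesis by simp
qed

text \<open>The \<open>2 ^ Suc n - 1\<close> positions queried are exactly the strings of length at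
  most \<open>n\<close>. \<open>G\<close> may be partial, since convergence is required only at the
  number that codes the actual oracle.\<close>

lemma oracle_computation:
  assumes G: "partial_recursive G"
  obtains M where "oracle_machine M"
    "\<And>n A y. G (npair n (\<Sum>q<2 ^ Suc n - 1. of_bool (num_str q \<in> A) * 2 ^ q)) = Some y \<Longrightarrow>
      otm_output M A (num_str n) = Some (num_str y)"
proof -
  \<comment> \<open>Registers 0 to 6 are used. The result of \<open>G\<close> is put into 6 because
    \<open>write_program\<close> overwrites 3, 4 and 5.\<close>
  define s :: nat where "s = 7"
  obtain c1 where c1: "\<And>A T e x. T 0 = string_tape x \<Longrightarrow> e 0 = 0 \<Longrightarrow>
    \<exists>T' e'. runs s A c1 T e T' e' \<and> e' 0 = str_num x \<and> T' 1 = T 1 \<and> T' 2 = T 2"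
    by (rule read_program[of s]) (use that in \<open>auto simp: s_def\<close>)
  have "recursive (\<lambda>n. 2 ^ Suc n - 1)"
    by (intro rec_intros)
  then obtain c2 where c2: "\<And>A T e. runs s A c2 T e T (e(1 := 2 ^ Suc (e 0) - 1))"
    by (rule compile_recursive[of _ 0 s 1]) (auto simp: s_def)
  obtain c3 where c3: "\<And>A T e. T 1 = blank_tape \<Longrightarrow> \<exists>e'. runs s A c3 T e T e' \<and> e' 0 = e 0 \<and>
    e' 2 = e 2 + (\<Sum>q<e 1. of_bool (num_str q \<in> A) * 2 ^ q)"
    by (rule oracle_program[of s]) (use that in \<open>auto simp: s_def\<close>)
  have "recursive2 npair"
    by (intro rec_intros)
  then obtain c4 where c4: "\<And>A T e. runs s A c4 T e T (e(3 := npair (e 0) (e 2)))"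
    by (rule compile_recursive2[of _ 0 s 2 3]) (auto simp: s_def)
  obtain c5 where c5: "\<And>A T e v. G (e 3) = Some v \<Longrightarrow> runs s A c5 T e T (e(6 := v))"
    by (rule compile_partial_recursive[OF G, of 3 s 6]) (auto simp: s_def)
  obtain c6 where c6: "\<And>A T e. T 2 = blank_tape \<Longrightarrow> \<exists>e'.
    runs s A c6 T e (T(2 := prefix_tape (num_str (e 6)) (length (num_str (e 6))))) e' \<and>
    (\<forall>r. r \<noteq> 3 \<and> r \<noteq> 4 \<and> r \<noteq> 5 \<longrightarrow> e' r = e r)"
    by (rule write_program[of 2 6 s]) (use that in \<open>auto simp: s_def\<close>)
  define main where "main = Seq (Seq c1 c2) (Seq (Seq (clear 2) c3) (Seq (Seq c4 c5) c6))"
  define R where "R = tapes_used main"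
  define prog where "prog = Seq (init_registers R) main"
  have used: "tapes_used prog \<le> R + 3" "3 \<le> R + 3"
    using tapes_used_init_registers[of R] by (simp_all add: prog_def R_def)
  show ?thesis
  proof (rule that)
    show "oracle_machine (machine prog (R + 3))"
      by (rule oracle_machine_machine[OF used(2,1)])
    fix n A y
    assume y: "G (npair n (\<Sum>q<2 ^ Suc n - 1. of_bool (num_str q \<in> A) * 2 ^ q)) = Some y"
    define x where "x = num_str n"
    define T0 where "T0 i = (if i = 0 then string_tape x else blank_tape)" for i :: nat
    have "T0 0 = string_tape x" by (simp add: T0_def)
    from c1[where T = T0 and e = "\<lambda>_. 0" and A = A, OF this] obtain T1 e1 where
      r1: "runs s A c1 T0 (\<lambda>_. 0) T1 e1" "e1 0 = n" "T1 1 = blank_tape" "T1 2 = blank_tape"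
      by (auto simp: T0_def x_def)
    define e2 where "e2 = e1(1 := 2 ^ Suc (e1 0) - 1)"
    have r2: "runs s A c2 T1 e1 T1 e2"
      unfolding e2_def by (rule c2)
    define e3 where "e3 = e2(2 := 0)"
    have r3: "runs s A (clear 2) T1 e2 T1 e3"
      unfolding e3_def by (rule runs_clear)
    from c3[where T = T1 and e = e3 and A = A, OF r1(3)] obtain e4 where r4: "runs s A c3 T1 e3 T1 e4" "e4 0 = e3 0"
      "e4 2 = e3 2 + (\<Sum>q<e3 1. of_bool (num_str q \<in> A) * 2 ^ q)"
      by blast
    define e5 where "e5 = e4(3 := npair (e4 0) (e4 2))"
    have r5: "runs s A c4 T1 e4 T1 e5"
      unfolding e5_def by (rule c4)
    have "e5 3 = npair n (\<Sum>q<2 ^ Suc n - 1. of_bool (num_str q \<in> A) * 2 ^ q)"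
      using r1(2) r4(2,3) by (simp add: e5_def e3_def e2_def)
    then have "G (e5 3) = Some y"
      using y by (simp only:)
    then have r6: "runs s A c5 T1 e5 T1 (e5(6 := y))"
      by (rule c5)
    from c6[where T = T1 and e = "e5(6 := y)" and A = A, OF r1(4)] obtain e7 where
      r7: "runs s A c6 T1 (e5(6 := y)) (T1(2 := prefix_tape (num_str y) (length (num_str y)))) e7"
      by auto
    have "runs s A main T0 (\<lambda>_. 0) (T1(2 := prefix_tape (num_str y) (length (num_str y)))) e7"
      unfolding main_def
      by (rule runs_Seq[OF runs_Seq[OF r1(1) r2] runs_Seq[OF runs_Seq[OF r3 r4(1)] runs_Seq[OF runs_Seq[OF r5 r6] r7]]])
    then obtain e8 where ex: "exec A main (store_of T0 (\<lambda>_. 0))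
        (store_of (T1(2 := prefix_tape (num_str y) (length (num_str y)))) e8)"
      by (rule runsE[OF _ agree_refl])
    have "exec A prog (\<lambda>i. if i = 0 then string_tape x else if i < R + 3 then blank_tape else register_tape 0)
        (store_of (T1(2 := prefix_tape (num_str y) (length (num_str y)))) e8)"
      unfolding prog_def
      by (rule exec_Seq[OF exec_init_registers ex[unfolded T0_def]])
    from machine_output[OF this used(2,1), of x]
    have "otm_output (machine prog (R + 3)) A x = Some (tape_string (prefix_tape (num_str y) (length (num_str y))))"
      by (simp add: store_of_def)
    then show "otm_output (machine prog (R + 3)) A (num_str n) = Some (num_str y)"
      by (simp add: tape_string_prefix_tape x_def)
  qed
qed

section \<open>Summability yields a machine\<close>

text \<open>The components of a pair are at most its code, so the codes below \<open>N\<close> come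
  from the triples in a cube of side \<open>N\<close>.\<close>

lemma sum_triples_le:
  fixes F :: "nat \<Rightarrow> real"
  assumes "\<And>i. 0 \<le> F i"
  shows "(\<Sum>i<N. F i) \<le> (\<Sum>d<N. \<Sum>n<N. \<Sum>a<N. F (npair d (npair n a)))"
proof -
  define h where "h = (\<lambda>(d, n, a). npair d (npair n a))"
  have inj: "inj_on h X" for X
    by (auto simp: inj_on_def h_def)
  have "{..<N} \<subseteq> h ` ({..<N} \<times> {..<N} \<times> {..<N})"
  proof
    fix i assume "i \<in> {..<N}"
    then have "nfst i < N" "nfst (nsnd i) < N" "nsnd (nsnd i) < N"
      using nfst_le[of i] nsnd_le[of i] nfst_le[of "nsnd i"] nsnd_le[of "nsnd i"] by auto
    then show "i \<in> h ` ({..<N} \<times> {..<N} \<times> {..<N})"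
      by (intro image_eqI[of _ _ "(nfst i, nfst (nsnd i), nsnd (nsnd i))"]) (auto simp: h_def)
  qed
  then have "(\<Sum>i<N. F i) \<le> (\<Sum>i\<in>h ` ({..<N} \<times> {..<N} \<times> {..<N}). F i)"
    by (intro sum_mono2) (auto intro: assms)
  also have "\<dots> = (\<Sum>t\<in>{..<N} \<times> {..<N} \<times> {..<N}. F (h t))"
    by (subst sum.reindex[OF inj]) simp
  also have "\<dots> = (\<Sum>d<N. \<Sum>n<N. \<Sum>a<N. F (npair d (npair n a)))"
    unfolding sum.cartesian_product by (intro sum.cong refl) (auto simp: h_def)
  finally show ?thesis .
qed

lemma odd_div_sum_powers:
  assumes "q < m"
  shows "odd ((\<Sum>q<m. of_bool (P q) * 2 ^ q :: nat) div 2 ^ q) \<longleftrightarrow> P q"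
proof -
  have "(\<Sum>q<m. of_bool (P q) * 2 ^ q :: nat) = set_encode {q. q < m \<and> P q}"
    unfolding set_encode_def by (intro sum.mono_neutral_cong_right) auto
  then have "odd ((\<Sum>q<m. of_bool (P q) * 2 ^ q :: nat) div 2 ^ q) \<longleftrightarrow> q \<in> set_decode (set_encode {q. q < m \<and> P q})"
    by (simp add: set_decode_def)
  also have "\<dots> \<longleftrightarrow> P q"
    using assms by (subst set_encode_inverse) auto
  finally show ?thesis .
qed

text \<open>For every \<open>n\<close> and every candidate \<open>a\<close> for the first \<open>n - f n - O(1)\<close> digits of
  \<open>Omega W\<close>, request a program of length \<open>n - O(1)\<close> for a stage at which \<open>Omega W\<close> has
  been approximated up to \<open>a\<close>. Optimality of \<open>V\<close> turns it into an element of the domain of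
  length at most \<open>n\<close>. Its constant is unknown beforehand, so the requests are made for all
  constants \<open>d\<close> at once, with weights \<open>1 / 2 ^ d\<close>.\<close>

lemma machine_of_summable:
  assumes V: "optimal_computer V" and W: "optimal_computer W" and f: "total_recursive_pos f"
    and sum: "summable (\<lambda>n. 1 / 2 ^ f (Suc n) :: real)"
  shows "\<exists>M (c::nat). oracle_machine M \<and>
    (\<forall>n::nat. 1 \<le> n \<longrightarrow> otm_output M (set_upto (dom V) (int n)) (num_str n) =
      Some (real_prefix (Omega W) (int n - int (f n) - int c)))"
proof -
  obtain g where g: "recursive g" "\<And>n. 1 \<le> n \<Longrightarrow> g n = f n"
    by (rule total_recursive_pos_extend[OF f]) (rule that)
  have "computer V" "computer W"
    using V W unfolding optimal_computer_def by blast+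
  obtain SV where "staged_computer V SV"
    by (rule staged_computer_exists[OF \<open>computer V\<close>])
  then interpret V: staged_computer V SV .
  obtain SW where "staged_computer W SW"
    by (rule staged_computer_exists[OF \<open>computer W\<close>])
  then interpret W: staged_computer W SW .
  obtain e :: nat where e: "(\<Sum>n. 1 / 2 ^ f (Suc n) :: real) < 2 ^ e"
    using real_arch_pow[of 2 "\<Sum>n. 1 / 2 ^ f (Suc n) :: real"] by auto
  have sum_g: "(\<Sum>n<N. of_bool (1 \<le> n) / 2 ^ g n :: real) \<le> 2 ^ e" for N
  proof (cases N)
    case (Suc M)
    have "(\<Sum>n<Suc M. of_bool (1 \<le> n) / 2 ^ g n :: real) = (\<Sum>n<M. 1 / 2 ^ f (Suc n))"
      unfolding sum.lessThan_Suc_shift by (simp add: g(2))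
    also have "\<dots> \<le> (\<Sum>n. 1 / 2 ^ f (Suc n))"
      by (rule sum_le_suminf[OF sum]) auto
    finally show ?thesis
      using e Suc by simp
  qed simp
  \<comment> \<open>For given \<open>d\<close> and \<open>n\<close> there are
    \<open>2 ^ (n - (g n + w d))\<close> candidates, each with a request of length
    \<open>n - d\<close>, which together weigh \<open>1 / 2 ^ (g n + d + e + 1)\<close>. One
    \<open>d\<close> in \<open>w d\<close> pays for the shorter programs, the other for the weight
    of the constant; \<open>e\<close> absorbs the sum over \<open>n\<close>, and 1 the sum over
    \<open>d\<close>.\<close>
  define w where "w d = 2 * d + e + 1" for d
  define I where "I i \<longleftrightarrow> 1 \<le> nfst (nsnd i) \<and> g (nfst (nsnd i)) + w (nfst i) \<le> nfst (nsnd i) \<and>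
    nsnd (nsnd i) < 2 ^ (nfst (nsnd i) - (g (nfst (nsnd i)) + w (nfst i)))" for i
  define L where "L i = nfst (nsnd i) - nfst i" for i
  \<comment> \<open>A candidate above the true digits is reached at no stage; the search for its
    request does not end.\<close>
  define R where "R i k \<longleftrightarrow> nsnd (nsnd i) \<le> W.trunc (nfst (nsnd i) - (g (nfst (nsnd i)) + w (nfst i))) k" for i k
  have rec: "decidable I" "recursive L" "decidable2 R"
    unfolding I_def L_def R_def w_def
    by (intro rec_intros recursive_comp[OF g(1)] W.recursive_trunc)+
  have "(\<Sum>i<N. of_bool (I i) / 2 ^ L i :: real) \<le> 1" for N
  proof -
    have "(\<Sum>i<N. of_bool (I i) / 2 ^ L i :: real)
        \<le> (\<Sum>d<N. \<Sum>n<N. \<Sum>a<N. of_bool (I (npair d (npair n a))) / 2 ^ L (npair d (npair n a)))"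
      by (rule sum_triples_le) simp
    also have "\<dots> \<le> (\<Sum>d<N. \<Sum>n<N. (1 / 2 ^ (d + e + 1)) * (of_bool (1 \<le> n) / 2 ^ g n))"
    proof (intro sum_mono)
      fix d n
      show "(\<Sum>a<N. of_bool (I (npair d (npair n a))) / 2 ^ L (npair d (npair n a)))
          \<le> (1 / 2 ^ (d + e + 1)) * (of_bool (1 \<le> n) / 2 ^ g n :: real)"
      proof (cases "1 \<le> n \<and> g n + w d \<le> n")
        case True
        define m where "m = n - (g n + w d)"
        have nm: "n - d = m + g n + (d + e + 1)"
          using True unfolding m_def w_def by arith
        have "(\<Sum>a<N. of_bool (I (npair d (npair n a))) / 2 ^ L (npair d (npair n a)) :: real)
            = (\<Sum>a<N. of_bool (a < (2 ^ m :: nat)) / 2 ^ (n - d))"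
          using True by (simp add: I_def L_def m_def)
        also have "\<dots> = (\<Sum>a\<in>{..<N} \<inter> {..<2 ^ m :: nat}. 1 / 2 ^ (n - d))"
          by (intro sum.mono_neutral_cong_right) auto
        also have "\<dots> \<le> (\<Sum>a\<in>{..<2 ^ m :: nat}. 1 / 2 ^ (n - d))"
          by (intro sum_mono2) auto
        also have "\<dots> = (1 / 2 ^ (d + e + 1)) * (1 / 2 ^ g n)"
          unfolding nm by (simp add: power_add)
        finally show ?thesis
          using True by simp
      qed (simp add: I_def)
    qed
    also have "\<dots> \<le> (\<Sum>d<N. (1 / 2 ^ (d + e + 1)) * 2 ^ e)"
      unfolding sum_distrib_left[symmetric] by (intro sum_mono mult_left_mono sum_g) simp
    also have "\<dots> = (\<Sum>d<N. 1 / 2 ^ Suc d)"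
      by (simp add: power_add)
    also have "\<dots> = 1 - 1 / 2 ^ N"
      by (induction N) (auto simp: field_simps)
    finally show ?thesis
      by (simp add: order_trans[of _ "1 - 1 / 2 ^ N"])
  qed
  from computer_with_lengths[OF rec(1,2) this rec(3)] obtain C where C: "computer C"
    "\<And>i k. I i \<Longrightarrow> R i k \<Longrightarrow> \<exists>p k'. length p = Suc (L i) \<and> C p = Some (num_str k') \<and> R i k'"
    by blast
  obtain d0 where d0: "\<forall>p\<in>dom C. \<exists>q. V q = C p \<and> length q \<le> length p + d0"
    using V C(1) unfolding optimal_computer_def by blast
  \<comment> \<open>The additional bit of the code words is charged to the constant:
    \<open>Suc (n - d) + d0 = n\<close> for \<open>d \<le> n\<close>.\<close>
  define d where "d = Suc d0"
  define c where "c = w d"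
  define m where "m n = n - (g n + c)" for n
  have m: "nat (int n - int (f n) - int c) = m n" if "1 \<le> n" for n
    using g(2)[OF that] by (simp add: m_def)
  \<comment> \<open>All programs marked in the oracle number have halted by stage \<open>k\<close>.
    Such a stage exists for the true oracle; for other numbers \<open>G\<close> may be
    undefined.\<close>
  define P where "P x k \<longleftrightarrow> (\<forall>q<2 ^ Suc (nfst x) - 1. odd (nsnd x div 2 ^ q) \<longrightarrow> SV k q \<noteq> 0)" for x k
  \<comment> \<open>Every nonzero \<open>SV k q\<close> is \<open>Suc\<close> of an output, so the
    sum is a stage beyond the outputs of all marked programs.\<close>
  define K where "K x k = (\<Sum>q<2 ^ Suc (nfst x) - 1. of_bool (odd (nsnd x div 2 ^ q)) * SV k q)" for x k
  \<comment> \<open>By \<open>bval_num_str\<close> this is the position of the string of length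
    \<open>m n\<close> whose binary value is the truncation.\<close>
  define h where "h x k = 2 ^ m (nfst x) - 1 + W.trunc (m (nfst x)) (K x k)" for x k
  define G where "G x = (if \<exists>k. P x k then Some (h x (LEAST k. P x k)) else None)" for x
  have "partial_recursive G"
    unfolding G_def
  proof (rule partial_recursive_search)
    show "decidable2 P"
      unfolding P_def by (intro rec_intros V.recursive_S_app)
    show "recursive2 h"
      unfolding h_def K_def m_def
      by (intro rec_intros V.recursive_S_app W.recursive_trunc recursive_comp[OF g(1)])
  qed
  then obtain M where M: "oracle_machine M"
    "\<And>n A y. G (npair n (\<Sum>q<2 ^ Suc n - 1. of_bool (num_str q \<in> A) * 2 ^ q)) = Some y \<Longrightarrow>
      otm_output M A (num_str n) = Some (num_str y)"
    by (rule oracle_computation) (rule that, assumption+)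
  have "otm_output M (set_upto (dom V) (int n)) (num_str n) =
      Some (real_prefix (Omega W) (int n - int (f n) - int c))" if n: "1 \<le> n" for n
  proof -
    let ?A = "set_upto (dom V) (int n)"
    define r where "r = real_prefix (Omega W) (int n - int (f n) - int c)"
    define b where "b = (\<Sum>q<2 ^ Suc n - 1. of_bool (num_str q \<in> ?A) * 2 ^ q :: nat)"
    define x where "x = npair n b"
    have bit: "odd (b div 2 ^ q) \<longleftrightarrow> num_str q \<in> ?A" if "q < 2 ^ Suc n - 1" for q
      unfolding b_def by (rule odd_div_sum_powers[OF that])
    have P: "P x k \<longleftrightarrow> (\<forall>q<2 ^ Suc n - 1. num_str q \<in> ?A \<longrightarrow> SV k q \<noteq> 0)" for k
      unfolding P_def x_def nfst_npair nsnd_npair using bit by blast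
    have "\<forall>\<^sub>F k in sequentially. \<forall>q\<in>{q. q < 2 ^ Suc n - 1 \<and> num_str q \<in> ?A}. q \<in> V.D k"
      by (intro eventually_ball_finite ballI V.eventually_D) (auto simp: set_upto_def)
    then obtain k where "\<forall>q\<in>{q. q < 2 ^ Suc n - 1 \<and> num_str q \<in> ?A}. q \<in> V.D k"
      by (auto simp: eventually_sequentially)
    then have "P x k"
      unfolding P V.D_def by blast
    then have ex: "\<exists>k. P x k" by blast
    define t where "t = (LEAST k. P x k)"
    have t: "P x t"
      unfolding t_def using ex by (rule LeastI_ex)
    have Gx: "G x = Some (h x t)"
      unfolding G_def t_def using ex by simp
    \<comment> \<open>No stage exceeds the true digits, so a stage that reaches them shows them
      exactly.\<close>
    have upper: "W.trunc (m n) j \<le> bval r" for j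
      using W.trunc_le_Omega[OF W, of "int n - int (f n) - int c" j] m[OF n] by (simp add: r_def)
    have "W.trunc (m n) (K x t) = bval r"
    \<comment> \<open>In the negative case no digit is asked for, and no request was made for this
      \<open>n\<close> with the constant \<open>d\<close>.\<close>
    proof (cases "g n + c \<le> n")
      case False
      then have "length r = 0"
        using m[OF n] by (simp add: r_def m_def)
      then show ?thesis
        using upper[of "K x t"] by simp
    next
      case True
      have len: "length r = m n"
        using m[OF n] by (simp add: r_def)
      define i where "i = npair d (npair n (bval r))"
      have "I i"
        using n True bval_less[of r] len by (simp add: I_def i_def c_def m_def)
      obtain k where "W.trunc (m n) k = bval r"
        using W.eventually_trunc[OF W, of "int n - int (f n) - int c"] m[OF n]
        by (auto simp: eventually_sequentially r_def)
      then have "R i k"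
        by (simp add: R_def i_def c_def m_def)
      with C(2)[OF \<open>I i\<close>] obtain p k' where p: "length p = Suc (L i)" "C p = Some (num_str k')" "R i k'"
        by blast
      have lower: "bval r \<le> W.trunc (m n) k'"
        using p(3) by (simp add: R_def i_def c_def m_def)
      have "p \<in> dom C"
        using p(2) by (simp add: domIff)
      with d0 obtain q where q: "V q = C p" "length q \<le> length p + d0" by blast
      have "d \<le> n"
        using True by (simp add: c_def w_def)
      then have "length q \<le> n"
        using q(2) p(1) by (simp add: L_def i_def d_def)
      have "q \<in> ?A"
        using \<open>length q \<le> n\<close> q(1) p(2) by (auto simp: set_upto_def domIff)
      define j where "j = str_num q"
      have j: "j < 2 ^ Suc n - 1" "num_str j \<in> ?A"
        using \<open>q \<in> ?A\<close> \<open>length q \<le> n\<close> length_le_iff_str_num[of q n] by (simp_all add: j_def)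
      then have "SV t j \<noteq> 0"
        using t unfolding P by blast
      then obtain v where v: "SV t j = Suc v"
        by (metis not0_implies_Suc)
      have "num_str v = num_str k'"
        using V.S_sound[OF v] q(1) p(2) by (simp add: j_def)
      then have "v = k'"
        by (metis str_num_num_str)
      have "of_bool (odd (nsnd x div 2 ^ j)) * SV t j \<le> K x t"
        unfolding K_def using j(1) by (intro member_le_sum[of j "{..<2 ^ Suc (nfst x) - 1}"
          "\<lambda>q. of_bool (odd (nsnd x div 2 ^ q)) * SV t q"]) (auto simp: x_def)
      then have "k' \<le> K x t"
        using bit[OF j(1)] j(2) v \<open>v = k'\<close> by (simp add: x_def)
      then have "bval r \<le> W.trunc (m n) (K x t)"
        using lower W.trunc_mono[of k' "K x t" "m n"] by linarith
      with upper[of "K x t"] show ?thesis by simp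
    qed
    moreover have "length r = m n"
      using m[OF n] by (simp add: r_def)
    ultimately have "Suc (h x t) = Suc (str_num r)"
      unfolding Suc_str_num h_def by (simp add: x_def)
    then have "num_str (h x t) = r"
      by simp
    moreover have "otm_output M ?A (num_str n) = Some (num_str (h x t))"
      by (rule M(2)) (use Gx in \<open>simp only: x_def b_def\<close>)
    ultimately show ?thesis
      by (simp add: r_def)
  qed
  with M(1) show ?thesis by blast
qed

theorem theorem3p1:
  fixes V W :: "str \<Rightarrow> str option" and f :: "nat \<Rightarrow> nat"
  assumes "optimal_computer V" and "optimal_computer W" and "total_recursive_pos f"
  shows "(\<exists>M (c::nat). oracle_machine M \<and>
            (\<forall>n::nat. 1 \<le> n \<longrightarrow>
              otm_output M (set_upto (dom V) (int n)) (num_str n) =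
                Some (real_prefix (Omega W) (int n - int (f n) - int c))))
         \<longleftrightarrow> summable (\<lambda>n. 1 / 2 ^ f (Suc n) :: real)"
proof
  assume "\<exists>M (c::nat). oracle_machine M \<and>
            (\<forall>n::nat. 1 \<le> n \<longrightarrow>
              otm_output M (set_upto (dom V) (int n)) (num_str n) =
                Some (real_prefix (Omega W) (int n - int (f n) - int c)))"
  then show "summable (\<lambda>n. 1 / 2 ^ f (Suc n) :: real)"
    using summable_of_machine[OF assms] by blast
qed (rule machine_of_summable[OF assms])

end
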